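(* For every GCS $\mathcal{G}=(\mathit{Var},\mathit{Const},\mathit{Act},\Delta,\lambda)$ and every labeled transition system $T=(V,\mathit{Act},\to)$ with finite state set $V$, the maximal weak bisimulation $\approx$ between the transition system $T_{\mathcal{G}}$ of $\mathcal{G}$ and $T$ is effectively gap definable: for each state $s\in V$, the set $\{\nu\in\mathit{Val}\mid \nu\approx s\}$ is gap definable, and a gap formula defining it can be computed from $\mathcal{G}$, $T$ and $s$.
   Context: Fix finite sets $\mathit{Var}$ of variables and $\mathit{Const}\subseteq\mathbb{Z}$ of constants; valuations are maps $\nu:\mathit{Var}\to\mathbb{Z}$ (with $\nu(c)=c$ for constants), forming the set $\mathit{Val}$. A gap clause is $x-y\ge k$ with $x,y\in\mathit{Var}\cup\mathit{Const}$, $k\in\mathbb{Z}$ (positive if $k\in\mathbb{N}$), satisfied by $\nu$ iff $\nu(x)-\nu(y)\ge k$. A gap formula is a Boolean combination of gap clauses; a set of valuations is gap definable if it is the set of valuations satisfying some gap formula. A GCS $\mathcal{G}=(\mathit{Var},\mathit{Const},\mathit{Act},\Delta,\lambda)$ consists of a finite action set $\mathit{Act}$, a finite set $\Delta$ of positive gap constraints (finite conjunctions of positive gap clauses) over $\mathit{Var}\cup\mathit{Var}'\cup\mathit{Const}$ where $\mathit{Var}'=\{x'\mid x\in\mathit{Var}\}$, and $\lambda:\Delta\to\mathit{Act}$; its transition system $T_{\mathcal{G}}$ has states $\mathit{Val}$ and $\nu\xrightarrow{a}\nu'$ iff the assignment $x\mapsto\nu(x)$, $x'\mapsto\nu'(x)$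 satisfies some $C\in\Delta$ with $\lambda(C)=a$. A dedicated action $\tau\in\mathit{Act}$ is unobservable; weak steps are $\stackrel{\tau}{\Rightarrow}=(\xrightarrow{\tau})^*$ and $\stackrel{a}{\Rightarrow}=(\xrightarrow{\tau})^*\cdot\xrightarrow{a}\cdot(\xrightarrow{\tau})^*$ for $a\neq\tau$. A relation $R$ on states of an LTS is a weak bisimulation if $sRt$ implies: for every $s\stackrel{a}{\Rightarrow}s'$ there is $t\stackrel{a}{\Rightarrow}t'$ with $s'Rt'$, and for every $t\stackrel{a}{\Rightarrow}t'$ there is $s\stackrel{a}{\Rightarrow}s'$ with $s'Rt'$. The maximal weak bisimulation between two LTS is the largest weak bisimulation on their disjoint union, projected to pairs with one component from each system. *)

theory Defs
  imports Main "HOL-Library.FuncSet" "HOL-Library.Nat_Bijection"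
begin

section \<open>Gap clauses, gap formulas and gap definable sets\<close>

datatype 'v trm = V 'v | C int

fun trm_val :: "('v \<Rightarrow> int) \<Rightarrow> 'v trm \<Rightarrow> int" where
  "trm_val \<nu> (V x) = \<nu> x"
| "trm_val \<nu> (C c) = c"

text \<open>\<open>Gap t u k\<close> is the clause \<open>t - u \<ge> k\<close>.\<close>

datatype 'v gap_clause = Gap "'v trm" "'v trm" int

fun clause_sat :: "('v \<Rightarrow> int) \<Rightarrow> 'v gap_clause \<Rightarrow> bool" where
  "clause_sat \<nu> (Gap t u k) \<longleftrightarrow> trm_val \<nu> t - trm_val \<nu> u \<ge> k"

definition trms_over :: "'v set \<Rightarrow> int set \<Rightarrow> 'v trm set" where
  "trms_over Vs Cs = V ` Vs \<union> C ` Cs"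

fun clause_over :: "'v set \<Rightarrow> int set \<Rightarrow> 'v gap_clause \<Rightarrow> bool" where
  "clause_over Vs Cs (Gap t u k) \<longleftrightarrow> t \<in> trms_over Vs Cs \<and> u \<in> trms_over Vs Cs"

fun positive_clause :: "'v gap_clause \<Rightarrow> bool" where
  "positive_clause (Gap t u k) \<longleftrightarrow> k \<ge> 0"

text \<open>\<open>FTrue\<close> is the empty conjunction; it is needed as a formula of its own only when there are
  neither variables nor constants, hence no clauses.\<close>

datatype 'v gap_formula =
    FTrue
  | FClause "'v gap_clause"
  | FNot "'v gap_formula"
  | FAnd "'v gap_formula" "'v gap_formula"
  | FOr "'v gap_formula" "'v gap_formula"

fun formula_sat :: "('v \<Rightarrow> int) \<Rightarrow> 'v gap_formula \<Rightarrow> bool" where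
  "formula_sat \<nu> FTrue \<longleftrightarrow> True"
| "formula_sat \<nu> (FClause c) \<longleftrightarrow> clause_sat \<nu> c"
| "formula_sat \<nu> (FNot \<phi>) \<longleftrightarrow> \<not> formula_sat \<nu> \<phi>"
| "formula_sat \<nu> (FAnd \<phi> \<psi>) \<longleftrightarrow> formula_sat \<nu> \<phi> \<and> formula_sat \<nu> \<psi>"
| "formula_sat \<nu> (FOr \<phi> \<psi>) \<longleftrightarrow> formula_sat \<nu> \<phi> \<or> formula_sat \<nu> \<psi>"

fun formula_over :: "'v set \<Rightarrow> int set \<Rightarrow> 'v gap_formula \<Rightarrow> bool" where
  "formula_over Vs Cs FTrue \<longleftrightarrow> True"
| "formula_over Vs Cs (FClause c) \<longleftrightarrow> clause_over Vs Cs c"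
| "formula_over Vs Cs (FNot \<phi>) \<longleftrightarrow> formula_over Vs Cs \<phi>"
| "formula_over Vs Cs (FAnd \<phi> \<psi>) \<longleftrightarrow> formula_over Vs Cs \<phi> \<and> formula_over Vs Cs \<psi>"
| "formula_over Vs Cs (FOr \<phi> \<psi>) \<longleftrightarrow> formula_over Vs Cs \<phi> \<and> formula_over Vs Cs \<psi>"

text \<open>Maps from \<open>Vs\<close> to the integers, represented extensionally (\<open>undefined\<close> outside \<open>Vs\<close>).\<close>

definition Val :: "'v set \<Rightarrow> ('v \<Rightarrow> int) set" where
  "Val Vs = Vs \<rightarrow>\<^sub>E UNIV"

definition defines_set :: "'v set \<Rightarrow> int set \<Rightarrow> 'v gap_formula \<Rightarrow> ('v \<Rightarrow> int) set \<Rightarrow> bool" where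
  "defines_set Vs Cs \<phi> S \<longleftrightarrow> formula_over Vs Cs \<phi> \<and> S = {\<nu> \<in> Val Vs. formula_sat \<nu> \<phi>}"

definition gap_definable :: "'v set \<Rightarrow> int set \<Rightarrow> ('v \<Rightarrow> int) set \<Rightarrow> bool" where
  "gap_definable Vs Cs S \<longleftrightarrow> (\<exists>\<phi>. defines_set Vs Cs \<phi> S)"


section \<open>Labeled transition systems and weak bisimulation\<close>

record ('s, 'a) lts =
  states :: "'s set"
  labels :: "'a set"
  steps :: "('s \<times> 'a \<times> 's) set"

definition wf_lts :: "('s, 'a) lts \<Rightarrow> bool" where
  "wf_lts T \<longleftrightarrow> steps T \<subseteq> states T \<times> labels T \<times> states T"

definition step_rel :: "('s, 'a) lts \<Rightarrow> 'a \<Rightarrow> ('s \<times> 's) set" where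
  "step_rel T a = {(s, s'). (s, a, s') \<in> steps T}"

definition weak_step :: "'a \<Rightarrow> ('s, 'a) lts \<Rightarrow> 'a \<Rightarrow> ('s \<times> 's) set" where
  "weak_step \<tau> T a =
     (if a = \<tau> then (step_rel T \<tau>)\<^sup>*
      else (step_rel T \<tau>)\<^sup>* O step_rel T a O (step_rel T \<tau>)\<^sup>*)"

definition weak_bisimulation :: "'a \<Rightarrow> ('s, 'a) lts \<Rightarrow> ('s \<times> 's) set \<Rightarrow> bool" where
  "weak_bisimulation \<tau> T R \<longleftrightarrow> R \<subseteq> states T \<times> states T \<and>
     (\<forall>(s, t) \<in> R. \<forall>a \<in> labels T.
        (\<forall>s'. (s, s') \<in> weak_step \<tau> T a \<longrightarrow> (\<exists>t'. (t, t') \<in> weak_step \<tau> T a \<and> (s', t') \<in> R)) \<and>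
        (\<forall>t'. (t, t') \<in> weak_step \<tau> T a \<longrightarrow> (\<exists>s'. (s, s') \<in> weak_step \<tau> T a \<and> (s', t') \<in> R)))"

definition max_weak_bisim :: "'a \<Rightarrow> ('s, 'a) lts \<Rightarrow> ('s \<times> 's) set" where
  "max_weak_bisim \<tau> T = \<Union> {R. weak_bisimulation \<tau> T R}"

lemma weak_bisimulation_max_weak_bisim: "weak_bisimulation \<tau> T (max_weak_bisim \<tau> T)"
proof -
  have sub: "R \<subseteq> max_weak_bisim \<tau> T" if "weak_bisimulation \<tau> T R" for R
    using that unfolding max_weak_bisim_def by blast
  show ?thesis
    unfolding weak_bisimulation_def
  proof (intro conjI ballI, goal_cases)
    case 1
    show ?case
      unfolding max_weak_bisim_def weak_bisimulation_def by (rule Union_least) simp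
  next
    case (2 p)
    then obtain R where R: "weak_bisimulation \<tau> T R" "p \<in> R"
      unfolding max_weak_bisim_def by blast
    obtain s t where p: "p = (s, t)" by (cases p)
    show ?case
      unfolding p prod.case
    proof (intro conjI ballI allI impI)
      fix a s' assume "a \<in> labels T" "(s, s') \<in> weak_step \<tau> T a"
      then obtain t' where "(t, t') \<in> weak_step \<tau> T a" "(s', t') \<in> R"
        using R unfolding p weak_bisimulation_def by fastforce
      then show "\<exists>t'. (t, t') \<in> weak_step \<tau> T a \<and> (s', t') \<in> max_weak_bisim \<tau> T"
        using sub[OF R(1)] by blast
    next
      fix a t' assume "a \<in> labels T" "(t, t') \<in> weak_step \<tau> T a"
      then obtain s' where "(s, s') \<in> weak_step \<tau> T a" "(s', t') \<in> R"
        using R unfolding p weak_bisimulation_def by fastforce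
      then show "\<exists>s'. (s, s') \<in> weak_step \<tau> T a \<and> (s', t') \<in> max_weak_bisim \<tau> T"
        using sub[OF R(1)] by blast
    qed
  qed
qed

definition lts_sum :: "('s, 'a) lts \<Rightarrow> ('t, 'a) lts \<Rightarrow> ('s + 't, 'a) lts" where
  "lts_sum S T =
     \<lparr>states = states S <+> states T,
      labels = labels S \<union> labels T,
      steps = {(Inl s, a, Inl s') | s a s'. (s, a, s') \<in> steps S} \<union>
              {(Inr t, a, Inr t') | t a t'. (t, a, t') \<in> steps T}\<rparr>"

definition weak_bisim_between :: "'a \<Rightarrow> ('s, 'a) lts \<Rightarrow> ('t, 'a) lts \<Rightarrow> ('s \<times> 't) set" where
  "weak_bisim_between \<tau> S T = {(s, t). (Inl s, Inr t) \<in> max_weak_bisim \<tau> (lts_sum S T)}"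


section \<open>Gap-order constraint systems\<close>

datatype 'x pvar = Unprimed 'x | Primed 'x

type_synonym 'x gap_constraint = "'x pvar gap_clause list"

record ('x, 'a) gcs =
  vars :: "'x set"
  consts_of :: "int set"
  acts :: "'a set"
  constraints :: "'x gap_constraint set"
  lab :: "'x gap_constraint \<Rightarrow> 'a"

definition wf_gcs :: "('x, 'a) gcs \<Rightarrow> bool" where
  "wf_gcs G \<longleftrightarrow>
     finite (vars G) \<and> finite (consts_of G) \<and> finite (acts G) \<and> finite (constraints G) \<and>
     (\<forall>D \<in> constraints G. lab G D \<in> acts G \<and>
        (\<forall>c \<in> set D. positive_clause c \<and>
           clause_over (Unprimed ` vars G \<union> Primed ` vars G) (consts_of G) c))"

definition joint :: "('x \<Rightarrow> int) \<Rightarrow> ('x \<Rightarrow> int) \<Rightarrow> 'x pvar \<Rightarrow> int" where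
  "joint \<nu> \<nu>' p = (case p of Unprimed x \<Rightarrow> \<nu> x | Primed x \<Rightarrow> \<nu>' x)"

definition gcs_lts :: "('x, 'a) gcs \<Rightarrow> ('x \<Rightarrow> int, 'a) lts" where
  "gcs_lts G =
     \<lparr>states = Val (vars G),
      labels = acts G,
      steps = {(\<nu>, a, \<nu>'). \<nu> \<in> Val (vars G) \<and> \<nu>' \<in> Val (vars G) \<and>
                 (\<exists>D \<in> constraints G. lab G D = a \<and> (\<forall>c \<in> set D. clause_sat (joint \<nu> \<nu>') c))}\<rparr>"

definition bisim_instance :: "('x, 'a) gcs \<Rightarrow> 'a \<Rightarrow> ('s, 'a) lts \<Rightarrow> 's \<Rightarrow> bool" where
  "bisim_instance G \<tau> T s \<longleftrightarrow>
     wf_gcs G \<and> \<tau> \<in> acts G \<and>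
     wf_lts T \<and> labels T = acts G \<and> finite (states T) \<and> s \<in> states T"

definition bisimilar_valuations :: "('x, 'a) gcs \<Rightarrow> 'a \<Rightarrow> ('s, 'a) lts \<Rightarrow> 's \<Rightarrow> ('x \<Rightarrow> int) set" where
  "bisimilar_valuations G \<tau> T s =
     {\<nu> \<in> Val (vars G). (\<nu>, s) \<in> weak_bisim_between \<tau> (gcs_lts G) T}"


section \<open>Partial recursive functions\<close>

text \<open>The partial recursive functions as unary partial functions on the natural numbers, where
  tuples of arguments are packed with the Cantor pairing \<^const>\<open>prod_encode\<close>.\<close>

definition prim_rec :: "(nat \<rightharpoonup> nat) \<Rightarrow> (nat \<rightharpoonup> nat) \<Rightarrow> nat \<rightharpoonup> nat" where
  "prim_rec f g n = (case prod_decode n of (a, m) \<Rightarrow>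
     rec_nat (f a) (\<lambda>i r. Option.bind r (\<lambda>v. g (prod_encode (a, prod_encode (i, v))))) m)"

definition minimize :: "(nat \<rightharpoonup> nat) \<Rightarrow> nat \<rightharpoonup> nat" where
  "minimize f a =
     (if \<exists>n. f (prod_encode (a, n)) = Some 0 \<and> (\<forall>i<n. f (prod_encode (a, i)) \<noteq> None)
      then Some (LEAST n. f (prod_encode (a, n)) = Some 0) else None)"

inductive partial_recursive :: "(nat \<rightharpoonup> nat) \<Rightarrow> bool" where
  zero: "partial_recursive (\<lambda>n. Some 0)"
| succ: "partial_recursive (\<lambda>n. Some (Suc n))"
| left: "partial_recursive (\<lambda>n. Some (fst (prod_decode n)))"
| right: "partial_recursive (\<lambda>n. Some (snd (prod_decode n)))"
| pair: "partial_recursive f \<Longrightarrow> partial_recursive g \<Longrightarrow>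
    partial_recursive (\<lambda>n. Option.bind (f n) (\<lambda>u. Option.bind (g n) (\<lambda>v. Some (prod_encode (u, v)))))"
| comp: "partial_recursive f \<Longrightarrow> partial_recursive g \<Longrightarrow> partial_recursive (f \<circ>\<^sub>m g)"
| prec: "partial_recursive f \<Longrightarrow> partial_recursive g \<Longrightarrow> partial_recursive (prim_rec f g)"
| mini: "partial_recursive f \<Longrightarrow> partial_recursive (minimize f)"


section \<open>Encoding of inputs and outputs as natural numbers\<close>

text \<open>The names of variables, actions and states are natural numbers. Finite sets are encoded by
  \<^const>\<open>set_encode\<close>, the binary number whose one bits are the elements.\<close>

fun encode_trm :: "nat trm \<Rightarrow> nat" where
  "encode_trm (V x) = sum_encode (Inl x)"
| "encode_trm (C c) = sum_encode (Inr (int_encode c))"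

fun encode_clause :: "nat gap_clause \<Rightarrow> nat" where
  "encode_clause (Gap t u k) = prod_encode (encode_trm t, prod_encode (encode_trm u, int_encode k))"

fun encode_formula :: "nat gap_formula \<Rightarrow> nat" where
  "encode_formula FTrue = prod_encode (0, 0)"
| "encode_formula (FClause c) = prod_encode (1, encode_clause c)"
| "encode_formula (FNot \<phi>) = prod_encode (2, encode_formula \<phi>)"
| "encode_formula (FAnd \<phi> \<psi>) = prod_encode (3, prod_encode (encode_formula \<phi>, encode_formula \<psi>))"
| "encode_formula (FOr \<phi> \<psi>) = prod_encode (4, prod_encode (encode_formula \<phi>, encode_formula \<psi>))"

lemma inj_encode_trm: "encode_trm t = encode_trm u \<Longrightarrow> t = u"
  by (cases t; cases u) (auto simp: sum_encode_eq int_encode_eq simp del: One_nat_def)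

lemma inj_encode_clause: "encode_clause c = encode_clause d \<Longrightarrow> c = d"
  by (cases c; cases d) (auto simp: prod_encode_eq int_encode_eq dest: inj_encode_trm)

lemma inj_encode_formula: "inj encode_formula"
proof (rule injI)
  show "encode_formula \<phi> = encode_formula \<psi> \<Longrightarrow> \<phi> = \<psi>" for \<phi> \<psi>
    by (induction \<phi> arbitrary: \<psi>; case_tac \<psi>) (auto simp: prod_encode_eq dest: inj_encode_clause)
qed

fun encode_pvar :: "nat pvar \<Rightarrow> nat" where
  "encode_pvar (Unprimed x) = sum_encode (Inl x)"
| "encode_pvar (Primed x) = sum_encode (Inr x)"

definition encode_constraint :: "nat gap_constraint \<Rightarrow> nat" where
  "encode_constraint D = list_encode (map (encode_clause \<circ> map_gap_clause encode_pvar) D)"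

definition encode_instance :: "(nat, nat) gcs \<Rightarrow> nat \<Rightarrow> (nat, nat) lts \<Rightarrow> nat \<Rightarrow> nat" where
  "encode_instance G \<tau> T s = list_encode
     [set_encode (vars G),
      set_encode (int_encode ` consts_of G),
      set_encode (acts G),
      set_encode ((\<lambda>D. prod_encode (encode_constraint D, lab G D)) ` constraints G),
      \<tau>,
      set_encode (states T),
      set_encode ((\<lambda>(p, a, q). prod_encode (p, prod_encode (a, q))) ` steps T),
      s]"

end

theory Submission
  imports Defs
begin

text \<open>Treat the constants as extra coordinates that never change. Then the relation of a sequence of
  positive gap constraints is closed under pointwise minimum and maximum, translation and doubling,
  and such a relation is determined by the matrix of its tightest gaps, with entries in the naturals
  or minus infinity. By Dickson's lemma, finitely many sequences cover all others, so every
  reachability relation needs only a bounded number \<open>N\<close> of steps.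

  Call two valuations \<open>K\<close>-equivalent if they satisfy the same clauses with gaps up to \<open>K\<close>. With \<open>n\<close>
  variables, a step from one of two \<open>4 ^ n * K\<close>-equivalent valuations can be matched by a step from
  the other one up to \<open>K\<close>-equivalence, and the new values can be chosen close to old ones. Hence the
  approximants of weak bisimilarity are invariant under gap equivalence. Since they are stationary
  after boundedly many rounds on the finite system, \<open>\<nu> \<approx> q\<close> holds iff \<open>\<nu>\<close> and \<open>q\<close> are related by a
  late approximant and so is every valuation reachable from \<open>\<nu>\<close> with some state.

  For computability, search for an \<open>N\<close> such that the \<open>N\<close>-step preimages of all equivalence classes
  are stationary. This and the approximants can be evaluated in a bounded box of valuations
  that shrinks with every step, and the output is the disjunction of the characteristic formulas of
  the classes that were found to be bisimilar.\<close>

section \<open>Equivalence of integer tuples up to bounded gaps\<close>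

definition gap_eqv :: "int \<Rightarrow> 'i set \<Rightarrow> ('i \<Rightarrow> int) \<Rightarrow> ('i \<Rightarrow> int) \<Rightarrow> bool" where
  "gap_eqv K I p q \<longleftrightarrow> (\<forall>i\<in>I. \<forall>j\<in>I. \<forall>k. \<bar>k\<bar> \<le> K \<longrightarrow> (k \<le> p i - p j \<longleftrightarrow> k \<le> q i - q j))"

lemma gap_eqvD: "gap_eqv K I p q \<Longrightarrow> i \<in> I \<Longrightarrow> j \<in> I \<Longrightarrow> \<bar>k\<bar> \<le> K \<Longrightarrow> k \<le> p i - p j \<longleftrightarrow> k \<le> q i - q j"
  by (simp add: gap_eqv_def)

lemma gap_eqv_mono: "gap_eqv K I p q \<Longrightarrow> L \<le> K \<Longrightarrow> J \<subseteq> I \<Longrightarrow> gap_eqv L J p q"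
  unfolding gap_eqv_def by (meson order.trans subsetD)

lemma gap_eqv_sym: "gap_eqv K I p q \<Longrightarrow> gap_eqv K I q p"
  by (simp add: gap_eqv_def)

lemma gap_eqv_refl: "gap_eqv K I p p"
  by (simp add: gap_eqv_def)

lemma gap_eqv_trans: "gap_eqv K I p q \<Longrightarrow> gap_eqv K I q r \<Longrightarrow> gap_eqv K I p r"
  by (simp add: gap_eqv_def)

lemma gap_eqv_cong:
  "(\<And>i. i \<in> I \<Longrightarrow> p i = p' i) \<Longrightarrow> (\<And>i. i \<in> I \<Longrightarrow> q i = q' i) \<Longrightarrow> gap_eqv K I p q \<longleftrightarrow> gap_eqv K I p' q'"
  by (simp add: gap_eqv_def)

lemma gap_eqv_insert:
  assumes "gap_eqv K I p q" "j \<notin> I" "0 \<le> K"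
    "\<And>i k. i \<in> I \<Longrightarrow> \<bar>k\<bar> \<le> K \<Longrightarrow> k \<le> a - p i \<longleftrightarrow> k \<le> b - q i"
    "\<And>i k. i \<in> I \<Longrightarrow> \<bar>k\<bar> \<le> K \<Longrightarrow> k \<le> p i - a \<longleftrightarrow> k \<le> q i - b"
  shows "gap_eqv K (insert j I) (p(j := a)) (q(j := b))"
  using assms unfolding gap_eqv_def by auto

text \<open>If \<open>a\<close> is within distance \<open>K\<close> of some \<open>p i\<close>, then \<open>b\<close> is at the same distance from \<open>q i\<close>;
  otherwise it is put at distance \<open>K + 1\<close> from the nearest neighbour.\<close>

lemma gap_eqv_extend_one:
  assumes fin: "finite I" and j: "j \<notin> I" and K: "1 \<le> K" and eqv: "gap_eqv (4 * K) I p q"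
  shows "\<exists>b. gap_eqv K (insert j I) (p(j := a)) (q(j := b)) \<and> ((\<exists>i\<in>I. \<bar>b - q i\<bar> \<le> 2 * K) \<or> I = {} \<and> b = 0)"
proof -
  have eqvK: "gap_eqv K I p q" using gap_eqv_mono[OF eqv _ subset_refl] K by simp
  have ext: "gap_eqv K (insert j I) (p(j := a)) (q(j := b))"
    if "\<And>i k. i \<in> I \<Longrightarrow> \<bar>k\<bar> \<le> K \<Longrightarrow> (k \<le> a - p i \<longleftrightarrow> k \<le> b - q i) \<and> (k \<le> p i - a \<longleftrightarrow> k \<le> q i - b)" for b
    using gap_eqv_insert[OF eqvK j] that K by auto
  show ?thesis
  proof (cases "\<exists>i\<in>I. \<bar>a - p i\<bar> \<le> K")
    case True
    then obtain i where i: "i \<in> I" "\<bar>a - p i\<bar> \<le> K" by blast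
    have "(k \<le> a - p m \<longleftrightarrow> k \<le> (q i + (a - p i)) - q m) \<and> (k \<le> p m - a \<longleftrightarrow> k \<le> q m - (q i + (a - p i)))"
      if "m \<in> I" "\<bar>k\<bar> \<le> K" for m k
      using gap_eqvD[OF eqv i(1) that(1), of "k - (a - p i)"]
        gap_eqvD[OF eqv that(1) i(1), of "k + (a - p i)"] that(2) i(2) K by (auto simp: algebra_simps)
    from ext[OF this] i show ?thesis using K by (intro exI[of _ "q i + (a - p i)"]) force
  next
    case False
    then have far: "K < \<bar>a - p m\<bar>" if "m \<in> I" for m using that not_le by blast
    let ?L = "{i \<in> I. p i < a}" and ?U = "{i \<in> I. p i > a}"
    have split: "m \<in> ?L \<or> m \<in> ?U" if "m \<in> I" for m
    proof -
      have "K < \<bar>a - p m\<bar>" using far that by blast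
      then show ?thesis using that K by auto
    qed
    have L: "p m < a - K" if "m \<in> ?L" for m
    proof -
      have "K < \<bar>a - p m\<bar>" using far that by blast
      then show ?thesis using that by auto
    qed
    have U: "a + K < p m" if "m \<in> ?U" for m
    proof -
      have "K < \<bar>a - p m\<bar>" using far that by blast
      then show ?thesis using that by auto
    qed
    have ord: "q m \<le> q i" if "m \<in> I" "i \<in> I" "p m \<le> p i" for m i
      using gap_eqvD[OF eqv that(2,1), of 0] that(3) K by simp
    have placed: "gap_eqv K (insert j I) (p(j := a)) (q(j := b))"
      if b: "\<And>m. m \<in> ?L \<Longrightarrow> q m < b - K" "\<And>m. m \<in> ?U \<Longrightarrow> b + K < q m" for b
    proof (rule ext)
      fix m k assume m: "m \<in> I" and k: "\<bar>k\<bar> \<le> K"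
      from split[OF m] show "(k \<le> a - p m \<longleftrightarrow> k \<le> b - q m) \<and> (k \<le> p m - a \<longleftrightarrow> k \<le> q m - b)"
      proof
        assume "m \<in> ?L"
        from L[OF this] b(1)[OF this] k show ?thesis by auto
      next
        assume "m \<in> ?U"
        from U[OF this] b(2)[OF this] k show ?thesis by auto
      qed
    qed
    show ?thesis
    proof (cases "?L = {}")
      case False
      define i where "i = (ARG_MAX p i. i \<in> ?L)"
      have iL: "i \<in> ?L" and imax: "\<And>m. m \<in> ?L \<Longrightarrow> p m \<le> p i"
      proof -
        have "Max (p ` ?L) \<in> p ` ?L" using fin False by (intro Max_in) auto
        then obtain i0 where i0: "i0 \<in> ?L" "p i0 = Max (p ` ?L)" by force
        have "\<forall>m. m \<in> ?L \<longrightarrow> p m \<le> p i0" using i0(2) fin by simp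
        then have "is_arg_max p (\<lambda>i. i \<in> ?L) i0" using i0(1) by (auto simp: is_arg_max_linorder)
        then have "is_arg_max p (\<lambda>i. i \<in> ?L) i"
          unfolding i_def arg_max_def by (rule someI)
        then show "i \<in> ?L" "\<And>m. m \<in> ?L \<Longrightarrow> p m \<le> p i" by (auto simp: is_arg_max_linorder)
      qed
      have "gap_eqv K (insert j I) (p(j := a)) (q(j := q i + K + 1))"
      proof (rule placed)
        fix m assume "m \<in> ?L"
        with ord[of m i] iL imax show "q m < q i + K + 1 - K" by force
      next
        fix m assume m: "m \<in> ?U"
        have "2 * K + 2 \<le> p m - p i" using L[OF iL] U[OF m] by simp
        then have "2 * K + 2 \<le> q m - q i"
          using gap_eqvD[OF eqv, of m i "2 * K + 2"] m iL K by simp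
        then show "q i + K + 1 + K < q m" by simp
      qed
      then show ?thesis using iL K by (intro exI[of _ "q i + K + 1"]) force
    next
      case noL: True
      show ?thesis
      proof (cases "?U = {}")
        case False
        have "Min (p ` ?U) \<in> p ` ?U" using fin False by (intro Min_in) auto
        then obtain i where iU: "i \<in> ?U" and eq: "p i = Min (p ` ?U)" by force
        have imin: "p i \<le> p m" if "m \<in> ?U" for m using that fin unfolding eq by simp
        have "gap_eqv K (insert j I) (p(j := a)) (q(j := q i - K - 1))"
        proof (rule placed)
          fix m assume "m \<in> ?U"
          with ord[of i m] iU imin show "q i - K - 1 + K < q m" by force
        next
          fix m assume "m \<in> ?L"
          then show "q m < q i - K - 1 - K" using noL by blast
        qed
        then show ?thesis using iU K by (intro exI[of _ "q i - K - 1"]) force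
      next
        case True
        then have "I = {}" using split noL by blast
        moreover from this have "gap_eqv K (insert j I) (p(j := a)) (q(j := 0))"
          by (intro ext) simp
        ultimately show ?thesis by blast
      qed
    qed
  qed
qed

lemma gap_eqv_extend:
  assumes "finite J" "finite I" "I \<inter> J = {}" "1 \<le> K" "0 \<le> B"
    "gap_eqv (4 ^ card J * K) I p q" "\<And>i. i \<in> I \<Longrightarrow> \<bar>q i\<bar> \<le> B" "\<And>i. i \<in> I \<Longrightarrow> p' i = p i"
  shows "\<exists>q'. (\<forall>i. i \<notin> J \<longrightarrow> q' i = q i) \<and> gap_eqv K (I \<union> J) p' q' \<and>
    (\<forall>j\<in>J. \<bar>q' j\<bar> \<le> B + int (card J) * (2 * 4 ^ card J * K))"
  using assms
proof (induction J arbitrary: K rule: finite_induct)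
  case empty
  have "gap_eqv K I p' q" using gap_eqv_cong[of I p' p q q K] empty.prems by simp
  then show ?case by auto
next
  case (insert j J)
  have "gap_eqv (4 ^ card J * (4 * K)) I p q" using insert.prems(5) insert.hyps by (simp add: mult_ac)
  from insert.IH[OF insert.prems(1) _ _ insert.prems(4) this insert.prems(6,7)] insert.prems(2,3)
  obtain q' where
    q': "\<And>i. i \<notin> J \<Longrightarrow> q' i = q i" "gap_eqv (4 * K) (I \<union> J) p' q'"
      "\<And>j. j \<in> J \<Longrightarrow> \<bar>q' j\<bar> \<le> B + int (card J) * (2 * 4 ^ card J * (4 * K))"
    by force
  have "j \<notin> I \<union> J" "finite (I \<union> J)" using insert by auto
  from gap_eqv_extend_one[OF this(2,1) insert.prems(3) q'(2), of "p' j"] obtain b where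
    b: "gap_eqv K (insert j (I \<union> J)) p' (q'(j := b))"
      "(\<exists>i\<in>I \<union> J. \<bar>b - q' i\<bar> \<le> 2 * K) \<or> I \<union> J = {} \<and> b = 0"
    by auto
  define e where "e = (4::int) ^ card J * (4 * K)"
  have e: "K \<le> e"
  proof -
    have "(1::int) \<le> 4 ^ Suc (card J)" by (rule one_le_power) simp
    then have "1 * K \<le> 4 ^ Suc (card J) * K" using insert.prems(3) by (intro mult_right_mono) auto
    then show ?thesis by (simp add: e_def mult_ac)
  qed
  have bnd: "B + int (card (insert j J)) * (2 * 4 ^ card (insert j J) * K) = B + int (card J) * (2 * e) + 2 * e"
    using insert.hyps by (simp add: e_def algebra_simps)
  have old: "\<bar>q' i\<bar> \<le> B + int (card J) * (2 * e)" if "i \<in> I \<union> J" for i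
  proof (cases "i \<in> J")
    case True then show ?thesis using q'(3)[OF True] by (simp add: e_def mult_ac)
  next
    case False
    then have "\<bar>q' i\<bar> \<le> B" using that q'(1) insert.prems(6) by auto
    moreover have "0 \<le> int (card J) * (2 * e)" using e insert.prems(3) by simp
    ultimately show ?thesis by linarith
  qed
  have "\<bar>b\<bar> \<le> B + int (card J) * (2 * e) + 2 * e"
    using b(2)
  proof
    assume "\<exists>i\<in>I \<union> J. \<bar>b - q' i\<bar> \<le> 2 * K"
    then obtain i where i: "i \<in> I \<union> J" "\<bar>b - q' i\<bar> \<le> 2 * K" by blast
    from old[OF i(1)] i(2) e show ?thesis by linarith
  next
    assume "I \<union> J = {} \<and> b = 0"
    moreover have "0 \<le> int (card J) * (2 * e)" using e insert.prems(3) by simp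
    ultimately show ?thesis using insert.prems(3,4) e by linarith
  qed
  have "\<bar>q' i\<bar> \<le> B + int (card J) * (2 * e) + 2 * e" if "i \<in> J" for i
    using old[of i] that e insert.prems(3) by auto
  then have "\<bar>(q'(j := b)) i\<bar> \<le> B + int (card J) * (2 * e) + 2 * e" if "i \<in> insert j J" for i
    using that \<open>\<bar>b\<bar> \<le> _\<close> by (cases "i = j") auto
  moreover have "(q'(j := b)) i = q i" if "i \<notin> insert j J" for i using that q'(1) by simp
  ultimately show ?case unfolding bnd using b(1)
    by (intro exI[of _ "q'(j := b)"]) (simp del: fun_upd_apply)
qed

section \<open>Finitely many steps suffice\<close>

subsection \<open>Dickson's lemma\<close>

lemma nat_mono_subseq:
  fixes f :: "nat \<Rightarrow> nat"
  shows "\<exists>g :: nat \<Rightarrow> nat. strict_mono g \<and> (\<forall>i j. i \<le> j \<longrightarrow> f (g i) \<le> f (g j))"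
proof -
  define nxt where "nxt n = (ARG_MIN f i. n \<le> i)" for n
  have nxt: "n \<le> nxt n" "\<And>i. n \<le> i \<Longrightarrow> f (nxt n) \<le> f i" for n
    using arg_min_nat_lemma[of "\<lambda>i. n \<le> i" n f] by (auto simp: nxt_def)
  define g where "g = rec_nat (nxt 0) (\<lambda>_ m. nxt (Suc m))"
  have g: "g 0 = nxt 0" "g (Suc i) = nxt (Suc (g i))" for i by (simp_all add: g_def)
  have lt: "g i < g (Suc i)" for i using nxt(1)[of "Suc (g i)"] by (simp add: g)
  then have sm: "strict_mono g" by (simp add: strict_mono_Suc_iff)
  have "f (g i) \<le> f m" if "g i \<le> m" for i m
  proof (cases i)
    case 0 then show ?thesis using nxt(2)[of 0 m] by (simp add: g)
  next
    case (Suc i')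
    then show ?thesis using nxt(2)[of "Suc (g i')" m] lt[of i'] that by (simp add: g)
  qed
  then have "\<forall>i j. i \<le> j \<longrightarrow> f (g i) \<le> f (g j)"
    using monoD[OF strict_mono_mono[OF sm]] by blast
  with sm show ?thesis by blast
qed

lemma dickson:
  fixes f :: "nat \<Rightarrow> 'j \<Rightarrow> nat"
  assumes "finite J"
  shows "\<exists>g :: nat \<Rightarrow> nat. strict_mono g \<and> (\<forall>i j. i \<le> j \<longrightarrow> (\<forall>x\<in>J. f (g i) x \<le> f (g j) x))"
  using assms
proof (induction J rule: finite_induct)
  case empty
  show ?case by (intro exI[of _ "\<lambda>i. i"]) (simp add: strict_mono_def)
next
  case (insert y J)
  then obtain g :: "nat \<Rightarrow> nat" where g: "strict_mono g" "\<And>i j x. i \<le> j \<Longrightarrow> x \<in> J \<Longrightarrow> f (g i) x \<le> f (g j) x" by metis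
  obtain h :: "nat \<Rightarrow> nat" where h: "strict_mono h" "\<And>i j. i \<le> j \<Longrightarrow> f (g (h i)) y \<le> f (g (h j)) y"
    using nat_mono_subseq[of "\<lambda>i. f (g i) y"] by metis
  have "strict_mono (g \<circ> h)" using g(1) h(1) by (simp add: strict_mono_def)
  moreover have "f ((g \<circ> h) i) x \<le> f ((g \<circ> h) j) x" if "i \<le> j" "x \<in> insert y J" for i j x
    using that h(2) g(2) strict_mono_less_eq[OF h(1)] by auto
  ultimately show ?case by (intro exI[of _ "g \<circ> h"] conjI allI impI ballI)
qed

subsection \<open>Positive gap relations\<close>

text \<open>Closure under pointwise minimum, maximum and translation characterises conjunctions of gap
  clauses; closure under doubling makes the gaps nonnegative. All these properties survive
  relational composition, so no quantifier elimination on gap constraints is needed.\<close>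

definition gap_closed :: "'i set \<Rightarrow> (('i \<Rightarrow> int) \<times> ('i \<Rightarrow> int)) set \<Rightarrow> bool" where
  "gap_closed I S \<longleftrightarrow>
     (\<forall>p p' q q'. (p, p') \<in> S \<longrightarrow> (q, q') \<in> S \<longrightarrow>
        (\<lambda>i. min (p i) (q i), \<lambda>i. min (p' i) (q' i)) \<in> S \<and>
        (\<lambda>i. max (p i) (q i), \<lambda>i. max (p' i) (q' i)) \<in> S) \<and>
     (\<forall>p p'. (p, p') \<in> S \<longrightarrow> (\<forall>c. (\<lambda>i. p i + c, \<lambda>i. p' i + c) \<in> S) \<and> (\<lambda>i. 2 * p i, \<lambda>i. 2 * p' i) \<in> S) \<and>
     (\<forall>p p' q q'. (p, p') \<in> S \<longrightarrow> (\<forall>i\<in>I. p i = q i) \<longrightarrow> (\<forall>i\<in>I. p' i = q' i) \<longrightarrow> (q, q') \<in> S)"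

lemma gap_closedD:
  assumes "gap_closed I S"
  shows "(p, p') \<in> S \<Longrightarrow> (q, q') \<in> S \<Longrightarrow> (\<lambda>i. min (p i) (q i), \<lambda>i. min (p' i) (q' i)) \<in> S"
    and "(p, p') \<in> S \<Longrightarrow> (q, q') \<in> S \<Longrightarrow> (\<lambda>i. max (p i) (q i), \<lambda>i. max (p' i) (q' i)) \<in> S"
    and "(p, p') \<in> S \<Longrightarrow> (\<lambda>i. p i + c, \<lambda>i. p' i + c) \<in> S"
    and "(p, p') \<in> S \<Longrightarrow> (\<lambda>i. 2 * p i, \<lambda>i. 2 * p' i) \<in> S"
    and "(p, p') \<in> S \<Longrightarrow> (\<And>i. i \<in> I \<Longrightarrow> p i = q i) \<Longrightarrow> (\<And>i. i \<in> I \<Longrightarrow> p' i = q' i) \<Longrightarrow> (q, q') \<in> S"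
  using assms unfolding gap_closed_def by blast+

lemma gap_closed_relcomp:
  assumes S: "gap_closed I S" and S': "gap_closed I S'"
  shows "gap_closed I (S O S')"
  unfolding gap_closed_def
proof (intro conjI allI impI)
  fix p p' q q' assume "(p, p') \<in> S O S'" "(q, q') \<in> S O S'"
  then obtain m n where *: "(p, m) \<in> S" "(m, p') \<in> S'" "(q, n) \<in> S" "(n, q') \<in> S'" by blast
  show "(\<lambda>i. min (p i) (q i), \<lambda>i. min (p' i) (q' i)) \<in> S O S'"
    using gap_closedD(1)[OF S *(1,3)] gap_closedD(1)[OF S' *(2,4)] by blast
  show "(\<lambda>i. max (p i) (q i), \<lambda>i. max (p' i) (q' i)) \<in> S O S'"
    using gap_closedD(2)[OF S *(1,3)] gap_closedD(2)[OF S' *(2,4)] by blast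
next
  fix p p' c assume "(p, p') \<in> S O S'"
  then obtain m where *: "(p, m) \<in> S" "(m, p') \<in> S'" by blast
  show "(\<lambda>i. p i + c, \<lambda>i. p' i + c) \<in> S O S'"
    using gap_closedD(3)[OF S *(1)] gap_closedD(3)[OF S' *(2)] by blast
  show "(\<lambda>i. 2 * p i, \<lambda>i. 2 * p' i) \<in> S O S'"
    using gap_closedD(4)[OF S *(1)] gap_closedD(4)[OF S' *(2)] by blast
next
  fix p p' q q' assume "(p, p') \<in> S O S'" and eq: "\<forall>i\<in>I. p i = q i" "\<forall>i\<in>I. p' i = q' i"
  then obtain m where *: "(p, m) \<in> S" "(m, p') \<in> S'" by blast
  show "(q, q') \<in> S O S'"
    using gap_closedD(5)[OF S *(1), of q m] gap_closedD(5)[OF S' *(2), of m q'] eq by blast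
qed

text \<open>The tightest gaps implied by a relation, shifted by one so that \<open>0\<close> means that the difference
  is unbounded below.\<close>

definition gap_matrix :: "(('i \<Rightarrow> int) \<times> ('i \<Rightarrow> int)) set \<Rightarrow> ('i + 'i) \<times> ('i + 'i) \<Rightarrow> nat" where
  "gap_matrix S = (\<lambda>(i, j). let d = (\<lambda>(p, p'). case_sum p p' i - case_sum p p' j) in
     if \<exists>r\<in>S. d r < 0 then 0 else Suc (LEAST k. \<exists>r\<in>S. d r = int k))"

lemma gap_closed_double:
  assumes "gap_closed I S" "(p, p') \<in> S"
  shows "(\<lambda>i. 2 ^ n * p i, \<lambda>i. 2 ^ n * p' i) \<in> S"
proof (induction n)
  case (Suc n)
  from gap_closedD(4)[OF assms(1) this] show ?case by (simp add: mult_ac)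
qed (use assms in simp)

lemma gap_matrix_attained:
  assumes S: "gap_closed I S" and S': "(p, p') \<in> S'" and ne: "S \<noteq> {}"
    and le: "gap_matrix S (i, j) \<le> gap_matrix S' (i, j)"
  shows "\<exists>(q, q')\<in>S. case_sum q q' i - case_sum q q' j \<le> case_sum p p' i - case_sum p p' j"
proof -
  let ?d = "\<lambda>(p, p'). case_sum p p' i - case_sum p p' j"
  show ?thesis
  proof (cases "\<exists>r\<in>S. ?d r < 0")
    case True
    then obtain q q' where q: "(q, q') \<in> S" "?d (q, q') < 0" by auto
    define n where "n = nat \<bar>?d (p, p')\<bar>"
    have "case_sum (\<lambda>i. 2 ^ n * q i) (\<lambda>i. 2 ^ n * q' i) x = 2 ^ n * case_sum q q' x" for x
      by (cases x) simp_all
    then have "?d (\<lambda>i. 2 ^ n * q i, \<lambda>i. 2 ^ n * q' i) = 2 ^ n * ?d (q, q')"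
      by (simp only: prod.case right_diff_distrib)
    also have "\<dots> \<le> 2 ^ n * (- 1)" using q(2) by (intro mult_left_mono) auto
    also have "\<dots> \<le> - int n"
      using less_exp[of n] by (simp add: less_imp_le)
    also have "\<dots> \<le> ?d (p, p')" by (simp add: n_def)
    finally show ?thesis
      by (intro bexI[OF _ gap_closed_double[OF S q(1), of n]]) (simp only: prod.case)
  next
    case False
    define P where "P k \<longleftrightarrow> (\<exists>r\<in>S. ?d r = int k)" for k
    define P' where "P' k \<longleftrightarrow> (\<exists>r\<in>S'. ?d r = int k)" for k
    have w: "gap_matrix S (i, j) = Suc (LEAST k. P k)"
      using False by (simp add: gap_matrix_def P_def)
    obtain r where r: "r \<in> S" using ne by blast
    then have "P (nat (?d r))" using False by (force simp: P_def not_less)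
    then have least: "P (LEAST k. P k)" by (rule LeastI)
    have neg': "\<not> (\<exists>r\<in>S'. ?d r < 0)"
    proof
      assume "\<exists>r\<in>S'. ?d r < 0"
      then have "gap_matrix S' (i, j) = 0" by (simp add: gap_matrix_def)
      then show False using le w by simp
    qed
    then have w': "gap_matrix S' (i, j) = Suc (LEAST k. P' k)"
      by (simp add: gap_matrix_def P'_def)
    have nn: "0 \<le> ?d (p, p')" using neg' S' by (force simp: not_less)
    then have "P' (nat (?d (p, p')))" using S' by (force simp: P'_def)
    then have "(LEAST k. P' k) \<le> nat (?d (p, p'))" by (rule Least_le)
    with le w w' nn have le': "int (LEAST k. P k) \<le> ?d (p, p')" by linarith
    define m where "m = (LEAST k. P k)"
    have "P m" using least by (simp add: m_def)
    then obtain q q' where r: "(q, q') \<in> S" "?d (q, q') = int m" unfolding P_def by fast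
    show ?thesis
      by (rule bexI[OF _ r(1)]) (use le' r(2) in \<open>simp only: m_def[symmetric] prod.case\<close>)
  qed
qed

lemma gap_closed_fold:
  assumes "gap_closed I S" "finite A" "A \<noteq> {}" "\<And>a. a \<in> A \<Longrightarrow> (P a, P' a) \<in> S"
  shows "(\<lambda>i. Max ((\<lambda>a. P a i) ` A), \<lambda>i. Max ((\<lambda>a. P' a i) ` A)) \<in> S"
    and "(\<lambda>i. Min ((\<lambda>a. P a i) ` A), \<lambda>i. Min ((\<lambda>a. P' a i) ` A)) \<in> S"
  using assms(2-4)
proof (induction A rule: finite_ne_induct)
  case (singleton a)
  case 1 then show ?case using singleton by simp
next
  case (singleton a)
  case 2 then show ?case using singleton by simp
next
  case (insert a A)
  case 1
  from gap_closedD(2)[OF assms(1), of "P a" "P' a"] 1 insert show ?case by simp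
next
  case (insert a A)
  case 2
  from gap_closedD(1)[OF assms(1), of "P a" "P' a"] 2 insert show ?case by simp
qed

lemma gap_closed_subset:
  assumes fin: "finite I" and S: "gap_closed I S" and ne: "S \<noteq> {}"
    and le: "\<And>x. x \<in> (I <+> I) \<times> (I <+> I) \<Longrightarrow> gap_matrix S x \<le> gap_matrix S' x"
  shows "S' \<subseteq> S"
proof
  fix x assume "x \<in> S'"
  then obtain p p' where x: "x = (p, p')" and S': "(p, p') \<in> S'" by (cases x) auto
  let ?J = "I <+> I"
  let ?v = "case_sum p p'"
  show "x \<in> S"
  proof (cases "I = {}")
    case True
    then show ?thesis using ne gap_closedD(5)[OF S] x by auto
  next
    case False
    then have J: "finite ?J" "?J \<noteq> {}" using fin by auto
    have "\<exists>q q'. (q, q') \<in> S \<and> case_sum q q' i = ?v i \<and> ?v j \<le> case_sum q q' j"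
      if ij: "i \<in> ?J" "j \<in> ?J" for i j
    proof -
      obtain q q' where q: "(q, q') \<in> S" "case_sum q q' i - case_sum q q' j \<le> ?v i - ?v j"
        using gap_matrix_attained[OF S S' ne le[of "(i, j)"]] ij by blast
      define c where "c = ?v i - case_sum q q' i"
      have c: "case_sum (\<lambda>i. q i + c) (\<lambda>i. q' i + c) y = case_sum q q' y + c" for y
        by (cases y) simp_all
      have "case_sum q q' i + c = ?v i" "?v j \<le> case_sum q q' j + c"
        using q(2) by (simp_all add: c_def)
      then show ?thesis
        using gap_closedD(3)[OF S q(1), of c]
        by (intro exI[of _ "\<lambda>i. q i + c"] exI[of _ "\<lambda>i. q' i + c"]) (simp only: c simp_thms)
    qed
    then obtain q q' where q: "\<And>i j. i \<in> ?J \<Longrightarrow> j \<in> ?J \<Longrightarrow>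
        (q i j, q' i j) \<in> S \<and> case_sum (q i j) (q' i j) i = ?v i \<and> ?v j \<le> case_sum (q i j) (q' i j) j"
      by metis
    define r where "r i = (\<lambda>x. Max ((\<lambda>j. q i j x) ` ?J))" for i
    define r' where "r' i = (\<lambda>x. Max ((\<lambda>j. q' i j x) ` ?J))" for i
    have rS: "(r i, r' i) \<in> S" if "i \<in> ?J" for i
      unfolding r_def r'_def using gap_closed_fold(1)[OF S J, of "q i" "q' i"] q[OF that] by simp
    have sum_r: "case_sum (r i) (r' i) x = Max ((\<lambda>j. case_sum (q i j) (q' i j) x) ` ?J)" for i x
      by (cases x) (simp_all add: r_def r'_def)
    have r_eq: "case_sum (r i) (r' i) i = ?v i" if "i \<in> ?J" for i
    proof -
      have "(\<lambda>j. case_sum (q i j) (q' i j) i) ` ?J = {?v i}" using q[OF that] J(2) by auto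
      then show ?thesis by (simp add: sum_r)
    qed
    have r_ge: "?v j \<le> case_sum (r i) (r' i) j" if "i \<in> ?J" "j \<in> ?J" for i j
      unfolding sum_r
      by (rule order.trans[OF conjunct2[OF conjunct2[OF q[OF that]]]],
          intro Max_ge finite_imageI J, rule image_eqI[where x = j, OF refl that(2)])
    let ?m = "\<lambda>x. Min ((\<lambda>j. r j x) ` ?J)" and ?m' = "\<lambda>x. Min ((\<lambda>j. r' j x) ` ?J)"
    have mS: "(?m, ?m') \<in> S" using gap_closed_fold(2)[OF S J, of r r'] rS by simp
    have "case_sum ?m ?m' i = ?v i" if i: "i \<in> ?J" for i
    proof -
      have "case_sum ?m ?m' i = Min ((\<lambda>j. case_sum (r j) (r' j) i) ` ?J)" by (cases i) simp_all
      also have "\<dots> = ?v i"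
        using J i r_eq[OF i] r_ge by (intro Min_eqI) (auto intro!: image_eqI[where x = i])
      finally show ?thesis .
    qed
    then have "?m y = p y \<and> ?m' y = p' y" if "y \<in> I" for y
      using that by (metis InlI InrI sum.case)
    then show ?thesis unfolding x using gap_closedD(5)[OF S mS, of p p'] by blast
  qed
qed

subsection \<open>Words of gap constraints\<close>

definition gstep :: "('x, 'a) gcs \<Rightarrow> 'a option \<Rightarrow> (('x \<Rightarrow> int) \<times> ('x \<Rightarrow> int)) set" where
  "gstep G m = {(\<nu>, \<nu>'). \<nu> \<in> Val (vars G) \<and> \<nu>' \<in> Val (vars G) \<and>
     (\<exists>D \<in> constraints G. (m = None \<or> m = Some (lab G D)) \<and> (\<forall>c \<in> set D. clause_sat (joint \<nu> \<nu>') c))}"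

lemma step_rel_gcs_lts: "step_rel (gcs_lts G) a = gstep G (Some a)"
  by (auto simp: step_rel_def gcs_lts_def gstep_def)

fun pair_val :: "('x trm \<Rightarrow> int) \<Rightarrow> ('x trm \<Rightarrow> int) \<Rightarrow> 'x pvar trm \<Rightarrow> int" where
  "pair_val p p' (V (Unprimed x)) = p (V x)"
| "pair_val p p' (V (Primed x)) = p' (V x)"
| "pair_val p p' (C c) = p (C c)"

lemma pair_val_trm_val: "pair_val (trm_val \<nu>) (trm_val \<nu>') t = trm_val (joint \<nu> \<nu>') t"
  by (cases "(trm_val \<nu>, trm_val \<nu>', t)" rule: pair_val.cases) (auto simp: joint_def)

text \<open>Here constants are treated as additional coordinates that no step changes; this makes the
  relations invariant under translation.\<close>

definition constraint_rel :: "int set \<Rightarrow> 'x gap_constraint \<Rightarrow> (('x trm \<Rightarrow> int) \<times> ('x trm \<Rightarrow> int)) set" where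
  "constraint_rel Cs D = {(p, p'). (\<forall>c\<in>Cs. p (C c) = p' (C c)) \<and>
     (\<forall>t u k. Gap t u k \<in> set D \<longrightarrow> k \<le> pair_val p p' t - pair_val p p' u)}"

definition constraint_over :: "'x set \<Rightarrow> int set \<Rightarrow> 'x gap_constraint \<Rightarrow> bool" where
  "constraint_over Vs Cs D \<longleftrightarrow>
     (\<forall>c \<in> set D. positive_clause c \<and> clause_over (Unprimed ` Vs \<union> Primed ` Vs) Cs c)"

lemma constraint_overD:
  "constraint_over Vs Cs D \<Longrightarrow> Gap t u k \<in> set D \<Longrightarrow> 0 \<le> k \<and>
     t \<in> trms_over (Unprimed ` Vs \<union> Primed ` Vs) Cs \<and> u \<in> trms_over (Unprimed ` Vs \<union> Primed ` Vs) Cs"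
  unfolding constraint_over_def by fastforce

lemma pair_val_cong:
  assumes "t \<in> trms_over (Unprimed ` Vs \<union> Primed ` Vs) Cs"
    "\<And>i. i \<in> trms_over Vs Cs \<Longrightarrow> p i = q i" "\<And>i. i \<in> trms_over Vs Cs \<Longrightarrow> p' i = q' i"
  shows "pair_val p p' t = pair_val q q' t"
  using assms unfolding trms_over_def by auto

lemma pair_val_lift:
  "pair_val (\<lambda>i. min (p i) (q i)) (\<lambda>i. min (p' i) (q' i)) t = min (pair_val p p' t) (pair_val q q' t)"
  "pair_val (\<lambda>i. max (p i) (q i)) (\<lambda>i. max (p' i) (q' i)) t = max (pair_val p p' t) (pair_val q q' t)"
  "pair_val (\<lambda>i. p i + c) (\<lambda>i. p' i + c) t = pair_val p p' t + c"
  "pair_val (\<lambda>i. 2 * p i) (\<lambda>i. 2 * p' i) t = 2 * pair_val p p' t"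
  by (cases "(p, p', t)" rule: pair_val.cases; simp)+

lemma gap_closed_constraint_rel:
  assumes over: "constraint_over Vs Cs D"
  shows "gap_closed (trms_over Vs Cs) (constraint_rel Cs D)"
  unfolding gap_closed_def
proof (intro conjI allI impI)
  fix p p' q q' assume *: "(p, p') \<in> constraint_rel Cs D" "(q, q') \<in> constraint_rel Cs D"
  have "k \<le> min a b - min c d" "k \<le> max a b - max c d" if "k \<le> a - c" "k \<le> b - d" for a b c d k :: int
    using that by linarith+
  with * show "(\<lambda>i. min (p i) (q i), \<lambda>i. min (p' i) (q' i)) \<in> constraint_rel Cs D"
    and "(\<lambda>i. max (p i) (q i), \<lambda>i. max (p' i) (q' i)) \<in> constraint_rel Cs D"
    by (simp_all add: constraint_rel_def pair_val_lift)
next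
  fix p p' c assume *: "(p, p') \<in> constraint_rel Cs D"
  then show "(\<lambda>i. p i + c, \<lambda>i. p' i + c) \<in> constraint_rel Cs D"
    by (simp add: constraint_rel_def pair_val_lift)
  show "(\<lambda>i. 2 * p i, \<lambda>i. 2 * p' i) \<in> constraint_rel Cs D"
    using * constraint_overD[OF over] unfolding constraint_rel_def mem_Collect_eq prod.case pair_val_lift
    by (smt (verit))
next
  fix p p' q q' assume *: "(p, p') \<in> constraint_rel Cs D"
    and eq: "\<forall>i\<in>trms_over Vs Cs. p i = q i" "\<forall>i\<in>trms_over Vs Cs. p' i = q' i"
  have "pair_val p p' t = pair_val q q' t" if "t \<in> trms_over (Unprimed ` Vs \<union> Primed ` Vs) Cs" for t
    using pair_val_cong[OF that] eq by blast
  moreover have "p (C c) = q (C c)" "p' (C c) = q' (C c)" if "c \<in> Cs" for c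
    using eq that by (auto simp: trms_over_def)
  ultimately show "(q, q') \<in> constraint_rel Cs D"
    using * constraint_overD[OF over] unfolding constraint_rel_def mem_Collect_eq prod.case by metis
qed

primrec word_rel :: "'x set \<Rightarrow> int set \<Rightarrow> 'x gap_constraint list \<Rightarrow> (('x trm \<Rightarrow> int) \<times> ('x trm \<Rightarrow> int)) set" where
  "word_rel Vs Cs [] = {(p, p'). \<forall>i\<in>trms_over Vs Cs. p i = p' i}"
| "word_rel Vs Cs (D # w) = constraint_rel Cs D O word_rel Vs Cs w"

lemma gap_closed_word_rel:
  "\<forall>D\<in>set w. constraint_over Vs Cs D \<Longrightarrow> gap_closed (trms_over Vs Cs) (word_rel Vs Cs w)"
proof (induction w)
  case Nil
  show ?case by (auto simp: gap_closed_def)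
next
  case (Cons D w)
  then show ?case by (simp add: gap_closed_relcomp gap_closed_constraint_rel)
qed

primrec word_path :: "'x set \<Rightarrow> 'x gap_constraint list \<Rightarrow> (('x \<Rightarrow> int) \<times> ('x \<Rightarrow> int)) set" where
  "word_path Vs [] = Id"
| "word_path Vs (D # w) =
     {(\<nu>, \<nu>'). \<nu> \<in> Val Vs \<and> \<nu>' \<in> Val Vs \<and> (\<forall>c \<in> set D. clause_sat (joint \<nu> \<nu>') c)} O word_path Vs w"

lemma constraint_rel_trm_val:
  "(trm_val \<nu>, trm_val \<nu>') \<in> constraint_rel Cs D \<longleftrightarrow> (\<forall>c \<in> set D. clause_sat (joint \<nu> \<nu>') c)"
  unfolding constraint_rel_def mem_Collect_eq prod.case pair_val_trm_val
  by (auto, metis clause_sat.simps gap_clause.exhaust)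

lemma word_path_imp_word_rel:
  "(\<nu>, \<nu>') \<in> word_path Vs w \<Longrightarrow> (trm_val \<nu>, trm_val \<nu>') \<in> word_rel Vs Cs w"
proof (induction w arbitrary: \<nu>)
  case (Cons D w)
  then obtain \<mu> where "\<forall>c \<in> set D. clause_sat (joint \<nu> \<mu>) c" "(\<mu>, \<nu>') \<in> word_path Vs w" by auto
  then show ?case using Cons.IH constraint_rel_trm_val[of \<nu> \<mu> Cs D] by auto
qed simp

lemma word_rel_imp_word_path:
  assumes "\<forall>D\<in>set w. constraint_over Vs Cs D" "\<nu> \<in> Val Vs" "\<nu>' \<in> Val Vs"
    "(trm_val \<nu>, trm_val \<nu>') \<in> word_rel Vs Cs w"
  shows "(\<nu>, \<nu>') \<in> word_path Vs w"
  using assms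
proof (induction w arbitrary: \<nu>)
  case Nil
  then have "\<nu> x = \<nu>' x" if "x \<in> Vs" for x using that by (force simp: trms_over_def)
  then show ?case using Nil.prems by (auto simp: Val_def intro: PiE_ext)
next
  case (Cons D w)
  then obtain p where p: "(trm_val \<nu>, p) \<in> constraint_rel Cs D" "(p, trm_val \<nu>') \<in> word_rel Vs Cs w" by auto
  define \<mu> where "\<mu> = restrict (\<lambda>x. p (V x)) Vs"
  have \<mu>: "\<mu> \<in> Val Vs" by (simp add: \<mu>_def Val_def)
  have eq: "p i = trm_val \<mu> i" if "i \<in> trms_over Vs Cs" for i
    using p(1) that by (auto simp: trms_over_def \<mu>_def constraint_rel_def)
  have D: "constraint_over Vs Cs D" and w: "\<forall>D\<in>set w. constraint_over Vs Cs D" using Cons.prems(1) by auto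
  have "(trm_val \<nu>, trm_val \<mu>) \<in> constraint_rel Cs D"
    using gap_closedD(5)[OF gap_closed_constraint_rel[OF D] p(1)] eq by blast
  moreover have "(trm_val \<mu>, trm_val \<nu>') \<in> word_rel Vs Cs w"
    using gap_closedD(5)[OF gap_closed_word_rel[OF w] p(2)] eq by blast
  ultimately show ?case
    using Cons.IH[OF w \<mu>] Cons.prems(2,3) \<mu> constraint_rel_trm_val[of \<nu> \<mu> Cs D] by auto
qed

lemma word_path_subset:
  assumes "\<forall>D\<in>set w. D \<in> constraints G \<and> (m = None \<or> m = Some (lab G D))"
  shows "word_path (vars G) w \<subseteq> gstep G m ^^ length w"
  using assms
proof (induction w)
  case (Cons D w)
  have "{(\<nu>, \<nu>'). \<nu> \<in> Val (vars G) \<and> \<nu>' \<in> Val (vars G) \<and> (\<forall>c \<in> set D. clause_sat (joint \<nu> \<nu>') c)} \<subseteq> gstep G m"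
    using Cons.prems by (auto simp: gstep_def)
  from relcomp_mono[OF this Cons.IH] Cons.prems show ?case
    by (simp add: relpow_commute)
qed simp

lemma relpow_gstep_word_path:
  "(\<nu>, \<nu>') \<in> gstep G m ^^ i \<Longrightarrow>
     \<exists>w. (\<forall>D\<in>set w. D \<in> constraints G \<and> (m = None \<or> m = Some (lab G D))) \<and> length w = i \<and>
         (\<nu>, \<nu>') \<in> word_path (vars G) w"
proof (induction i arbitrary: \<nu>)
  case 0
  then show ?case by (intro exI[of _ "[]"]) simp
next
  case (Suc i)
  then obtain \<mu> where \<mu>: "(\<nu>, \<mu>) \<in> gstep G m" "(\<mu>, \<nu>') \<in> gstep G m ^^ i" by (meson relpow_Suc_D2)
  from Suc.IH[OF \<mu>(2)] obtain w where
    w: "\<forall>D\<in>set w. D \<in> constraints G \<and> (m = None \<or> m = Some (lab G D))" "length w = i"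
      "(\<mu>, \<nu>') \<in> word_path (vars G) w" by blast
  from \<mu>(1) obtain D where D: "D \<in> constraints G" "m = None \<or> m = Some (lab G D)"
    "\<nu> \<in> Val (vars G)" "\<mu> \<in> Val (vars G)" "\<forall>c \<in> set D. clause_sat (joint \<nu> \<mu>) c"
    by (auto simp: gstep_def)
  show ?case
    by (rule exI[of _ "D # w"]) (use w D in auto)
qed

text \<open>By Dickson's lemma, among infinitely many words, one that occurs late denotes a relation that
  is contained in the relation of a shorter word.\<close>

theorem ex_gstep_rtrancl_bound:
  assumes wf: "wf_gcs G"
  shows "\<exists>N. (gstep G m)\<^sup>* \<subseteq> (\<Union>i\<le>N. gstep G m ^^ i)"
proof (rule ccontr)
  let ?I = "trms_over (vars G) (consts_of G)" and ?R = "word_rel (vars G) (consts_of G)"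
  let ?ok = "\<lambda>w. \<forall>D\<in>set w. D \<in> constraints G \<and> (m = None \<or> m = Some (lab G D))"
  assume no_bound: "\<not> ?thesis"
  have "\<exists>w \<nu> \<nu>'. ?ok w \<and> (\<nu>, \<nu>') \<in> word_path (vars G) w \<and> (\<nu>, \<nu>') \<notin> (\<Union>i\<le>N. gstep G m ^^ i)" for N
  proof -
    from no_bound have "\<not> (gstep G m)\<^sup>* \<subseteq> (\<Union>i\<le>N. gstep G m ^^ i)" by simp
    then obtain \<nu> \<nu>' where *: "(\<nu>, \<nu>') \<in> (gstep G m)\<^sup>*" "(\<nu>, \<nu>') \<notin> (\<Union>i\<le>N. gstep G m ^^ i)"
      by (meson subrelI)
    from *(1) obtain i where "(\<nu>, \<nu>') \<in> gstep G m ^^ i" by (auto dest: rtrancl_imp_relpow)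
    from relpow_gstep_word_path[OF this] *(2) show ?thesis by metis
  qed
  then obtain w \<nu> \<nu>' where w: "\<And>N. ?ok (w N)" "\<And>N. (\<nu> N, \<nu>' N) \<in> word_path (vars G) (w N)"
    "\<And>N. (\<nu> N, \<nu>' N) \<notin> (\<Union>i\<le>N. gstep G m ^^ i)"
    by metis
  have fin: "finite ?I" using wf by (auto simp: wf_gcs_def trms_over_def)
  have over: "\<forall>D\<in>set (w N). constraint_over (vars G) (consts_of G) D" for N
    using w(1)[of N] wf by (auto simp: wf_gcs_def constraint_over_def)
  have in_rel: "(trm_val (\<nu> N), trm_val (\<nu>' N)) \<in> ?R (w N)" for N
    using w(2) by (rule word_path_imp_word_rel)
  obtain g :: "nat \<Rightarrow> nat" where g: "strict_mono g"
    "\<And>i j x. i \<le> j \<Longrightarrow> x \<in> (?I <+> ?I) \<times> (?I <+> ?I) \<Longrightarrow>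
       gap_matrix (?R (w (g i))) x \<le> gap_matrix (?R (w (g j))) x"
    using dickson[of "(?I <+> ?I) \<times> (?I <+> ?I)" "\<lambda>N. gap_matrix (?R (w N))"] fin by (metis finite_SigmaI finite_Plus)
  let ?L = "length (w (g 0))"
  have "?R (w (g ?L)) \<subseteq> ?R (w (g 0))"
    using gap_closed_subset[OF fin gap_closed_word_rel[OF over]] in_rel g(2)[of 0 ?L] by blast
  then have rel: "(trm_val (\<nu> (g ?L)), trm_val (\<nu>' (g ?L))) \<in> ?R (w (g 0))" using in_rel by blast
  have "w (g ?L) \<noteq> []"
  proof
    assume "w (g ?L) = []"
    then have "(\<nu> (g ?L), \<nu>' (g ?L)) \<in> gstep G m ^^ 0" using w(2)[of "g ?L"] by simp
    then show False using w(3)[of "g ?L"] by blast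
  qed
  then obtain D w' where Dw: "w (g ?L) = D # w'" by (cases "w (g ?L)") auto
  have tgt: "(\<mu>, \<mu>') \<in> word_path (vars G) w \<Longrightarrow> \<mu> \<in> Val (vars G) \<Longrightarrow> \<mu>' \<in> Val (vars G)" for \<mu> \<mu>' w
    by (induction w arbitrary: \<mu>) auto
  have "\<nu> (g ?L) \<in> Val (vars G)" using w(2)[of "g ?L"] Dw by auto
  moreover from this have "\<nu>' (g ?L) \<in> Val (vars G)" using tgt w(2)[of "g ?L"] by blast
  ultimately have "(\<nu> (g ?L), \<nu>' (g ?L)) \<in> word_path (vars G) (w (g 0))"
    using word_rel_imp_word_path[OF over _ _ rel] by blast
  then have "(\<nu> (g ?L), \<nu>' (g ?L)) \<in> gstep G m ^^ ?L" using word_path_subset[OF w(1)] by blast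
  moreover have "?L \<le> g ?L" using g(1) by (rule strict_mono_imp_increasing)
  ultimately show False using w(3)[of "g ?L"] by blast
qed

section \<open>Approximants of weak bisimilarity\<close>

primrec wb_approx :: "'a \<Rightarrow> ('s, 'a) lts \<Rightarrow> nat \<Rightarrow> ('s \<times> 's) set" where
  "wb_approx \<tau> T 0 = states T \<times> states T"
| "wb_approx \<tau> T (Suc k) = {(s, t) \<in> states T \<times> states T. \<forall>a \<in> labels T.
     (\<forall>s'. (s, s') \<in> weak_step \<tau> T a \<longrightarrow> (\<exists>t'. (t, t') \<in> weak_step \<tau> T a \<and> (s', t') \<in> wb_approx \<tau> T k)) \<and>
     (\<forall>t'. (t, t') \<in> weak_step \<tau> T a \<longrightarrow> (\<exists>s'. (s, s') \<in> weak_step \<tau> T a \<and> (s', t') \<in> wb_approx \<tau> T k))}"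

lemma wb_approx_states: "(s, t) \<in> wb_approx \<tau> T k \<Longrightarrow> s \<in> states T \<and> t \<in> states T"
  by (cases k) auto

lemma wb_approx_SucD:
  assumes "(s, t) \<in> wb_approx \<tau> T (Suc k)" "a \<in> labels T"
  shows "(s, s') \<in> weak_step \<tau> T a \<Longrightarrow> \<exists>t'. (t, t') \<in> weak_step \<tau> T a \<and> (s', t') \<in> wb_approx \<tau> T k"
    and "(t, t') \<in> weak_step \<tau> T a \<Longrightarrow> \<exists>s'. (s, s') \<in> weak_step \<tau> T a \<and> (s', t') \<in> wb_approx \<tau> T k"
  using assms by auto

lemma wb_approx_SucI:
  assumes "s \<in> states T" "t \<in> states T"
    "\<And>a s'. a \<in> labels T \<Longrightarrow> (s, s') \<in> weak_step \<tau> T a \<Longrightarrow> \<exists>t'. (t, t') \<in> weak_step \<tau> T a \<and> (s', t') \<in> wb_approx \<tau> T k"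
    "\<And>a t'. a \<in> labels T \<Longrightarrow> (t, t') \<in> weak_step \<tau> T a \<Longrightarrow> \<exists>s'. (s, s') \<in> weak_step \<tau> T a \<and> (s', t') \<in> wb_approx \<tau> T k"
  shows "(s, t) \<in> wb_approx \<tau> T (Suc k)"
  using assms by auto

lemma wb_approx_sym: "(s, t) \<in> wb_approx \<tau> T k \<Longrightarrow> (t, s) \<in> wb_approx \<tau> T k"
proof (induction k arbitrary: s t)
  case (Suc k)
  show ?case
    by (rule wb_approx_SucI) (use wb_approx_states[OF Suc.prems] wb_approx_SucD[OF Suc.prems] Suc.IH in \<open>blast+\<close>)
qed auto

lemma wb_approx_trans:
  "(s, t) \<in> wb_approx \<tau> T k \<Longrightarrow> (t, u) \<in> wb_approx \<tau> T k \<Longrightarrow> (s, u) \<in> wb_approx \<tau> T k"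
proof (induction k arbitrary: s t u)
  case (Suc k)
  show ?case
  proof (rule wb_approx_SucI)
    show "s \<in> states T" "u \<in> states T"
      using wb_approx_states[OF Suc.prems(1)] wb_approx_states[OF Suc.prems(2)] by auto
  next
    fix a s' assume "a \<in> labels T" "(s, s') \<in> weak_step \<tau> T a"
    then show "\<exists>t'. (u, t') \<in> weak_step \<tau> T a \<and> (s', t') \<in> wb_approx \<tau> T k"
      using wb_approx_SucD(1)[OF Suc.prems(1)] wb_approx_SucD(1)[OF Suc.prems(2)] Suc.IH by meson
  next
    fix a t' assume "a \<in> labels T" "(u, t') \<in> weak_step \<tau> T a"
    then show "\<exists>s'. (s, s') \<in> weak_step \<tau> T a \<and> (s', t') \<in> wb_approx \<tau> T k"
      using wb_approx_SucD(2)[OF Suc.prems(1)] wb_approx_SucD(2)[OF Suc.prems(2)] Suc.IH by meson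
  qed
qed auto

lemma wb_approx_Suc_subset: "wb_approx \<tau> T (Suc k) \<subseteq> wb_approx \<tau> T k"
proof (induction k)
  case 0
  show ?case by auto
next
  case (Suc k)
  show ?case
  proof (rule subrelI)
    fix s t assume st: "(s, t) \<in> wb_approx \<tau> T (Suc (Suc k))"
    show "(s, t) \<in> wb_approx \<tau> T (Suc k)"
      by (rule wb_approx_SucI) (use wb_approx_states[OF st] wb_approx_SucD[OF st] Suc.IH in \<open>blast+\<close>)
  qed
qed

lemma max_weak_bisim_states: "(s, t) \<in> max_weak_bisim \<tau> T \<Longrightarrow> s \<in> states T \<and> t \<in> states T"
  using weak_bisimulation_max_weak_bisim[of \<tau> T] unfolding weak_bisimulation_def by auto

lemma max_weak_bisimD:
  assumes "(s, t) \<in> max_weak_bisim \<tau> T" "a \<in> labels T"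
  shows "(s, s') \<in> weak_step \<tau> T a \<Longrightarrow> \<exists>t'. (t, t') \<in> weak_step \<tau> T a \<and> (s', t') \<in> max_weak_bisim \<tau> T"
    and "(t, t') \<in> weak_step \<tau> T a \<Longrightarrow> \<exists>s'. (s, s') \<in> weak_step \<tau> T a \<and> (s', t') \<in> max_weak_bisim \<tau> T"
  using weak_bisimulation_max_weak_bisim[of \<tau> T] assms unfolding weak_bisimulation_def by fast+

lemma max_weak_bisim_subset_approx: "max_weak_bisim \<tau> T \<subseteq> wb_approx \<tau> T k"
proof (induction k)
  case 0
  show ?case using max_weak_bisim_states by fastforce
next
  case (Suc k)
  show ?case
  proof (rule subrelI)
    fix s t assume st: "(s, t) \<in> max_weak_bisim \<tau> T"
    show "(s, t) \<in> wb_approx \<tau> T (Suc k)"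
      by (rule wb_approx_SucI) (use max_weak_bisim_states[OF st] max_weak_bisimD[OF st] Suc.IH in \<open>blast+\<close>)
  qed
qed

lemma max_weak_bisimI: "weak_bisimulation \<tau> T R \<Longrightarrow> (s, t) \<in> R \<Longrightarrow> (s, t) \<in> max_weak_bisim \<tau> T"
  unfolding max_weak_bisim_def by blast

lemma step_rel_states: "wf_lts T \<Longrightarrow> (s, s') \<in> step_rel T a \<Longrightarrow> s \<in> states T \<and> s' \<in> states T"
  unfolding wf_lts_def step_rel_def by auto

lemma step_rel_rtrancl_states:
  "(s, s') \<in> (step_rel T a)\<^sup>* \<Longrightarrow> wf_lts T \<Longrightarrow> s \<in> states T \<Longrightarrow> s' \<in> states T"
  by (induction rule: rtrancl_induct) (auto dest: step_rel_states)

lemma weak_step_states: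
  assumes "wf_lts T" "(s, s') \<in> weak_step \<tau> T a" "s \<in> states T" shows "s' \<in> states T"
  using assms step_rel_rtrancl_states[OF _ assms(1)] step_rel_states[OF assms(1)]
  unfolding weak_step_def by (auto split: if_splits)

lemma weak_step_rtrancl:
  assumes "(s, s') \<in> weak_step \<tau> T a" "a \<in> L" "\<tau> \<in> L"
  shows "(s, s') \<in> (\<Union>b\<in>L. step_rel T b)\<^sup>*"
proof -
  have "(step_rel T \<tau>)\<^sup>* \<subseteq> (\<Union>b\<in>L. step_rel T b)\<^sup>*" "step_rel T a \<subseteq> (\<Union>b\<in>L. step_rel T b)\<^sup>*"
    using assms(2,3) by (auto intro!: rtrancl_mono)
  then show ?thesis
    using assms(1) unfolding weak_step_def by (auto split: if_splits) (meson rtrancl_trans subsetD)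
qed

lemma step_rel_weak_step: "(s, s') \<in> step_rel T a \<Longrightarrow> (s, s') \<in> weak_step \<tau> T a"
  unfolding weak_step_def by auto

subsection \<open>Disjoint unions\<close>

lemma step_rel_sum:
  "step_rel (lts_sum S T) a = map_prod Inl Inl ` step_rel S a \<union> map_prod Inr Inr ` step_rel T a"
  unfolding step_rel_def lts_sum_def by (auto simp: image_iff)

lemma rtrancl_step_rel_Inl:
  "(Inl s, y) \<in> (step_rel (lts_sum S T) a)\<^sup>* \<longleftrightarrow> (\<exists>s'. y = Inl s' \<and> (s, s') \<in> (step_rel S a)\<^sup>*)"
proof
  assume "(Inl s, y) \<in> (step_rel (lts_sum S T) a)\<^sup>*"
  then show "\<exists>s'. y = Inl s' \<and> (s, s') \<in> (step_rel S a)\<^sup>*"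
    by (induction rule: rtrancl_induct) (auto simp: step_rel_sum intro: rtrancl_into_rtrancl)
next
  assume "\<exists>s'. y = Inl s' \<and> (s, s') \<in> (step_rel S a)\<^sup>*"
  then obtain s' where y: "y = Inl s'" and "(s, s') \<in> (step_rel S a)\<^sup>*" by blast
  from this(2) show "(Inl s, y) \<in> (step_rel (lts_sum S T) a)\<^sup>*"
    unfolding y by (induction rule: rtrancl_induct) (auto simp: step_rel_sum intro: rtrancl_into_rtrancl)
qed

lemma rtrancl_step_rel_Inr:
  "(Inr s, y) \<in> (step_rel (lts_sum S T) a)\<^sup>* \<longleftrightarrow> (\<exists>s'. y = Inr s' \<and> (s, s') \<in> (step_rel T a)\<^sup>*)"
proof
  assume "(Inr s, y) \<in> (step_rel (lts_sum S T) a)\<^sup>*"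
  then show "\<exists>s'. y = Inr s' \<and> (s, s') \<in> (step_rel T a)\<^sup>*"
    by (induction rule: rtrancl_induct) (auto simp: step_rel_sum intro: rtrancl_into_rtrancl)
next
  assume "\<exists>s'. y = Inr s' \<and> (s, s') \<in> (step_rel T a)\<^sup>*"
  then obtain s' where y: "y = Inr s'" and "(s, s') \<in> (step_rel T a)\<^sup>*" by blast
  from this(2) show "(Inr s, y) \<in> (step_rel (lts_sum S T) a)\<^sup>*"
    unfolding y by (induction rule: rtrancl_induct) (auto simp: step_rel_sum intro: rtrancl_into_rtrancl)
qed

lemma relcomp_image_iff:
  assumes "\<And>s y. (f s, y) \<in> A \<longleftrightarrow> (\<exists>s'. y = f s' \<and> (s, s') \<in> A')"
    and "\<And>s y. (f s, y) \<in> B \<longleftrightarrow> (\<exists>s'. y = f s' \<and> (s, s') \<in> B')"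
  shows "(f s, y) \<in> A O B \<longleftrightarrow> (\<exists>s'. y = f s' \<and> (s, s') \<in> A' O B')"
proof -
  have "(f s, y) \<in> A O B \<longleftrightarrow> (\<exists>u. (s, u) \<in> A' \<and> (f u, y) \<in> B)"
    unfolding relcomp_unfold using assms(1) by auto
  then show ?thesis unfolding assms(2) by blast
qed

lemma weak_step_sum_Inl:
  "(Inl s, y) \<in> weak_step \<tau> (lts_sum S T) a \<longleftrightarrow> (\<exists>s'. y = Inl s' \<and> (s, s') \<in> weak_step \<tau> S a)"
proof (cases "a = \<tau>")
  case False
  have "(Inl s', z) \<in> step_rel (lts_sum S T) a \<longleftrightarrow> (\<exists>s''. z = Inl s'' \<and> (s', s'') \<in> step_rel S a)" for s' z
    by (auto simp: step_rel_sum)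
  from relcomp_image_iff[OF rtrancl_step_rel_Inl relcomp_image_iff[OF this rtrancl_step_rel_Inl]] False show ?thesis
    by (simp add: weak_step_def)
qed (simp add: weak_step_def rtrancl_step_rel_Inl)

lemma weak_step_sum_Inr:
  "(Inr s, y) \<in> weak_step \<tau> (lts_sum S T) a \<longleftrightarrow> (\<exists>s'. y = Inr s' \<and> (s, s') \<in> weak_step \<tau> T a)"
proof (cases "a = \<tau>")
  case False
  have "(Inr s', z) \<in> step_rel (lts_sum S T) a \<longleftrightarrow> (\<exists>s''. z = Inr s'' \<and> (s', s'') \<in> step_rel T a)" for s' z
    by (auto simp: step_rel_sum)
  from relcomp_image_iff[OF rtrancl_step_rel_Inr relcomp_image_iff[OF this rtrancl_step_rel_Inr]] False show ?thesis
    by (simp add: weak_step_def)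
qed (simp add: weak_step_def rtrancl_step_rel_Inr)

lemma states_sum: "Inl s \<in> states (lts_sum S T) \<longleftrightarrow> s \<in> states S" "Inr t \<in> states (lts_sum S T) \<longleftrightarrow> t \<in> states T"
  by (auto simp: lts_sum_def)

lemma labels_sum: "labels (lts_sum S T) = labels S \<union> labels T"
  by (simp add: lts_sum_def)

lemma wb_approx_Inr_stable_Suc:
  assumes "\<And>q q'. (Inr q, Inr q') \<in> wb_approx \<tau> (lts_sum S T) k \<Longrightarrow> (Inr q, Inr q') \<in> wb_approx \<tau> (lts_sum S T) (Suc k)"
    and "(Inr q, Inr q') \<in> wb_approx \<tau> (lts_sum S T) (Suc k)"
  shows "(Inr q, Inr q') \<in> wb_approx \<tau> (lts_sum S T) (Suc (Suc k))"
proof (rule wb_approx_SucI)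
  show "Inr q \<in> states (lts_sum S T)" "Inr q' \<in> states (lts_sum S T)"
    using wb_approx_states[OF assms(2)] by auto
next
  fix a s' assume a: "a \<in> labels (lts_sum S T)" "(Inr q, s') \<in> weak_step \<tau> (lts_sum S T) a"
  from wb_approx_SucD(1)[OF assms(2) this] obtain t' where
    t': "(Inr q', t') \<in> weak_step \<tau> (lts_sum S T) a" "(s', t') \<in> wb_approx \<tau> (lts_sum S T) k" by blast
  from a(2) t'(1) obtain p p' where "s' = Inr p" "t' = Inr p'" unfolding weak_step_sum_Inr by blast
  with t' assms(1) show "\<exists>t'. (Inr q', t') \<in> weak_step \<tau> (lts_sum S T) a \<and> (s', t') \<in> wb_approx \<tau> (lts_sum S T) (Suc k)"
    by blast
next
  fix a t' assume a: "a \<in> labels (lts_sum S T)" "(Inr q', t') \<in> weak_step \<tau> (lts_sum S T) a"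
  from wb_approx_SucD(2)[OF assms(2) this] obtain s' where
    s': "(Inr q, s') \<in> weak_step \<tau> (lts_sum S T) a" "(s', t') \<in> wb_approx \<tau> (lts_sum S T) k" by blast
  from a(2) s'(1) obtain p p' where "s' = Inr p" "t' = Inr p'" unfolding weak_step_sum_Inr by blast
  with s' assms(1) show "\<exists>s'. (Inr q, s') \<in> weak_step \<tau> (lts_sum S T) a \<and> (s', t') \<in> wb_approx \<tau> (lts_sum S T) (Suc k)"
    by blast
qed

lemma wb_approx_Inr_stable:
  assumes fin: "finite (states T)" and k: "card (states T \<times> states T) \<le> k"
    and "(Inr q, Inr q') \<in> wb_approx \<tau> (lts_sum S T) k"
  shows "(Inr q, Inr q') \<in> wb_approx \<tau> (lts_sum S T) (Suc k)"
proof -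
  define F where "F i = {(q, q'). (Inr q, Inr q') \<in> wb_approx \<tau> (lts_sum S T) i}" for i
  have F: "F i \<subseteq> states T \<times> states T" for i
    by (auto simp: F_def states_sum dest!: wb_approx_states)
  then have finF: "finite (F i)" for i using fin by (meson finite_SigmaI finite_subset)
  have anti: "F (Suc i) \<subseteq> F i" for i
    using wb_approx_Suc_subset[of \<tau> "lts_sum S T" i] unfolding F_def by auto
  have F_iff: "(q, q') \<in> F i \<longleftrightarrow> (Inr q, Inr q') \<in> wb_approx \<tau> (lts_sum S T) i" for q q' i
    by (simp add: F_def)
  have stab: "F (Suc (Suc i)) = F (Suc i)" if eq: "F (Suc i) = F i" for i
  proof (intro equalityI anti subrelI)
    have "(Inr q, Inr q') \<in> wb_approx \<tau> (lts_sum S T) (Suc i)"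
      if "(Inr q, Inr q') \<in> wb_approx \<tau> (lts_sum S T) i" for q q'
      using that unfolding F_iff[symmetric] eq .
    from wb_approx_Inr_stable_Suc[OF this] show "(q, q') \<in> F (Suc (Suc i))" if "(q, q') \<in> F (Suc i)" for q q'
      using that unfolding F_iff by blast
  qed
  have "F (Suc i) = F i \<or> card (F (Suc i)) + Suc i \<le> card (states T \<times> states T)" for i
  proof (induction i)
    case 0
    show ?case
    proof (cases "F 1 = F 0")
      case False
      then have "card (F 1) < card (F 0)" using anti[of 0] finF psubset_card_mono by (metis One_nat_def psubsetI)
      also have "\<dots> \<le> card (states T \<times> states T)" using F fin by (intro card_mono) auto
      finally show ?thesis by simp
    qed simp
  next
    case (Suc i)
    show ?case
    proof (cases "F (Suc (Suc i)) = F (Suc i)")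
      case False
      then have "card (F (Suc (Suc i))) < card (F (Suc i))" using anti[of "Suc i"] finF psubset_card_mono by (metis psubsetI)
      with Suc stab False show ?thesis by fastforce
    qed simp
  qed
  from this[of k] k have "F (Suc k) = F k" by simp
  then show ?thesis using assms(3) unfolding F_iff[symmetric] by simp
qed

text \<open>Once the approximants are stable on the finite side, a valuation is bisimilar to \<open>q\<close> iff it is
  approximately so and never leaves the states that are approximately bisimilar to some state.\<close>

theorem weak_bisim_between_iff:
  fixes S :: "('s, 'a) lts" and T :: "('t, 'a) lts"
  assumes S: "wf_lts S" and T: "wf_lts T" and lab: "labels S = labels T" and tau: "\<tau> \<in> labels T"
    and stable: "\<And>q q'. (Inr q, Inr q') \<in> wb_approx \<tau> (lts_sum S T) k \<Longrightarrow>
      (Inr q, Inr q') \<in> wb_approx \<tau> (lts_sum S T) (Suc k)"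
  shows "(s, q) \<in> weak_bisim_between \<tau> S T \<longleftrightarrow> (Inl s, Inr q) \<in> wb_approx \<tau> (lts_sum S T) (Suc k) \<and>
    (\<forall>s'. (s, s') \<in> (\<Union>a\<in>labels T. step_rel S a)\<^sup>* \<longrightarrow>
       (\<exists>q'. (Inl s', Inr q') \<in> wb_approx \<tau> (lts_sum S T) (Suc k)))"
    (is "?l \<longleftrightarrow> ?r s q")
proof
  let ?U = "lts_sum S T"
  have labU: "labels ?U = labels T" using lab by (simp add: labels_sum)
  {
    assume ?l
    then have sq: "(Inl s, Inr q) \<in> max_weak_bisim \<tau> ?U" by (simp add: weak_bisim_between_def)
    have "\<exists>q'. (Inl s', Inr q') \<in> max_weak_bisim \<tau> ?U" if "(s, s') \<in> (\<Union>a\<in>labels T. step_rel S a)\<^sup>*" for s'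
      using that
    proof (induction rule: rtrancl_induct)
      case (step y z)
      then obtain a q' where a: "a \<in> labels T" "(y, z) \<in> step_rel S a" "(Inl y, Inr q') \<in> max_weak_bisim \<tau> ?U"
        by blast
      then have "(Inl y, Inl z) \<in> weak_step \<tau> ?U a"
        by (auto simp: weak_step_sum_Inl intro: step_rel_weak_step)
      from max_weak_bisimD(1)[OF a(3) _ this] a(1) labU show ?case by (auto simp: weak_step_sum_Inr)
    qed (rule exI[of _ q], rule sq)
    then show "?r s q" using sq max_weak_bisim_subset_approx[of \<tau> ?U "Suc k"] by (meson subsetD)
  next
    assume r: "?r s q"
    define R :: "(('s + 't) \<times> ('s + 't)) set" where "R = {(Inl s, Inr q) | s q. ?r s q}"
    have RI: "(Inl s, Inr q) \<in> R" if "?r s q" for s q using that unfolding R_def by blast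
    have "weak_bisimulation \<tau> ?U R"
      unfolding weak_bisimulation_def
    proof (intro conjI ballI, goal_cases)
      case 1
      show ?case using wb_approx_states unfolding R_def by fast
    next
      case (2 x)
      then obtain s q where x: "x = (Inl s, Inr q)" and sq: "?r s q" unfolding R_def by blast
      have reach: "?r s' q'" if "(Inl s', Inr q') \<in> wb_approx \<tau> ?U (Suc k)" "(s, s') \<in> weak_step \<tau> S a" "a \<in> labels T"
        for s' q' a
        using that sq weak_step_rtrancl[OF that(2,3) tau] by (meson rtrancl_trans)
      have up: "(Inl s', Inr q') \<in> wb_approx \<tau> ?U (Suc k)"
        if h: "(Inl s', Inr q') \<in> wb_approx \<tau> ?U k" "(s, s') \<in> weak_step \<tau> S a" "a \<in> labels T" for s' q' a
      proof -
        obtain q'' where q'': "(Inl s', Inr q'') \<in> wb_approx \<tau> ?U (Suc k)"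
          using sq weak_step_rtrancl[OF h(2,3) tau] by blast
        then have "(Inl s', Inr q'') \<in> wb_approx \<tau> ?U k" by (rule subsetD[OF wb_approx_Suc_subset])
        then have "(Inr q'', Inr q') \<in> wb_approx \<tau> ?U k"
          by (rule wb_approx_trans[OF wb_approx_sym h(1)])
        then have "(Inr q'', Inr q') \<in> wb_approx \<tau> ?U (Suc k)" by (rule stable)
        with q'' show ?thesis by (rule wb_approx_trans)
      qed
      have sq': "(Inl s, Inr q) \<in> wb_approx \<tau> ?U (Suc k)" using sq by blast
      show ?case
        unfolding x prod.case
      proof (intro ballI conjI allI impI)
        fix a y assume a: "a \<in> labels ?U" "(Inl s, y) \<in> weak_step \<tau> ?U a"
        then obtain s' where s': "y = Inl s'" "(s, s') \<in> weak_step \<tau> S a" by (auto simp: weak_step_sum_Inl)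
        obtain q' where q': "(Inr q, Inr q') \<in> weak_step \<tau> ?U a" "(Inl s', Inr q') \<in> wb_approx \<tau> ?U k"
          using wb_approx_SucD(1)[OF sq' a] unfolding s'(1) by (auto simp: weak_step_sum_Inr)
        show "\<exists>t'. (Inr q, t') \<in> weak_step \<tau> ?U a \<and> (y, t') \<in> R"
          using q'(1) RI[OF reach[OF up[OF q'(2) s'(2)] s'(2)]] a(1) s'(1) labU by blast
      next
        fix a y assume a: "a \<in> labels ?U" "(Inr q, y) \<in> weak_step \<tau> ?U a"
        then obtain q' where q': "y = Inr q'" by (auto simp: weak_step_sum_Inr)
        obtain s' where s': "(Inl s, Inl s') \<in> weak_step \<tau> ?U a" "(s, s') \<in> weak_step \<tau> S a"
          "(Inl s', Inr q') \<in> wb_approx \<tau> ?U k"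
          using wb_approx_SucD(2)[OF sq' a] unfolding q' by (auto simp: weak_step_sum_Inl)
        show "\<exists>s'. (Inl s, s') \<in> weak_step \<tau> ?U a \<and> (s', y) \<in> R"
          using s'(1) RI[OF reach[OF up[OF s'(3,2)] s'(2)]] a(1) q' labU by blast
      qed
    qed
    then show ?l using RI[OF r] max_weak_bisimI by (auto simp: weak_bisim_between_def)
  }
qed

section \<open>Invariance under gap equivalence\<close>

definition val_eqv :: "('x, 'a) gcs \<Rightarrow> int \<Rightarrow> ('x \<Rightarrow> int) \<Rightarrow> ('x \<Rightarrow> int) \<Rightarrow> bool" where
  "val_eqv G K \<nu> \<mu> \<longleftrightarrow> gap_eqv K (trms_over (vars G) (consts_of G)) (trm_val \<nu>) (trm_val \<mu>)"

definition star :: "nat \<Rightarrow> ('v \<times> 'v) set \<Rightarrow> 'v set \<Rightarrow> 'v set" where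
  "star N R X = ((\<lambda>Y. Y \<union> R\<inverse> `` Y) ^^ N) X"

lemma star_0 [simp]: "star 0 R X = X"
  and star_Suc [simp]: "star (Suc N) R X = star N R X \<union> R\<inverse> `` star N R X"
  by (simp_all add: star_def)

lemma star_eq: "star N R X = (\<Union>i\<le>N. (R ^^ i)\<inverse> `` X)"
proof (induction N)
  case (Suc N)
  have "R\<inverse> `` ((R ^^ i)\<inverse> `` X) = (R ^^ Suc i)\<inverse> `` X" for i
    unfolding relpow.simps(2) relpow_commute[symmetric] converse_relcomp relcomp_Image ..
  then have "R\<inverse> `` star N R X = (\<Union>i\<le>N. (R ^^ Suc i)\<inverse> `` X)"
    unfolding Suc by (simp add: Image_UN del: relpow.simps)
  moreover have "{..Suc N} = {..N} \<union> Suc ` {..N}" by (auto simp: image_iff le_Suc_eq)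
  ultimately show ?case unfolding star_Suc Suc by (simp add: UN_Un del: relpow.simps)
qed simp

lemma star_subset_rtrancl: "star N R X \<subseteq> (R\<^sup>*)\<inverse> `` X"
  unfolding star_eq by (auto dest: relpow_imp_rtrancl)

lemma subset_star: "X \<subseteq> star N R X"
  by (induction N) auto

lemma star_closed:
  assumes "star (Suc N) R X \<subseteq> star N R X"
  shows "(R\<^sup>*)\<inverse> `` X = star N R X"
proof
  have "(x, y) \<in> R\<^sup>* \<Longrightarrow> y \<in> X \<Longrightarrow> x \<in> star N R X" for x y
    by (induction rule: converse_rtrancl_induct) (use assms subset_star[of X N R] in auto)
  then show "(R\<^sup>*)\<inverse> `` X \<subseteq> star N R X" by blast
qed (rule star_subset_rtrancl)

lemma star_Union: "star N R (\<Union>(X ` A)) = (\<Union>x\<in>A. star N R (X x))"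
  unfolding star_eq by blast

locale bounded_gcs =
  fixes G :: "('x, 'a) gcs" and n M c :: nat
  assumes wf: "wf_gcs G"
    and card_vars: "card (vars G) \<le> n"
    and M_pos: "1 \<le> M"
    and gap_le: "\<And>D t u k. D \<in> constraints G \<Longrightarrow> Gap t u k \<in> set D \<Longrightarrow> \<bar>k\<bar> \<le> int M"
    and const_le: "\<And>d. d \<in> consts_of G \<Longrightarrow> \<bar>d\<bar> \<le> int c"
begin

definition level :: "nat \<Rightarrow> int" where
  "level \<rho> = 4 ^ (n * \<rho>) * int M"

definition spread :: "nat \<Rightarrow> int" where
  "spread \<rho> = int n * (2 * 4 ^ n * level \<rho>)"

lemma level_Suc: "level (Suc \<rho>) = 4 ^ n * level \<rho>"
  by (simp add: level_def power_add mult_ac)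

lemma level_mono: "\<rho> \<le> \<rho>' \<Longrightarrow> level \<rho> \<le> level \<rho>'"
  unfolding level_def by (intro mult_right_mono power_increasing) auto

lemma M_le_level: "int M \<le> level \<rho>"
  using level_mono[of 0 \<rho>] by (simp add: level_def)

lemma level_pos: "1 \<le> level \<rho>"
  using M_le_level[of \<rho>] M_pos by linarith

lemma spread_mono: "\<rho> \<le> \<rho>' \<Longrightarrow> spread \<rho> \<le> spread \<rho>'"
  unfolding spread_def by (intro mult_left_mono level_mono) auto

lemma finite_vars: "finite (vars G)" and finite_consts: "finite (consts_of G)"
  using wf by (auto simp: wf_gcs_def)

lemma finite_trms: "finite (trms_over (vars G) (consts_of G))"
  using finite_vars finite_consts by (simp add: trms_over_def)

lemma card_spread:
  assumes "k = card (vars G)" shows "B + int k * (2 * 4 ^ k * level \<rho>) \<le> B + spread \<rho>"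
proof -
  have "(4::int) ^ k \<le> 4 ^ n" using card_vars assms by (intro power_increasing) auto
  then have "2 * 4 ^ k * level \<rho> \<le> 2 * 4 ^ n * level \<rho>" using level_pos[of \<rho>] by (intro mult_right_mono) auto
  then have "int k * (2 * 4 ^ k * level \<rho>) \<le> int n * (2 * 4 ^ n * level \<rho>)"
    using card_vars assms level_pos[of \<rho>] by (intro mult_mono) auto
  then show ?thesis by (simp add: spread_def)
qed

lemma val_eqv_mono: "val_eqv G K \<nu> \<mu> \<Longrightarrow> L \<le> K \<Longrightarrow> val_eqv G L \<nu> \<mu>"
  unfolding val_eqv_def by (rule gap_eqv_mono) auto

lemma step_match:
  assumes step: "(\<nu>, \<nu>') \<in> gstep G m" and eqv: "val_eqv G (level (Suc \<rho>)) \<nu> \<mu>" and \<mu>: "\<mu> \<in> Val (vars G)"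
    and B: "\<And>x. x \<in> vars G \<Longrightarrow> \<bar>\<mu> x\<bar> \<le> B" "int c \<le> B"
  shows "\<exists>\<mu>'. (\<mu>, \<mu>') \<in> gstep G m \<and> val_eqv G (level \<rho>) \<nu>' \<mu>' \<and> (\<forall>x\<in>vars G. \<bar>\<mu>' x\<bar> \<le> B + spread \<rho>)"
proof -
  let ?I = "trms_over (Unprimed ` vars G) (consts_of G)" and ?J = "V ` Primed ` vars G"
  let ?k = "card (vars G)"
  have fin: "finite ?J" "finite ?I" using finite_vars finite_consts by (auto simp: trms_over_def)
  have disj: "?I \<inter> ?J = {}" by (auto simp: trms_over_def)
  have card: "card ?J = ?k" by (simp add: card_image inj_on_def image_image)
  let ?T = "trms_over (vars G) (consts_of G)"
  have I_eq: "?I = map_trm Unprimed ` ?T" by (auto simp: trms_over_def image_Un image_image)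
  have un: "trm_val (joint \<kappa> \<kappa>') (map_trm Unprimed t) = trm_val \<kappa> t" for \<kappa> \<kappa>' t
    by (cases t) (simp_all add: joint_def)
  have "4 ^ ?k * level \<rho> \<le> level (Suc \<rho>)"
    unfolding level_Suc using level_pos[of \<rho>] card_vars by (intro mult_right_mono power_increasing) auto
  then have "gap_eqv (4 ^ ?k * level \<rho>) ?T (trm_val \<nu>) (trm_val \<mu>)"
    using eqv gap_eqv_mono unfolding val_eqv_def by blast
  then have eqvI: "gap_eqv (4 ^ card ?J * level \<rho>) ?I (trm_val (joint \<nu> \<nu>')) (trm_val (joint \<mu> \<mu>))"
    unfolding I_eq card by (simp add: gap_eqv_def un)
  have BI: "\<bar>trm_val (joint \<mu> \<mu>) i\<bar> \<le> B" if "i \<in> ?I" for i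
    using that B const_le order.trans unfolding trms_over_def by (force simp: joint_def)
  have "0 \<le> B" using B(2) by simp
  from gap_eqv_extend[OF fin disj level_pos this eqvI BI, of "trm_val (joint \<nu> \<nu>')"] obtain q where
    q: "\<And>i. i \<notin> ?J \<Longrightarrow> q i = trm_val (joint \<mu> \<mu>) i" "gap_eqv (level \<rho>) (?I \<union> ?J) (trm_val (joint \<nu> \<nu>')) q"
      "\<And>j. j \<in> ?J \<Longrightarrow> \<bar>q j\<bar> \<le> B + int ?k * (2 * 4 ^ ?k * level \<rho>)"
    unfolding card by auto
  define \<mu>' where "\<mu>' = restrict (\<lambda>x. q (V (Primed x))) (vars G)"
  have \<mu>': "\<mu>' \<in> Val (vars G)" by (simp add: \<mu>'_def Val_def)
  have q_eq: "q i = trm_val (joint \<mu> \<mu>') i" if "i \<in> ?I \<union> ?J" for i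
  proof (cases "i \<in> ?J")
    case True then show ?thesis by (auto simp: \<mu>'_def joint_def)
  next
    case False then show ?thesis using that q(1)[OF False] by (auto simp: trms_over_def joint_def)
  qed
  then have eqv': "gap_eqv (level \<rho>) (?I \<union> ?J) (trm_val (joint \<nu> \<nu>')) (trm_val (joint \<mu> \<mu>'))"
    using q(2) gap_eqv_cong[of "?I \<union> ?J" "trm_val (joint \<nu> \<nu>')" "trm_val (joint \<nu> \<nu>')" q "trm_val (joint \<mu> \<mu>')"]
    by blast
  have IJ: "?I \<union> ?J = trms_over (Unprimed ` vars G \<union> Primed ` vars G) (consts_of G)"
    by (auto simp: trms_over_def)
  from step obtain D where D: "D \<in> constraints G" "m = None \<or> m = Some (lab G D)"
    "\<forall>c \<in> set D. clause_sat (joint \<nu> \<nu>') c" by (auto simp: gstep_def)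
  have "clause_sat (joint \<mu> \<mu>') cl" if cl: "cl \<in> set D" for cl
  proof (cases cl)
    case (Gap t u k)
    have "clause_over (Unprimed ` vars G \<union> Primed ` vars G) (consts_of G) cl"
      using wf D(1) cl by (auto simp: wf_gcs_def)
    then have "t \<in> ?I \<union> ?J" "u \<in> ?I \<union> ?J" unfolding IJ Gap by auto
    moreover have "\<bar>k\<bar> \<le> level \<rho>" using gap_le[OF D(1)] cl M_le_level[of \<rho>] unfolding Gap by fastforce
    ultimately show ?thesis using gap_eqvD[OF eqv', of t u k] D(3) cl unfolding Gap by auto
  qed
  then have "(\<mu>, \<mu>') \<in> gstep G m" using D \<mu> \<mu>' by (auto simp: gstep_def)
  moreover have "val_eqv G (level \<rho>) \<nu>' \<mu>'"
  proof -
    have pr: "trm_val (joint \<kappa> \<kappa>') (map_trm Primed t) = trm_val \<kappa>' t" for \<kappa> \<kappa>' t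
      by (cases t) (simp_all add: joint_def)
    have "map_trm Primed ` ?T \<subseteq> ?I \<union> ?J" by (auto simp: trms_over_def)
    from gap_eqv_mono[OF eqv' order.refl this] show ?thesis
      unfolding val_eqv_def by (simp add: gap_eqv_def pr)
  qed
  moreover have "\<bar>\<mu>' x\<bar> \<le> B + spread \<rho>" if "x \<in> vars G" for x
    using q(3)[of "V (Primed x)"] that card_spread[OF refl, of B \<rho>] by (simp add: \<mu>'_def)
  ultimately show ?thesis by blast
qed

lemma ex_bounded_representative:
  assumes "\<nu> \<in> Val (vars G)"
  shows "\<exists>\<mu>\<in>Val (vars G). val_eqv G (level \<rho>) \<nu> \<mu> \<and> (\<forall>x\<in>vars G. \<bar>\<mu> x\<bar> \<le> int c + spread \<rho>)"
proof -
  let ?I = "C ` consts_of G :: 'x trm set" and ?J = "V ` vars G"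
  let ?k = "card (vars G)"
  have fin: "finite ?J" "finite ?I" using finite_vars finite_consts by auto
  have disj: "?I \<inter> ?J = {}" by auto
  have card: "card ?J = ?k" by (simp add: card_image inj_on_def)
  have BI: "\<bar>trm_val \<nu> i\<bar> \<le> int c" if "i \<in> ?I" for i
    using that const_le by auto
  from gap_eqv_extend[where p = "trm_val \<nu>" and q = "trm_val \<nu>" and p' = "trm_val \<nu>",
      OF fin disj level_pos[of \<rho>] _ gap_eqv_refl BI] obtain q where
    q: "\<And>i. i \<notin> ?J \<Longrightarrow> q i = trm_val \<nu> i" "gap_eqv (level \<rho>) (?I \<union> ?J) (trm_val \<nu>) q"
      "\<And>j. j \<in> ?J \<Longrightarrow> \<bar>q j\<bar> \<le> int c + int ?k * (2 * 4 ^ ?k * level \<rho>)"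
    unfolding card by auto
  define \<mu> where "\<mu> = restrict (\<lambda>x. q (V x)) (vars G)"
  have "q i = trm_val \<mu> i" if "i \<in> ?I \<union> ?J" for i
    using that q(1)[of i] by (auto simp: \<mu>_def image_iff)
  moreover have "?I \<union> ?J = trms_over (vars G) (consts_of G)" by (auto simp: trms_over_def)
  ultimately have "val_eqv G (level \<rho>) \<nu> \<mu>"
    using q(2) unfolding val_eqv_def by (simp add: gap_eqv_def)
  moreover have "\<bar>\<mu> x\<bar> \<le> int c + spread \<rho>" if "x \<in> vars G" for x
    using q(3)[of "V x"] that card_spread[OF refl, of "int c" \<rho>] by (simp add: \<mu>_def)
  ultimately show ?thesis by (intro bexI[of _ \<mu>]) (auto simp: \<mu>_def Val_def)
qed

definition invariant :: "nat \<Rightarrow> ('x \<Rightarrow> int) set \<Rightarrow> bool" where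
  "invariant \<rho> X \<longleftrightarrow> X \<subseteq> Val (vars G) \<and>
     (\<forall>\<nu>\<in>Val (vars G). \<forall>\<mu>\<in>Val (vars G). val_eqv G (level \<rho>) \<nu> \<mu> \<longrightarrow> \<nu> \<in> X \<longrightarrow> \<mu> \<in> X)"

lemma invariantD:
  "invariant \<rho> X \<Longrightarrow> \<nu> \<in> Val (vars G) \<Longrightarrow> \<mu> \<in> Val (vars G) \<Longrightarrow> val_eqv G (level \<rho>) \<nu> \<mu> \<Longrightarrow> \<nu> \<in> X \<Longrightarrow> \<mu> \<in> X"
  by (auto simp: invariant_def)

lemma val_eqv_sym: "val_eqv G K \<nu> \<mu> \<Longrightarrow> val_eqv G K \<mu> \<nu>"
  unfolding val_eqv_def by (rule gap_eqv_sym)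

lemma invariant_subset: "invariant \<rho> X \<Longrightarrow> X \<subseteq> Val (vars G)"
  by (simp add: invariant_def)

lemma invariant_mono: "invariant \<rho> X \<Longrightarrow> \<rho> \<le> \<rho>' \<Longrightarrow> invariant \<rho>' X"
  unfolding invariant_def using val_eqv_mono[of "level \<rho>'" _ _ "level \<rho>"] level_mono[of \<rho> \<rho>'] by simp

lemma invariant_Val: "invariant \<rho> (Val (vars G))"
  by (simp add: invariant_def)

lemma invariantI:
  assumes "X \<subseteq> Val (vars G)"
    "\<And>\<nu> \<mu>. \<nu> \<in> X \<Longrightarrow> \<mu> \<in> Val (vars G) \<Longrightarrow> val_eqv G (level \<rho>) \<nu> \<mu> \<Longrightarrow> \<mu> \<in> X"
  shows "invariant \<rho> X"
  using assms unfolding invariant_def by blast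

lemma invariant_Un:
  assumes X: "invariant \<rho> X" and Y: "invariant \<rho> Y" shows "invariant \<rho> (X \<union> Y)"
proof (rule invariantI)
  show "X \<union> Y \<subseteq> Val (vars G)" using X Y invariant_subset by blast
  then show "\<mu> \<in> X \<union> Y" if "\<nu> \<in> X \<union> Y" "\<mu> \<in> Val (vars G)" "val_eqv G (level \<rho>) \<nu> \<mu>" for \<nu> \<mu>
    using that invariantD[OF X _ that(2,3)] invariantD[OF Y _ that(2,3)] by blast
qed

lemma invariant_Union:
  assumes X: "\<And>i. i \<in> A \<Longrightarrow> invariant \<rho> (X i)" shows "invariant \<rho> (\<Union>i\<in>A. X i)"
proof (rule invariantI)
  show "(\<Union>i\<in>A. X i) \<subseteq> Val (vars G)" using invariant_subset[OF X] by blast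
  fix \<nu> \<mu> assume "\<nu> \<in> (\<Union>i\<in>A. X i)" and \<mu>: "\<mu> \<in> Val (vars G)" "val_eqv G (level \<rho>) \<nu> \<mu>"
  then obtain i where i: "i \<in> A" "\<nu> \<in> X i" by blast
  with invariant_subset[OF X] have "\<nu> \<in> Val (vars G)" by blast
  from invariantD[OF X[OF i(1)] this \<mu> i(2)] i(1) show "\<mu> \<in> (\<Union>i\<in>A. X i)" by blast
qed

lemma invariant_Diff:
  assumes X: "invariant \<rho> X" and Y: "invariant \<rho> Y" shows "invariant \<rho> (X - Y)"
proof (rule invariantI)
  show XV: "X - Y \<subseteq> Val (vars G)" using invariant_subset[OF X] by blast
  fix \<nu> \<mu> assume \<nu>: "\<nu> \<in> X - Y" and \<mu>: "\<mu> \<in> Val (vars G)" "val_eqv G (level \<rho>) \<nu> \<mu>"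
  with XV have "\<nu> \<in> Val (vars G)" by blast
  from invariantD[OF X this \<mu>] invariantD[OF Y \<mu>(1) this val_eqv_sym[OF \<mu>(2)]] \<nu>
  show "\<mu> \<in> X - Y" by blast
qed

lemma invariant_pre:
  assumes "invariant \<rho> X" shows "invariant (Suc \<rho>) ((gstep G m)\<inverse> `` X)"
  unfolding invariant_def
proof (intro conjI ballI impI)
  show "(gstep G m)\<inverse> `` X \<subseteq> Val (vars G)" by (auto simp: gstep_def)
next
  fix \<nu> \<mu> assume \<mu>: "\<mu> \<in> Val (vars G)" and eqv: "val_eqv G (level (Suc \<rho>)) \<nu> \<mu>"
    and "\<nu> \<in> (gstep G m)\<inverse> `` X"
  then obtain \<nu>' where \<nu>': "(\<nu>, \<nu>') \<in> gstep G m" "\<nu>' \<in> X" by blast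
  define B where "B = Max (insert (int c) ((\<lambda>x. \<bar>\<mu> x\<bar>) ` vars G))"
  have "\<bar>\<mu> x\<bar> \<le> B" if "x \<in> vars G" for x using that finite_vars by (simp add: B_def)
  moreover have "int c \<le> B" using finite_vars by (simp add: B_def)
  ultimately obtain \<mu>' where \<mu>': "(\<mu>, \<mu>') \<in> gstep G m" "val_eqv G (level \<rho>) \<nu>' \<mu>'"
    using step_match[OF \<nu>'(1) eqv \<mu>] by blast
  have "\<nu>' \<in> Val (vars G)" "\<mu>' \<in> Val (vars G)" using \<nu>'(1) \<mu>'(1) by (auto simp: gstep_def)
  from invariantD[OF assms this \<mu>'(2) \<nu>'(2)] \<mu>'(1) show "\<mu> \<in> (gstep G m)\<inverse> `` X" by blast
qed

lemma invariant_star: "invariant \<rho> X \<Longrightarrow> invariant (\<rho> + N) (star N (gstep G m) X)"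
proof (induction N)
  case (Suc N)
  have "invariant (\<rho> + Suc N) (star N (gstep G m) X)"
    by (rule invariant_mono[OF Suc.IH[OF Suc.prems]]) simp
  then show ?case using invariant_pre[OF Suc.IH[OF Suc.prems], of m] by (simp add: invariant_Un)
qed simp

end

subsection \<open>Invariant sets are gap definable\<close>

primrec big_or :: "(nat \<Rightarrow> 'v gap_formula) \<Rightarrow> nat \<Rightarrow> 'v gap_formula" where
  "big_or f 0 = FNot FTrue"
| "big_or f (Suc m) = FOr (f m) (big_or f m)"

primrec big_and :: "(nat \<Rightarrow> 'v gap_formula) \<Rightarrow> nat \<Rightarrow> 'v gap_formula" where
  "big_and f 0 = FTrue"
| "big_and f (Suc m) = FAnd (f m) (big_and f m)"

lemma formula_sat_big_or [simp]: "formula_sat \<nu> (big_or f m) \<longleftrightarrow> (\<exists>i<m. formula_sat \<nu> (f i))"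
  by (induction m) (auto simp: less_Suc_eq)

lemma formula_sat_big_and [simp]: "formula_sat \<nu> (big_and f m) \<longleftrightarrow> (\<forall>i<m. formula_sat \<nu> (f i))"
  by (induction m) (auto simp: less_Suc_eq)

lemma formula_over_big_or: "(\<And>i. i < m \<Longrightarrow> formula_over Vs Cs (f i)) \<Longrightarrow> formula_over Vs Cs (big_or f m)"
  by (induction m) auto

lemma formula_over_big_and: "(\<And>i. i < m \<Longrightarrow> formula_over Vs Cs (f i)) \<Longrightarrow> formula_over Vs Cs (big_and f m)"
  by (induction m) auto

definition literal :: "('v \<Rightarrow> int) \<Rightarrow> 'v gap_clause \<Rightarrow> 'v gap_formula" where
  "literal \<nu> c = (if clause_sat \<nu> c then FClause c else FNot (FClause c))"

lemma formula_sat_literal [simp]: "formula_sat \<mu> (literal \<nu> c) \<longleftrightarrow> (clause_sat \<nu> c \<longleftrightarrow> clause_sat \<mu> c)"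
  by (simp add: literal_def)

lemma formula_over_literal [simp]: "formula_over Vs Cs (literal \<nu> c) \<longleftrightarrow> clause_over Vs Cs c"
  by (simp add: literal_def)

context bounded_gcs
begin

definition clauses :: "nat \<Rightarrow> 'x gap_clause set" where
  "clauses \<rho> = {Gap t u k | t u k. t \<in> trms_over (vars G) (consts_of G) \<and>
     u \<in> trms_over (vars G) (consts_of G) \<and> \<bar>k\<bar> \<le> level \<rho>}"

lemma val_eqv_iff_clauses: "val_eqv G (level \<rho>) \<nu> \<mu> \<longleftrightarrow> (\<forall>c\<in>clauses \<rho>. clause_sat \<nu> c \<longleftrightarrow> clause_sat \<mu> c)"
proof -
  have "(\<forall>c\<in>clauses \<rho>. P c) \<longleftrightarrow> (\<forall>t\<in>trms_over (vars G) (consts_of G). \<forall>u\<in>trms_over (vars G) (consts_of G).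
      \<forall>k. \<bar>k\<bar> \<le> level \<rho> \<longrightarrow> P (Gap t u k))" for P
    unfolding clauses_def by blast
  then show ?thesis by (simp add: val_eqv_def gap_eqv_def)
qed

lemma finite_clauses: "finite (clauses \<rho>)"
proof -
  let ?T = "trms_over (vars G) (consts_of G)"
  have "clauses \<rho> \<subseteq> (\<lambda>(t, u, k). Gap t u k) ` (?T \<times> ?T \<times> {- level \<rho>..level \<rho>})"
    unfolding clauses_def by (force simp: image_iff)
  then show ?thesis using finite_trms by (meson finite_SigmaI finite_atLeastAtMost_int finite_imageI finite_subset)
qed

lemma clause_over_clauses: "cl \<in> clauses \<rho> \<Longrightarrow> clause_over (vars G) (consts_of G) cl"
  by (auto simp: clauses_def)

lemma gap_definable_invariant:
  assumes X: "invariant \<rho> X" shows "gap_definable (vars G) (consts_of G) X"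
proof -
  define sat where "sat \<nu> = {c \<in> clauses \<rho>. clause_sat \<nu> c}" for \<nu>
  have "finite (sat ` X)"
    by (rule finite_subset[of _ "Pow (clauses \<rho>)"]) (auto simp: sat_def finite_clauses)
  then obtain R where R: "R \<subseteq> X" "finite R" "sat ` X = sat ` R"
    using finite_subset_image[of "sat ` X" sat X] by blast
  obtain rs where rs: "set rs = R" using finite_list[OF R(2)] by blast
  obtain cs where cs: "set cs = clauses \<rho>" using finite_list[OF finite_clauses] by blast
  define \<phi> where "\<phi> = big_or (\<lambda>i. big_and (\<lambda>j. literal (rs ! i) (cs ! j)) (length cs)) (length rs)"
  have "formula_over (vars G) (consts_of G) \<phi>"
    using cs clause_over_clauses[of _ \<rho>] unfolding \<phi>_def
    by (intro formula_over_big_or formula_over_big_and) (metis formula_over_literal nth_mem)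
  moreover have "formula_sat \<mu> \<phi> \<longleftrightarrow> (\<exists>\<nu>\<in>R. \<forall>c\<in>clauses \<rho>. clause_sat \<nu> c \<longleftrightarrow> clause_sat \<mu> c)" for \<mu>
    unfolding \<phi>_def rs[symmetric] cs[symmetric] by (simp add: all_set_conv_all_nth) (metis in_set_conv_nth)
  moreover have "\<mu> \<in> X \<longleftrightarrow> (\<exists>\<nu>\<in>R. \<forall>c\<in>clauses \<rho>. clause_sat \<nu> c \<longleftrightarrow> clause_sat \<mu> c)" if \<mu>: "\<mu> \<in> Val (vars G)" for \<mu>
  proof
    assume "\<mu> \<in> X"
    then obtain \<nu> where "\<nu> \<in> R" "sat \<mu> = sat \<nu>" using R(3) by blast
    then show "\<exists>\<nu>\<in>R. \<forall>c\<in>clauses \<rho>. clause_sat \<nu> c \<longleftrightarrow> clause_sat \<mu> c" unfolding sat_def by blast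
  next
    assume "\<exists>\<nu>\<in>R. \<forall>c\<in>clauses \<rho>. clause_sat \<nu> c \<longleftrightarrow> clause_sat \<mu> c"
    then obtain \<nu> where \<nu>: "\<nu> \<in> X" "val_eqv G (level \<rho>) \<nu> \<mu>" unfolding val_eqv_iff_clauses using R(1) by blast
    with invariant_subset[OF X] have "\<nu> \<in> Val (vars G)" by blast
    from invariantD[OF X this \<mu> \<nu>(2,1)] show "\<mu> \<in> X" .
  qed
  ultimately show ?thesis
    using invariant_subset[OF X] unfolding gap_definable_def defines_set_def by blast
qed

end

section \<open>Bisimilar valuations\<close>

lemma wf_lts_gcs_lts: "wf_gcs G \<Longrightarrow> wf_lts (gcs_lts G)"
  by (auto simp: wf_lts_def gcs_lts_def wf_gcs_def)

locale bounded_bisim = bounded_gcs G n M c for G :: "('x, 'a) gcs" and n M c +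
  fixes \<tau> :: 'a and T :: "('s, 'a) lts" and k N :: nat
  assumes tau: "\<tau> \<in> acts G" and T: "wf_lts T" "labels T = acts G" "finite (states T)"
    and k: "card (states T \<times> states T) \<le> k"
begin

definition top_rank :: nat where
  "top_rank = (2 * N + 1) * (k + 2)"

definition star_exact :: bool where
  "star_exact \<longleftrightarrow> (\<forall>m\<in>{None, Some \<tau>}. \<forall>X. invariant top_rank X \<longrightarrow>
     ((gstep G m)\<^sup>*)\<inverse> `` X = star N (gstep G m) X)"

definition wpre :: "'a \<Rightarrow> ('x \<Rightarrow> int) set \<Rightarrow> ('x \<Rightarrow> int) set" where
  "wpre a X = (let Y = star N (gstep G (Some \<tau>)) X in
     if a = \<tau> then Y else star N (gstep G (Some \<tau>)) ((gstep G (Some a))\<inverse> `` Y))"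

definition approx_set :: "nat \<Rightarrow> 's \<Rightarrow> ('x \<Rightarrow> int) set" where
  "approx_set i q = {\<nu> \<in> Val (vars G). (Inl \<nu>, Inr q) \<in> wb_approx \<tau> (lts_sum (gcs_lts G) T) i}"

lemma invariant_wpre: "invariant \<rho> X \<Longrightarrow> invariant (\<rho> + (2 * N + 1)) (wpre a X)"
proof -
  assume "invariant \<rho> X"
  then have Y: "invariant (\<rho> + N) (star N (gstep G (Some \<tau>)) X)" by (rule invariant_star)
  show ?thesis
  proof (cases "a = \<tau>")
    case True
    then show ?thesis using invariant_mono[OF Y, of "\<rho> + (2 * N + 1)"] by (simp add: wpre_def)
  next
    case False
    with invariant_star[OF invariant_pre[OF Y], of N "Some \<tau>" "Some a"] show ?thesis
      by (simp add: wpre_def add_ac mult_2)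
  qed
qed

lemma weak_step_eq_wpre:
  assumes exact: star_exact and X: "invariant \<rho> X" "\<rho> + N + 1 \<le> top_rank"
  shows "(weak_step \<tau> (gcs_lts G) a)\<inverse> `` X = wpre a X"
proof -
  have st: "((gstep G (Some \<tau>))\<^sup>*)\<inverse> `` Y = star N (gstep G (Some \<tau>)) Y" if "invariant \<rho>' Y" "\<rho>' \<le> top_rank" for Y \<rho>'
    using exact invariant_mono[OF that] unfolding star_exact_def by blast
  have Y: "invariant (\<rho> + N) (star N (gstep G (Some \<tau>)) X)" using X(1) by (rule invariant_star)
  note Y' = invariant_pre[OF Y, of "Some a"]
  show ?thesis
  proof (cases "a = \<tau>")
    case True
    then show ?thesis using st[OF X(1)] X(2) by (simp add: weak_step_def wpre_def step_rel_gcs_lts)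
  next
    case False
    have "(weak_step \<tau> (gcs_lts G) a)\<inverse> `` X =
        ((gstep G (Some \<tau>))\<^sup>*)\<inverse> `` ((gstep G (Some a))\<inverse> `` (((gstep G (Some \<tau>))\<^sup>*)\<inverse> `` X))"
      using False by (auto simp: weak_step_def step_rel_gcs_lts)
    also have "\<dots> = wpre a X"
      using False st[OF X(1)] st[OF Y'] X(2) by (simp add: wpre_def)
    finally show ?thesis .
  qed
qed

lemma approx_set_0: "q \<in> states T \<Longrightarrow> approx_set 0 q = Val (vars G)"
  by (auto simp: approx_set_def lts_sum_def gcs_lts_def)

lemma labels_gcs_lts: "labels (gcs_lts G) = acts G" and states_gcs_lts: "states (gcs_lts G) = Val (vars G)"
  by (simp_all add: gcs_lts_def)

lemma approx_set_Suc_weak_step: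
  assumes q: "q \<in> states T"
  shows "approx_set (Suc i) q = {\<nu> \<in> Val (vars G). \<forall>a\<in>acts G.
    (\<forall>q'. (q, q') \<in> weak_step \<tau> T a \<longrightarrow> \<nu> \<in> (weak_step \<tau> (gcs_lts G) a)\<inverse> `` approx_set i q') \<and>
    \<nu> \<notin> (weak_step \<tau> (gcs_lts G) a)\<inverse> `` (Val (vars G) - (\<Union>q'\<in>weak_step \<tau> T a `` {q}. approx_set i q'))}"
proof -
  let ?U = "lts_sum (gcs_lts G) T"
  have "(Inl \<nu>, Inr q) \<in> wb_approx \<tau> ?U (Suc i) \<longleftrightarrow> (\<forall>a\<in>acts G.
      (\<forall>q'. (q, q') \<in> weak_step \<tau> T a \<longrightarrow> \<nu> \<in> (weak_step \<tau> (gcs_lts G) a)\<inverse> `` approx_set i q') \<and>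
      \<nu> \<notin> (weak_step \<tau> (gcs_lts G) a)\<inverse> `` (Val (vars G) - (\<Union>q'\<in>weak_step \<tau> T a `` {q}. approx_set i q')))"
    if \<nu>: "\<nu> \<in> Val (vars G)" for \<nu>
  proof -
    have W: "\<nu>' \<in> Val (vars G)" if "(\<nu>, \<nu>') \<in> weak_step \<tau> (gcs_lts G) a" for \<nu>' a
      using weak_step_states[OF wf_lts_gcs_lts[OF wf] that] \<nu> by (simp add: states_gcs_lts)
    have 1: "(\<forall>s'. (Inl \<nu>, s') \<in> weak_step \<tau> ?U a \<longrightarrow>
          (\<exists>t'. (Inr q, t') \<in> weak_step \<tau> ?U a \<and> (s', t') \<in> wb_approx \<tau> ?U i)) \<longleftrightarrow>
        \<nu> \<notin> (weak_step \<tau> (gcs_lts G) a)\<inverse> `` (Val (vars G) - (\<Union>q'\<in>weak_step \<tau> T a `` {q}. approx_set i q'))" for a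
      unfolding weak_step_sum_Inl weak_step_sum_Inr approx_set_def using W by (auto 0 3)
    have 2: "(\<forall>t'. (Inr q, t') \<in> weak_step \<tau> ?U a \<longrightarrow>
          (\<exists>s'. (Inl \<nu>, s') \<in> weak_step \<tau> ?U a \<and> (s', t') \<in> wb_approx \<tau> ?U i)) \<longleftrightarrow>
        (\<forall>q'. (q, q') \<in> weak_step \<tau> T a \<longrightarrow> \<nu> \<in> (weak_step \<tau> (gcs_lts G) a)\<inverse> `` approx_set i q')" for a
      unfolding weak_step_sum_Inl weak_step_sum_Inr approx_set_def using W by (auto 0 3)
    have "labels ?U = acts G" using T(2) by (simp add: labels_sum labels_gcs_lts)
    then show ?thesis
      using \<nu> q unfolding wb_approx.simps mem_Collect_eq prod.case mem_Sigma_iff states_sum states_gcs_lts 1 2 by blast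
  qed
  then show ?thesis unfolding approx_set_def by blast
qed

lemma approx_set_Suc:
  assumes star_exact and q: "q \<in> states T" and inv: "\<And>q. q \<in> states T \<Longrightarrow> invariant \<rho> (approx_set i q)"
    and \<rho>: "\<rho> + N + 1 \<le> top_rank"
  shows "approx_set (Suc i) q = {\<nu> \<in> Val (vars G). \<forall>a\<in>acts G.
    (\<forall>q'. (q, q') \<in> weak_step \<tau> T a \<longrightarrow> \<nu> \<in> wpre a (approx_set i q')) \<and>
    \<nu> \<notin> wpre a (Val (vars G) - (\<Union>q'\<in>weak_step \<tau> T a `` {q}. approx_set i q'))}"
proof -
  have q': "q' \<in> states T" if "(q, q') \<in> weak_step \<tau> T a" for q' a
    using weak_step_states[OF T(1) that q] .
  have "invariant \<rho> (Val (vars G) - (\<Union>q'\<in>weak_step \<tau> T a `` {q}. approx_set i q'))" for a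
    using q' by (intro invariant_Diff invariant_Val invariant_Union inv) blast
  from weak_step_eq_wpre[OF assms(1) this \<rho>] have
    1: "(weak_step \<tau> (gcs_lts G) a)\<inverse> `` (Val (vars G) - (\<Union>q'\<in>weak_step \<tau> T a `` {q}. approx_set i q')) =
      wpre a (Val (vars G) - (\<Union>q'\<in>weak_step \<tau> T a `` {q}. approx_set i q'))" for a .
  have 2: "(weak_step \<tau> (gcs_lts G) a)\<inverse> `` approx_set i q' = wpre a (approx_set i q')"
    if "(q, q') \<in> weak_step \<tau> T a" for a q'
    using weak_step_eq_wpre[OF assms(1) inv[OF q'[OF that]] \<rho>] .
  show ?thesis unfolding approx_set_Suc_weak_step[OF q] 1 using 2 by auto
qed

lemma invariant_approx_set:
  assumes star_exact shows "i \<le> k + 1 \<Longrightarrow> q \<in> states T \<Longrightarrow> invariant ((2 * N + 1) * i) (approx_set i q)"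
proof (induction i arbitrary: q)
  case 0
  then show ?case by (simp add: approx_set_0 invariant_Val)
next
  case (Suc i)
  let ?\<rho> = "(2 * N + 1) * i"
  have inv: "invariant ?\<rho> (approx_set i q)" if "q \<in> states T" for q using Suc that by simp
  have "(2 * N + 1) * i + (N + 1) \<le> (2 * N + 1) * k + (N + 1)"
    using Suc.prems(1) by (intro add_mono mult_le_mono) auto
  then have \<rho>: "?\<rho> + N + 1 \<le> top_rank" by (simp add: top_rank_def algebra_simps)
  have q': "q' \<in> states T" if "(q, q') \<in> weak_step \<tau> T a" for q' a
    using weak_step_states[OF T(1) that Suc.prems(2)] .
  have 1: "invariant ((2 * N + 1) * Suc i) (wpre a X)" if "invariant ?\<rho> X" for a X
    using invariant_wpre[OF that, of a] by (simp add: algebra_simps)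
  define P where "P a = (\<Union>q'\<in>weak_step \<tau> T a `` {q}. Val (vars G) - wpre a (approx_set i q')) \<union>
      wpre a (Val (vars G) - (\<Union>q'\<in>weak_step \<tau> T a `` {q}. approx_set i q'))" for a
  have "invariant ((2 * N + 1) * Suc i) (P a)" for a
    unfolding P_def using q'
    by (intro invariant_Un invariant_Union invariant_Diff invariant_Val 1 inv) auto
  then have "invariant ((2 * N + 1) * Suc i) (Val (vars G) - (\<Union>a\<in>acts G. P a))"
    by (intro invariant_Diff invariant_Val invariant_Union)
  moreover have "approx_set (Suc i) q = Val (vars G) - (\<Union>a\<in>acts G. P a)"
    by (subst approx_set_Suc[OF assms Suc.prems(2) inv \<rho>]) (auto simp: P_def)
  ultimately show ?case by simp
qed

lemma gstep_None: "gstep G None = (\<Union>a\<in>labels T. step_rel (gcs_lts G) a)"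
  using wf T(2) unfolding step_rel_gcs_lts by (fastforce simp: gstep_def wf_gcs_def)

lemma bisimilar_valuations_eq:
  assumes exact: star_exact and s: "s \<in> states T"
  shows "bisimilar_valuations G \<tau> T s = approx_set (Suc k) s -
    star N (gstep G None) (Val (vars G) - (\<Union>q\<in>states T. approx_set (Suc k) q))"
    and "invariant top_rank (bisimilar_valuations G \<tau> T s)"
proof -
  let ?U = "lts_sum (gcs_lts G) T" and ?Y = "Val (vars G) - (\<Union>q\<in>states T. approx_set (Suc k) q)"
  have inv: "invariant ((2 * N + 1) * Suc k) (approx_set (Suc k) q)" if "q \<in> states T" for q
    using invariant_approx_set[OF exact, of "Suc k" q] that by simp
  then have invY: "invariant ((2 * N + 1) * Suc k) ?Y"
    by (intro invariant_Diff invariant_Val invariant_Union)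
  have le: "(2 * N + 1) * Suc k \<le> top_rank" "(2 * N + 1) * Suc k + N \<le> top_rank" by (simp_all add: top_rank_def)
  have st: "((gstep G None)\<^sup>*)\<inverse> `` ?Y = star N (gstep G None) ?Y"
    using exact invariant_mono[OF invY le(1)] unfolding star_exact_def by blast
  have "(\<nu>, s) \<in> weak_bisim_between \<tau> (gcs_lts G) T \<longleftrightarrow>
      \<nu> \<in> approx_set (Suc k) s \<and> \<nu> \<notin> ((gstep G None)\<^sup>*)\<inverse> `` ?Y" if \<nu>: "\<nu> \<in> Val (vars G)" for \<nu>
  proof -
    have V: "\<nu>' \<in> Val (vars G)" if "(\<nu>, \<nu>') \<in> (gstep G None)\<^sup>*" for \<nu>'
      using that \<nu> by (induction rule: rtrancl_induct) (auto simp: gstep_def)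
    have q: "q \<in> states T" if "(Inl \<nu>', Inr q) \<in> wb_approx \<tau> ?U (Suc k)" for \<nu>' q
      using wb_approx_states[OF that] by (simp add: states_sum)
    have "(\<nu>, s) \<in> weak_bisim_between \<tau> (gcs_lts G) T \<longleftrightarrow> (Inl \<nu>, Inr s) \<in> wb_approx \<tau> ?U (Suc k) \<and>
      (\<forall>\<nu>'. (\<nu>, \<nu>') \<in> (gstep G None)\<^sup>* \<longrightarrow> (\<exists>q'. (Inl \<nu>', Inr q') \<in> wb_approx \<tau> ?U (Suc k)))"
      unfolding gstep_None
    proof (rule weak_bisim_between_iff)
      show "wf_lts (gcs_lts G)" "wf_lts T" using wf wf_lts_gcs_lts T(1) by auto
      show "labels (gcs_lts G) = labels T" "\<tau> \<in> labels T" using T(2) tau by (auto simp: labels_gcs_lts)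
      show "(Inr q, Inr q') \<in> wb_approx \<tau> ?U (Suc k)" if "(Inr q, Inr q') \<in> wb_approx \<tau> ?U k" for q q'
        by (rule wb_approx_Inr_stable[OF T(3) k that])
    qed
    moreover have "(\<exists>q'. (Inl \<nu>', Inr q') \<in> wb_approx \<tau> ?U (Suc k)) \<longleftrightarrow> \<nu>' \<notin> ?Y"
      if "(\<nu>, \<nu>') \<in> (gstep G None)\<^sup>*" for \<nu>'
      using V[OF that] q[of \<nu>'] unfolding approx_set_def by blast
    moreover have "(Inl \<nu>, Inr s) \<in> wb_approx \<tau> ?U (Suc k) \<longleftrightarrow> \<nu> \<in> approx_set (Suc k) s"
      using \<nu> by (simp add: approx_set_def)
    ultimately show ?thesis by blast
  qed
  moreover have "approx_set (Suc k) s \<subseteq> Val (vars G)" by (auto simp: approx_set_def)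
  ultimately show eq: "bisimilar_valuations G \<tau> T s = approx_set (Suc k) s - star N (gstep G None) ?Y"
    unfolding bisimilar_valuations_def st by blast
  show "invariant top_rank (bisimilar_valuations G \<tau> T s)"
    unfolding eq using invariant_mono[OF inv[OF s] le(1)] invariant_mono[OF invariant_star[OF invY, of N None] le(2)]
    by (rule invariant_Diff)
qed

lemma star_exactI:
  assumes "\<And>m. m \<in> {None, Some \<tau>} \<Longrightarrow> (gstep G m)\<^sup>* \<subseteq> (\<Union>i\<le>N. gstep G m ^^ i)"
  shows star_exact
  unfolding star_exact_def
proof (intro ballI allI impI equalityI star_subset_rtrancl)
  fix m X assume "m \<in> {None, Some \<tau>}"
  from assms[OF this] show "((gstep G m)\<^sup>*)\<inverse> `` X \<subseteq> star N (gstep G m) X" unfolding star_eq by blast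
qed

end

lemma ex_gstep_bound:
  assumes wf: "wf_gcs G"
  shows "\<exists>N. \<forall>m\<in>{None, Some \<tau>}. (gstep G m)\<^sup>* \<subseteq> (\<Union>i\<le>N. gstep G m ^^ i)"
proof -
  obtain N1 N2 where N: "(gstep G None)\<^sup>* \<subseteq> (\<Union>i\<le>N1. gstep G None ^^ i)"
    "(gstep G (Some \<tau>))\<^sup>* \<subseteq> (\<Union>i\<le>N2. gstep G (Some \<tau>) ^^ i)"
    using ex_gstep_rtrancl_bound[OF wf] by meson
  have "(\<Union>i\<le>N1. gstep G None ^^ i) \<subseteq> (\<Union>i\<le>max N1 N2. gstep G None ^^ i)"
    "(\<Union>i\<le>N2. gstep G (Some \<tau>) ^^ i) \<subseteq> (\<Union>i\<le>max N1 N2. gstep G (Some \<tau>) ^^ i)"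
    by (intro UN_mono; auto)+
  with N show ?thesis by (intro exI[of _ "max N1 N2"]) auto
qed

theorem gap_definable_bisimilar_valuations:
  assumes inst: "bisim_instance G \<tau> T s"
  shows "gap_definable (vars G) (consts_of G) (bisimilar_valuations G \<tau> T s)"
proof -
  have wf: "wf_gcs G" using inst by (simp add: bisim_instance_def)
  have fin: "finite (consts_of G)" "finite (constraints G)" using wf by (auto simp: wf_gcs_def)
  obtain N where N: "\<And>m. m \<in> {None, Some \<tau>} \<Longrightarrow> (gstep G m)\<^sup>* \<subseteq> (\<Union>i\<le>N. gstep G m ^^ i)"
    using ex_gstep_bound[OF wf] by meson
  define gaps where "gaps = (\<lambda>cl. case cl of Gap t u k \<Rightarrow> \<bar>k\<bar>) ` (\<Union>D\<in>constraints G. set D)"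
  have fg: "finite gaps" using fin by (simp add: gaps_def)
  define M where "M = nat (Max (insert 1 gaps))"
  define c where "c = nat (Max (insert 0 (abs ` consts_of G)))"
  have M1: "1 \<le> Max (insert 1 gaps)" using fg by simp
  have c0: "0 \<le> Max (insert 0 (abs ` consts_of G))" using fin by simp
  interpret bounded_bisim G "card (vars G)" M c \<tau> T "card (states T \<times> states T)" N
  proof
    show "\<bar>k\<bar> \<le> int M" if "D \<in> constraints G" "Gap t u k \<in> set D" for D t u k
    proof -
      have "\<bar>k\<bar> \<in> gaps" unfolding gaps_def using that by force
      then have "\<bar>k\<bar> \<le> Max (insert 1 gaps)" using fg by simp
      then show ?thesis using M1 by (simp add: M_def)
    qed
    show "\<bar>d\<bar> \<le> int c" if "d \<in> consts_of G" for d
    proof -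
      have "\<bar>d\<bar> \<le> Max (insert 0 (abs ` consts_of G))" using that fin by simp
      then show ?thesis using c0 by (simp add: c_def)
    qed
    show "1 \<le> M" using M1 by (simp add: M_def)
  qed (use inst in \<open>auto simp: bisim_instance_def\<close>)
  have "s \<in> states T" using inst by (simp add: bisim_instance_def)
  from bisimilar_valuations_eq(2)[OF star_exactI[OF N] this] show ?thesis
    by (rule gap_definable_invariant)
qed

section \<open>Computable functions\<close>

definition p1 :: "nat \<Rightarrow> nat" where "p1 n = fst (prod_decode n)"
definition p2 :: "nat \<Rightarrow> nat" where "p2 n = snd (prod_decode n)"

lemma p1_encode [simp]: "p1 (prod_encode (a, b)) = a"
  and p2_encode [simp]: "p2 (prod_encode (a, b)) = b"
  by (simp_all add: p1_def p2_def)

lemma encode_p1_p2 [simp]: "prod_encode (p1 n, p2 n) = n"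
  by (simp add: p1_def p2_def)

definition computable :: "(nat \<Rightarrow> nat) \<Rightarrow> bool" where
  "computable f \<longleftrightarrow> partial_recursive (\<lambda>n. Some (f n))"

definition decidable :: "(nat \<Rightarrow> bool) \<Rightarrow> bool" where
  "decidable P \<longleftrightarrow> computable (\<lambda>n. of_bool (P n))"

named_theorems comp_intros

lemma computable_compose: "computable f \<Longrightarrow> computable g \<Longrightarrow> computable (\<lambda>n. f (g n))"
  unfolding computable_def
  using partial_recursive.comp[of "\<lambda>n. Some (f n)" "\<lambda>n. Some (g n)"] by (simp add: map_comp_def)

lemma decidable_compose: "decidable P \<Longrightarrow> computable g \<Longrightarrow> decidable (\<lambda>n. P (g n))"
  unfolding decidable_def by (rule computable_compose)

lemma computable_Suc [comp_intros]: "computable f \<Longrightarrow> computable (\<lambda>n. Suc (f n))"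
  using computable_compose[of Suc f] partial_recursive.succ by (simp add: computable_def)

lemma computable_p1 [comp_intros]: "computable f \<Longrightarrow> computable (\<lambda>n. p1 (f n))"
  using computable_compose[of p1 f] partial_recursive.left by (simp add: computable_def p1_def)

lemma computable_p2 [comp_intros]: "computable f \<Longrightarrow> computable (\<lambda>n. p2 (f n))"
  using computable_compose[of p2 f] partial_recursive.right by (simp add: computable_def p2_def)

lemma computable_pair [comp_intros]:
  "computable f \<Longrightarrow> computable g \<Longrightarrow> computable (\<lambda>n. prod_encode (f n, g n))"
  unfolding computable_def using partial_recursive.pair[of "\<lambda>n. Some (f n)" "\<lambda>n. Some (g n)"] by simp

lemma computable_id [comp_intros]: "computable (\<lambda>n. n)"
  using computable_pair[of p1 p2] partial_recursive.left partial_recursive.right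
  by (simp add: computable_def p1_def p2_def)

lemma computable_const [comp_intros]: "computable (\<lambda>n. c)"
proof (induction c)
  case 0
  show ?case using partial_recursive.zero by (simp add: computable_def)
qed (rule computable_Suc)

lemma computable_rec_nat [comp_intros]:
  assumes "computable f" "computable (\<lambda>p. g (p1 p) (p1 (p2 p)) (p2 (p2 p)))" "computable t"
  shows "computable (\<lambda>n. rec_nat (f n) (\<lambda>i r. g n i r) (t n))"
proof -
  let ?f = "\<lambda>n. Some (f n)" and ?g = "\<lambda>p. Some (g (p1 p) (p1 (p2 p)) (p2 (p2 p)))"
  have "rec_nat (?f a) (\<lambda>i r. Option.bind r (\<lambda>v. ?g (prod_encode (a, prod_encode (i, v))))) m
      = Some (rec_nat (f a) (\<lambda>i r. g a i r) m)" for a m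
    by (induction m) simp_all
  then have "prim_rec ?f ?g = (\<lambda>n. Some (rec_nat (f (p1 n)) (\<lambda>i r. g (p1 n) i r) (p2 n)))"
    by (simp add: prim_rec_def fun_eq_iff p1_def p2_def split_beta)
  then have "computable (\<lambda>n. rec_nat (f (p1 n)) (\<lambda>i r. g (p1 n) i r) (p2 n))"
    using partial_recursive.prec[of ?f ?g] assms(1,2) by (simp add: computable_def)
  from computable_compose[OF this computable_pair[OF computable_id assms(3)]] show ?thesis
    by simp
qed

subsection \<open>Arithmetic\<close>

lemma computable_pred: "computable f \<Longrightarrow> computable (\<lambda>n. f n - 1)"
proof -
  assume "computable f"
  then have "computable (\<lambda>n. rec_nat 0 (\<lambda>i r. i) (f n))" by (intro comp_intros)
  moreover have "rec_nat 0 (\<lambda>i r. i) m = m - 1" for m :: nat by (cases m) auto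
  ultimately show ?thesis by simp
qed

lemma computable_add [comp_intros]:
  assumes "computable f" "computable g" shows "computable (\<lambda>n. f n + g n)"
proof -
  have "computable (\<lambda>n. rec_nat (f n) (\<lambda>i r. Suc r) (g n))" by (intro comp_intros assms)
  moreover have "rec_nat a (\<lambda>i r. Suc r) b = a + b" for a b by (induction b) auto
  ultimately show ?thesis by simp
qed

lemma computable_diff [comp_intros]:
  assumes "computable f" "computable g" shows "computable (\<lambda>n. f n - g n)"
proof -
  have "computable (\<lambda>n. rec_nat (f n) (\<lambda>i r. r - 1) (g n))"
    by (intro comp_intros computable_pred assms)
  moreover have "rec_nat a (\<lambda>i r. r - 1) b = a - b" for a b :: nat by (induction b) auto
  ultimately show ?thesis by simp
qed

lemma computable_mult [comp_intros]:
  assumes "computable f" "computable g" shows "computable (\<lambda>n. f n * g n)"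
proof -
  have "computable (\<lambda>n. rec_nat 0 (\<lambda>i r. r + f n) (g n))"
    by (intro comp_intros computable_compose[OF assms(1)] assms)
  moreover have "rec_nat 0 (\<lambda>i r. r + a) b = a * b" for a b :: nat by (induction b) auto
  ultimately show ?thesis by simp
qed

lemma computable_power [comp_intros]:
  assumes "computable f" "computable g" shows "computable (\<lambda>n. f n ^ g n)"
proof -
  have "computable (\<lambda>n. rec_nat 1 (\<lambda>i r. r * f n) (g n))"
    by (intro comp_intros computable_compose[OF assms(1)] assms)
  moreover have "rec_nat 1 (\<lambda>i r. r * a) b = a ^ b" for a b :: nat by (induction b) auto
  ultimately show ?thesis by simp
qed

lemma decidable_const [comp_intros]: "decidable (\<lambda>n. b)"
  unfolding decidable_def by (rule computable_const)

lemma decidable_not [comp_intros]: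
  assumes "decidable P" shows "decidable (\<lambda>n. \<not> P n)"
proof -
  have "computable (\<lambda>n. 1 - of_bool (P n))" using assms unfolding decidable_def by (intro comp_intros)
  moreover have "(1::nat) - of_bool b = of_bool (\<not> b)" for b by simp
  ultimately show ?thesis by (simp add: decidable_def)
qed

lemma decidable_conj [comp_intros]:
  assumes "decidable P" "decidable Q" shows "decidable (\<lambda>n. P n \<and> Q n)"
  using computable_mult[OF assms[unfolded decidable_def]] by (simp add: decidable_def of_bool_conj)

lemma decidable_disj [comp_intros]:
  assumes "decidable P" "decidable Q" shows "decidable (\<lambda>n. P n \<or> Q n)"
  using decidable_not[OF decidable_conj[OF decidable_not[OF assms(1)] decidable_not[OF assms(2)]]] by simp

lemma decidable_imp [comp_intros]:
  assumes "decidable P" "decidable Q" shows "decidable (\<lambda>n. P n \<longrightarrow> Q n)"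
  using decidable_disj[OF decidable_not[OF assms(1)] assms(2)] by (simp only: imp_conv_disj)

lemma decidable_iff [comp_intros]:
  assumes "decidable P" "decidable Q" shows "decidable (\<lambda>n. P n \<longleftrightarrow> Q n)"
  using decidable_conj[OF decidable_imp[OF assms] decidable_imp[OF assms(2,1)]]
  by (simp only: iff_conv_conj_imp)

lemma decidable_le [comp_intros]:
  assumes "computable f" "computable g" shows "decidable (\<lambda>n. f n \<le> g n)"
proof -
  have "computable (\<lambda>n. 1 - (f n - g n))" using assms by (intro comp_intros)
  moreover have "1 - (a - b) = of_bool (a \<le> b)" for a b :: nat by auto
  ultimately show ?thesis by (simp add: decidable_def)
qed

lemma decidable_less [comp_intros]:
  "computable f \<Longrightarrow> computable g \<Longrightarrow> decidable (\<lambda>n. f n < g n)"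
  using decidable_le[of "\<lambda>n. Suc (f n)" g] computable_Suc by (simp add: Suc_le_eq)

lemma decidable_eq [comp_intros]:
  assumes "computable f" "computable g" shows "decidable (\<lambda>n. f n = g n)"
  using decidable_conj[OF decidable_le[OF assms] decidable_le[OF assms(2,1)]]
  by (simp only: eq_iff[where 'a = nat])

lemma computable_if [comp_intros]:
  assumes "decidable P" "computable f" "computable g"
  shows "computable (\<lambda>n. if P n then f n else g n)"
proof -
  have "computable (\<lambda>n. of_bool (P n) * f n + of_bool (\<not> P n) * g n)"
    using assms(1) decidable_not[OF assms(1)] unfolding decidable_def
    by (intro comp_intros assms(2,3))
  moreover have "of_bool b * x + of_bool (\<not> b) * y = (if b then x else y)" for b and x y :: nat
    by simp
  ultimately show ?thesis by simp
qed

lemma decidable_all [comp_intros]: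
  assumes "computable t" "decidable (\<lambda>p. P (p1 p) (p2 p))"
  shows "decidable (\<lambda>n. \<forall>i<t n. P n i)"
proof -
  have "computable (\<lambda>p. of_bool (P (p1 p) (p1 (p2 p))))"
    using decidable_compose[OF assms(2) computable_pair[OF computable_p1 computable_p1[OF computable_p2]],
        OF computable_id computable_id]
    by (simp add: decidable_def)
  then have "computable (\<lambda>n. rec_nat 1 (\<lambda>i r. r * of_bool (P n i)) (t n))"
    by (intro comp_intros assms(1))
  moreover have "rec_nat 1 (\<lambda>i r. r * of_bool (Q i)) m = (of_bool (\<forall>i<m. Q i) :: nat)" for m Q
    by (induction m) (auto simp: less_Suc_eq)
  ultimately show ?thesis by (simp add: decidable_def)
qed

lemma decidable_ex [comp_intros]:
  assumes "computable t" "decidable (\<lambda>p. P (p1 p) (p2 p))"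
  shows "decidable (\<lambda>n. \<exists>i<t n. P n i)"
  using decidable_not[OF decidable_all[OF assms(1), of "\<lambda>n i. \<not> P n i"]] decidable_not[OF assms(2)]
  by simp

lemma computable_sum [comp_intros]:
  assumes "computable t" "computable (\<lambda>p. f (p1 p) (p2 p))"
  shows "computable (\<lambda>n. \<Sum>i<t n. f n i)"
proof -
  have "computable (\<lambda>p. f (p1 p) (p1 (p2 p)))"
    using computable_compose[OF assms(2) computable_pair[OF computable_p1 computable_p1[OF computable_p2]],
        OF computable_id computable_id]
    by simp
  then have "computable (\<lambda>n. rec_nat 0 (\<lambda>i r. r + f n i) (t n))"
    by (intro comp_intros assms(1))
  moreover have "rec_nat 0 (\<lambda>i r. r + f n i) m = (\<Sum>i<m. f n i)" for n m
    by (induction m) auto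
  ultimately show ?thesis by simp
qed

lemma computable_div [comp_intros]:
  assumes "computable f" "computable g" shows "computable (\<lambda>n. f n div g n)"
proof -
  have "computable (\<lambda>n. \<Sum>i<f n. if g n > 0 \<and> Suc i * g n \<le> f n then 1 else 0)"
    by (intro comp_intros computable_compose[OF assms(1)] computable_compose[OF assms(2)] assms)
  moreover have "(\<Sum>i<a. if b > 0 \<and> Suc i * b \<le> a then 1 else 0) = a div b" for a b :: nat
  proof (cases "b = 0")
    case False
    have "{i. i < a \<and> Suc i * b \<le> a} = {..<a div b}"
      using False by (auto simp: less_eq_div_iff_mult_less_eq Suc_le_eq[symmetric] simp del: mult_Suc)
         (metis False Suc_le_eq div_le_dividend gr0I le_trans less_eq_div_iff_mult_less_eq)
    then show ?thesis using False
      by (simp add: sum.If_cases Int_def del: mult_Suc)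
  qed simp
  ultimately show ?thesis by simp
qed

lemma computable_mod [comp_intros]:
  assumes "computable f" "computable g" shows "computable (\<lambda>n. f n mod g n)"
proof -
  have "computable (\<lambda>n. f n - f n div g n * g n)" by (intro comp_intros assms)
  then show ?thesis by (simp add: minus_div_mult_eq_mod)
qed

subsection \<open>Finite sets of naturals as bit vectors\<close>

definition mem :: "nat \<Rightarrow> nat \<Rightarrow> bool" where
  "mem i S \<longleftrightarrow> (S div 2 ^ i) mod 2 = 1"

definition tab :: "nat \<Rightarrow> (nat \<Rightarrow> bool) \<Rightarrow> nat" where
  "tab b P = (\<Sum>i<b. if P i then 2 ^ i else 0)"

lemma mem_iff: "mem i S \<longleftrightarrow> i \<in> set_decode S"
  by (simp add: mem_def set_decode_def odd_iff_mod_2_eq_one)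

lemma tab_eq: "tab b P = set_encode {i. i < b \<and> P i}"
  by (simp add: tab_def set_encode_def sum.If_cases Int_def)

lemma mem_tab [simp]: "mem i (tab b P) \<longleftrightarrow> i < b \<and> P i"
  by (simp add: mem_iff tab_eq)

lemma mem_set_encode [simp]: "finite A \<Longrightarrow> mem i (set_encode A) \<longleftrightarrow> i \<in> A"
  by (simp add: mem_iff)

lemma mem_less: "mem i S \<Longrightarrow> i < S"
proof -
  assume "mem i S"
  then have "2 ^ i \<le> S" by (auto simp: mem_def div_less intro: leI)
  then show ?thesis using less_exp[of i] by linarith
qed

lemma decidable_mem [comp_intros]: "computable f \<Longrightarrow> computable g \<Longrightarrow> decidable (\<lambda>n. mem (f n) (g n))"
  unfolding mem_def by (intro comp_intros)

lemma computable_tab [comp_intros]: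
  "computable t \<Longrightarrow> decidable (\<lambda>p. P (p1 p) (p2 p)) \<Longrightarrow> computable (\<lambda>n. tab (t n) (\<lambda>i. P n i))"
  unfolding tab_def by (intro comp_intros)

subsection \<open>Integer-valued functions\<close>

definition int_computable :: "(nat \<Rightarrow> int) \<Rightarrow> bool" where
  "int_computable z \<longleftrightarrow> (\<exists>f g. computable f \<and> computable g \<and> (\<forall>n. z n = int (f n) - int (g n)))"

lemma int_computableI:
  "computable f \<Longrightarrow> computable g \<Longrightarrow> (\<And>n. z n = int (f n) - int (g n)) \<Longrightarrow> int_computable z"
  unfolding int_computable_def by blast

lemma int_computable_int [comp_intros]: "computable f \<Longrightarrow> int_computable (\<lambda>n. int (f n))"
  by (rule int_computableI[of f "\<lambda>_. 0"]) (auto intro: comp_intros)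

lemma int_computable_decode [comp_intros]:
  assumes "computable f" shows "int_computable (\<lambda>n. int_decode (f n))"
proof (rule int_computableI)
  show "computable (\<lambda>n. if f n mod 2 = 0 then f n div 2 else 0)"
    and "computable (\<lambda>n. if f n mod 2 = 0 then 0 else Suc (f n div 2))"
    by (intro comp_intros assms)+
  show "int_decode (f n) = int (if f n mod 2 = 0 then f n div 2 else 0)
      - int (if f n mod 2 = 0 then 0 else Suc (f n div 2))" for n
    by (auto simp: int_decode_def sum_decode_def even_iff_mod_2_eq_zero)
qed

lemma int_computable_diff [comp_intros]:
  assumes "int_computable y" "int_computable z" shows "int_computable (\<lambda>n. y n - z n)"
proof -
  obtain f g f' g' where c: "computable f" "computable g" "computable f'" "computable g'"
    and eq: "\<And>n. y n = int (f n) - int (g n)" "\<And>n. z n = int (f' n) - int (g' n)"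
    using assms unfolding int_computable_def by blast
  show ?thesis
    by (rule int_computableI[of "\<lambda>n. f n + g' n" "\<lambda>n. g n + f' n"]) (auto intro!: comp_intros c simp: eq)
qed

lemma int_computable_minus [comp_intros]: "int_computable z \<Longrightarrow> int_computable (\<lambda>n. - z n)"
  using int_computable_diff[OF int_computable_int[OF computable_const[of 0]]] by simp

lemma int_computable_if [comp_intros]:
  assumes "decidable P" "int_computable y" "int_computable z"
  shows "int_computable (\<lambda>n. if P n then y n else z n)"
proof -
  obtain f g f' g' where c: "computable f" "computable g" "computable f'" "computable g'"
    and eq: "\<And>n. y n = int (f n) - int (g n)" "\<And>n. z n = int (f' n) - int (g' n)"
    using assms unfolding int_computable_def by blast
  show ?thesis
    by (rule int_computableI[of "\<lambda>n. if P n then f n else f' n" "\<lambda>n. if P n then g n else g' n"])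
       (auto intro!: comp_intros assms c simp: eq)
qed

lemma decidable_int_le [comp_intros]:
  assumes "int_computable y" "int_computable z" shows "decidable (\<lambda>n. y n \<le> z n)"
proof -
  obtain f g f' g' where c: "computable f" "computable g" "computable f'" "computable g'"
    and eq: "\<And>n. y n = int (f n) - int (g n)" "\<And>n. z n = int (f' n) - int (g' n)"
    using assms unfolding int_computable_def by blast
  have "decidable (\<lambda>n. f n + g' n \<le> f' n + g n)" by (intro comp_intros c)
  moreover have "f n + g' n \<le> f' n + g n \<longleftrightarrow> y n \<le> z n" for n unfolding eq by linarith
  ultimately show ?thesis by simp
qed

subsection \<open>Functions of several arguments\<close>

lemma computable2:
  assumes "computable (\<lambda>z. F (p1 z) (p2 z))" "computable a" "computable b"
  shows "computable (\<lambda>n. F (a n) (b n))"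
  using computable_compose[OF assms(1) computable_pair[OF assms(2,3)]] by simp

lemma computable3:
  assumes "computable (\<lambda>z. F (p1 z) (p1 (p2 z)) (p2 (p2 z)))" "computable a" "computable b" "computable c"
  shows "computable (\<lambda>n. F (a n) (b n) (c n))"
  using computable_compose[OF assms(1) computable_pair[OF assms(2) computable_pair[OF assms(3,4)]]] by simp

lemma computable4:
  assumes "computable (\<lambda>z. F (p1 z) (p1 (p2 z)) (p1 (p2 (p2 z))) (p2 (p2 (p2 z))))"
    "computable a" "computable b" "computable c" "computable d"
  shows "computable (\<lambda>n. F (a n) (b n) (c n) (d n))"
  using computable_compose[OF assms(1)
      computable_pair[OF assms(2) computable_pair[OF assms(3) computable_pair[OF assms(4,5)]]]] by simp

lemma computable5:
  assumes "computable (\<lambda>z. F (p1 z) (p1 (p2 z)) (p1 (p2 (p2 z))) (p1 (p2 (p2 (p2 z)))) (p2 (p2 (p2 (p2 z)))))"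
    "computable a" "computable b" "computable c" "computable d" "computable f"
  shows "computable (\<lambda>n. F (a n) (b n) (c n) (d n) (f n))"
  using computable_compose[OF assms(1) computable_pair[OF assms(2) computable_pair[OF assms(3)
      computable_pair[OF assms(4) computable_pair[OF assms(5,6)]]]]] by simp

lemma decidable2:
  assumes "decidable (\<lambda>z. F (p1 z) (p2 z))" "computable a" "computable b"
  shows "decidable (\<lambda>n. F (a n) (b n))"
  using decidable_compose[OF assms(1) computable_pair[OF assms(2,3)]] by simp

lemma decidable3:
  assumes "decidable (\<lambda>z. F (p1 z) (p1 (p2 z)) (p2 (p2 z)))" "computable a" "computable b" "computable c"
  shows "decidable (\<lambda>n. F (a n) (b n) (c n))"
  using decidable_compose[OF assms(1) computable_pair[OF assms(2) computable_pair[OF assms(3,4)]]] by simp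

lemma decidable4:
  assumes "decidable (\<lambda>z. F (p1 z) (p1 (p2 z)) (p1 (p2 (p2 z))) (p2 (p2 (p2 z))))"
    "computable a" "computable b" "computable c" "computable d"
  shows "decidable (\<lambda>n. F (a n) (b n) (c n) (d n))"
  using decidable_compose[OF assms(1)
      computable_pair[OF assms(2) computable_pair[OF assms(3) computable_pair[OF assms(4,5)]]]] by simp

lemma partial_recursive_search:
  assumes "decidable (\<lambda>p. P (p1 p) (p2 p))" "computable (\<lambda>p. F (p1 p) (p2 p))"
  shows "partial_recursive (\<lambda>a. if \<exists>n. P a n then Some (F a (LEAST n. P a n)) else None)"
proof -
  let ?c = "\<lambda>p. Some (of_bool (\<not> P (p1 p) (p2 p)) :: nat)"
  let ?m = "\<lambda>a. if \<exists>n. P a n then Some (LEAST n. P a n) else None"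
  have "?c (prod_encode (a, n)) = Some 0 \<longleftrightarrow> P a n" for a n by simp
  then have "minimize ?c = ?m" unfolding minimize_def by (auto simp: fun_eq_iff simp del: of_bool_not_iff)
  then have m: "partial_recursive ?m"
    using partial_recursive.mini[of ?c] decidable_not[OF assms(1)]
    by (simp add: decidable_def computable_def)
  have id: "partial_recursive Some"
    using computable_id by (simp add: computable_def)
  have "partial_recursive ((\<lambda>p. Some (F (p1 p) (p2 p))) \<circ>\<^sub>m
      (\<lambda>a. Option.bind (Some a) (\<lambda>u. Option.bind (?m a) (\<lambda>v. Some (prod_encode (u, v))))))"
    by (intro partial_recursive.comp partial_recursive.pair id m) (use assms(2) in \<open>simp add: computable_def\<close>)
  moreover have "((\<lambda>p. Some (F (p1 p) (p2 p))) \<circ>\<^sub>m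
      (\<lambda>a. Option.bind (Some a) (\<lambda>u. Option.bind (?m a) (\<lambda>v. Some (prod_encode (u, v))))))
    = (\<lambda>a. if \<exists>n. P a n then Some (F a (LEAST n. P a n)) else None)"
    by (auto simp: map_comp_def fun_eq_iff)
  ultimately show ?thesis by simp
qed

section \<open>The algorithm\<close>

definition lhd :: "nat \<Rightarrow> nat" where "lhd l = p1 (l - 1)"
definition ltl :: "nat \<Rightarrow> nat" where "ltl l = p2 (l - 1)"
definition ldrop :: "nat \<Rightarrow> nat \<Rightarrow> nat" where "ldrop l i = rec_nat l (\<lambda>_ r. ltl r) i"

text \<open>Below, \<open>e\<close> encodes an instance together with a candidate \<open>N\<close> for the number of steps after
  which backward reachability is stationary.\<close>

definition in_field :: "nat \<Rightarrow> nat \<Rightarrow> nat" where "in_field i e = lhd (ldrop (p1 e) i)"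

abbreviation "e_vars \<equiv> in_field 0"
abbreviation "e_consts \<equiv> in_field (Suc 0)"
abbreviation "e_acts \<equiv> in_field 2"
abbreviation "e_constraints \<equiv> in_field 3"
abbreviation "e_tau \<equiv> in_field 4"
abbreviation "e_states \<equiv> in_field 5"
abbreviation "e_steps \<equiv> in_field 6"
abbreviation "e_state \<equiv> in_field 7"
abbreviation "e_N \<equiv> p2"

definition e_gap :: "nat \<Rightarrow> nat" where "e_gap e = Suc (e_constraints e)"
definition e_rounds :: "nat \<Rightarrow> nat" where "e_rounds e = e_states e * e_states e"
definition e_top :: "nat \<Rightarrow> nat" where "e_top e = (2 * e_N e + 1) * (e_rounds e + 2)"
definition e_last :: "nat \<Rightarrow> nat" where "e_last e = e_top e + e_N e + 1"
definition e_level :: "nat \<Rightarrow> nat \<Rightarrow> nat" where "e_level e \<rho> = 4 ^ (e_vars e * \<rho>) * e_gap e"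
definition e_spread :: "nat \<Rightarrow> nat" where "e_spread e = e_vars e * (2 * 4 ^ e_vars e * e_level e (e_last e))"

text \<open>A set of rank \<open>\<rho>\<close> is tabulated correctly on the valuations of radius \<open>e_radius e \<rho>\<close>. Every step
  costs one rank and the radius \<open>e_spread e\<close>; the box that is left at rank \<open>e_last e\<close> still contains
  representatives of all equivalence classes.\<close>

definition e_radius :: "nat \<Rightarrow> nat \<Rightarrow> nat" where
  "e_radius e \<rho> = e_consts e + e_spread e + e_spread e * (e_last e - \<rho>)"

definition e_base :: "nat \<Rightarrow> nat" where "e_base e = 2 * e_radius e 0 + 1"
definition e_vmax :: "nat \<Rightarrow> nat" where "e_vmax e = e_base e ^ e_vars e"

text \<open>Valuations of radius \<open>e_radius e 0\<close> are numbers below \<open>e_vmax e\<close>, with one digit for each variable.\<close>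

definition vval :: "nat \<Rightarrow> nat \<Rightarrow> nat \<Rightarrow> int" where
  "vval e v x = int (v div e_base e ^ x mod e_base e) - int (e_radius e 0)"

definition in_box :: "nat \<Rightarrow> nat \<Rightarrow> nat \<Rightarrow> bool" where
  "in_box e \<rho> v \<longleftrightarrow> (\<forall>x<e_vars e. vval e v x \<le> int (e_radius e \<rho>) \<and> - int (e_radius e \<rho>) \<le> vval e v x)"

text \<open>The codes of \<open>V (Unprimed x)\<close>, \<open>V (Primed x)\<close> and \<open>C c\<close> are \<open>4 * x\<close>, \<open>4 * x + 2\<close> and
  \<open>2 * int_encode c + 1\<close>.\<close>

definition pair_tval :: "nat \<Rightarrow> nat \<Rightarrow> nat \<Rightarrow> nat \<Rightarrow> int" where
  "pair_tval e v w t = (if t mod 4 = 0 then vval e v (t div 4)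
     else if t mod 4 = 2 then vval e w (t div 4) else int_decode (t div 2))"

definition pair_sat :: "nat \<Rightarrow> nat \<Rightarrow> nat \<Rightarrow> nat \<Rightarrow> bool" where
  "pair_sat e v w cl \<longleftrightarrow> int_decode (p2 (p2 cl)) \<le> pair_tval e v w (p1 cl) - pair_tval e v w (p1 (p2 cl))"

definition list_sat :: "nat \<Rightarrow> nat \<Rightarrow> nat \<Rightarrow> nat \<Rightarrow> bool" where
  "list_sat e v w l \<longleftrightarrow> (\<forall>i<l. ldrop l i = 0 \<or> pair_sat e v w (lhd (ldrop l i)))"

text \<open>In mode \<open>m\<close>, \<open>0\<close> stands for steps with any action and \<open>Suc a\<close> for steps with action \<open>a\<close>.\<close>

definition e_step :: "nat \<Rightarrow> nat \<Rightarrow> nat \<Rightarrow> nat \<Rightarrow> bool" where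
  "e_step e m v w \<longleftrightarrow> (\<exists>d<e_constraints e. mem d (e_constraints e) \<and> (m = 0 \<or> m = Suc (p2 d)) \<and> list_sat e v w (p1 d))"

definition e_pre :: "nat \<Rightarrow> nat \<Rightarrow> nat \<Rightarrow> nat \<Rightarrow> nat" where
  "e_pre e m \<rho> X = tab (e_vmax e) (\<lambda>v. \<exists>w<e_vmax e. in_box e \<rho> w \<and> mem w X \<and> e_step e m v w)"

definition e_star :: "nat \<Rightarrow> nat \<Rightarrow> nat \<Rightarrow> nat \<Rightarrow> nat \<Rightarrow> nat" where
  "e_star e m \<rho> X i = rec_nat X (\<lambda>j Y. tab (e_vmax e) (\<lambda>v. mem v Y \<or> mem v (e_pre e m (\<rho> + j) Y))) i"

definition e_wpre :: "nat \<Rightarrow> nat \<Rightarrow> nat \<Rightarrow> nat \<Rightarrow> nat" where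
  "e_wpre e a \<rho> X = (if a = e_tau e then e_star e (Suc (e_tau e)) \<rho> X (e_N e)
     else e_star e (Suc (e_tau e)) (\<rho> + e_N e + 1)
       (e_pre e (Suc a) (\<rho> + e_N e) (e_star e (Suc (e_tau e)) \<rho> X (e_N e))) (e_N e))"

definition tau_closed :: "nat \<Rightarrow> nat \<Rightarrow> bool" where
  "tau_closed e Z \<longleftrightarrow> (\<forall>p<e_states e. \<forall>q<e_states e.
     mem (prod_encode (p, prod_encode (e_tau e, q))) (e_steps e) \<and> mem p Z \<longrightarrow> mem q Z)"

definition tau_reach :: "nat \<Rightarrow> nat \<Rightarrow> nat \<Rightarrow> bool" where
  "tau_reach e p q \<longleftrightarrow> (\<forall>Z<Suc (e_states e). tau_closed e Z \<and> mem p Z \<longrightarrow> mem q Z)"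

definition t_weak :: "nat \<Rightarrow> nat \<Rightarrow> nat \<Rightarrow> nat \<Rightarrow> bool" where
  "t_weak e a p q \<longleftrightarrow> (a = e_tau e \<and> tau_reach e p q) \<or>
     (a \<noteq> e_tau e \<and> (\<exists>p'<e_states e. \<exists>q'<e_states e. tau_reach e p p' \<and>
        mem (prod_encode (p', prod_encode (a, q'))) (e_steps e) \<and> tau_reach e q' q))"

definition row :: "nat \<Rightarrow> nat \<Rightarrow> nat \<Rightarrow> nat" where
  "row e F q = tab (e_vmax e) (\<lambda>v. mem (prod_encode (q, v)) F)"

definition unmatched_row :: "nat \<Rightarrow> nat \<Rightarrow> nat \<Rightarrow> nat \<Rightarrow> nat" where
  "unmatched_row e F a q = tab (e_vmax e) (\<lambda>v. \<not> (\<exists>q'<e_states e. mem q' (e_states e) \<and>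
     t_weak e a q q' \<and> mem (prod_encode (q', v)) F))"

definition uncovered :: "nat \<Rightarrow> nat \<Rightarrow> nat" where
  "uncovered e F = tab (e_vmax e) (\<lambda>v. \<not> (\<exists>q'<e_states e. mem q' (e_states e) \<and> mem (prod_encode (q', v)) F))"

definition refined :: "nat \<Rightarrow> nat \<Rightarrow> nat \<Rightarrow> nat \<Rightarrow> bool" where
  "refined e \<rho> F z \<longleftrightarrow> (\<forall>a<e_acts e. mem a (e_acts e) \<longrightarrow>
     (\<forall>q'<e_states e. mem q' (e_states e) \<and> t_weak e a (p1 z) q' \<longrightarrow> mem (p2 z) (e_wpre e a \<rho> (row e F q'))) \<and>
     \<not> mem (p2 z) (e_wpre e a \<rho> (unmatched_row e F a (p1 z))))"

definition e_pairs :: "nat \<Rightarrow> nat" where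
  "e_pairs e = Suc (prod_encode (e_states e, e_vmax e))"

definition e_approx :: "nat \<Rightarrow> nat \<Rightarrow> nat" where
  "e_approx e i = rec_nat (tab (e_pairs e) (\<lambda>_. True))
     (\<lambda>j F. tab (e_pairs e) (\<lambda>z. refined e ((2 * e_N e + 1) * j) F z)) i"

definition e_bisimilar :: "nat \<Rightarrow> nat" where
  "e_bisimilar e = (let F = e_approx e (Suc (e_rounds e)) in
     tab (e_vmax e) (\<lambda>v. mem (prod_encode (e_state e, v)) F \<and>
       \<not> mem v (e_star e 0 ((2 * e_N e + 1) * Suc (e_rounds e)) (uncovered e F) (e_N e))))"

definition e_trm :: "nat \<Rightarrow> nat \<Rightarrow> bool" where
  "e_trm e t \<longleftrightarrow> (t mod 2 = 0 \<and> mem (t div 2) (e_vars e)) \<or> (t mod 2 \<noteq> 0 \<and> mem (t div 2) (e_consts e))"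

definition e_clause :: "nat \<Rightarrow> nat \<Rightarrow> bool" where
  "e_clause e cl \<longleftrightarrow> e_trm e (p1 cl) \<and> e_trm e (p1 (p2 cl)) \<and>
     int_decode (p2 (p2 cl)) \<le> int (e_level e (e_top e)) \<and> - int (e_level e (e_top e)) \<le> int_decode (p2 (p2 cl))"

definition tval :: "nat \<Rightarrow> nat \<Rightarrow> nat \<Rightarrow> int" where
  "tval e v t = (if t mod 2 = 0 then vval e v (t div 2) else int_decode (t div 2))"

definition sat :: "nat \<Rightarrow> nat \<Rightarrow> nat \<Rightarrow> bool" where
  "sat e v cl \<longleftrightarrow> int_decode (p2 (p2 cl)) \<le> tval e v (p1 cl) - tval e v (p1 (p2 cl))"

definition e_clause_bound :: "nat \<Rightarrow> nat" where
  "e_clause_bound e = (let t = 2 * (e_vars e + e_consts e) + 1 in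
     Suc (prod_encode (t, prod_encode (t, 2 * e_level e (e_top e)))))"

definition e_eqv :: "nat \<Rightarrow> nat \<Rightarrow> nat \<Rightarrow> bool" where
  "e_eqv e u v \<longleftrightarrow> (\<forall>cl<e_clause_bound e. e_clause e cl \<longrightarrow> (sat e u cl \<longleftrightarrow> sat e v cl))"

definition e_class :: "nat \<Rightarrow> nat \<Rightarrow> nat" where
  "e_class e u = tab (e_vmax e) (\<lambda>v. e_eqv e v u)"

definition stationary :: "nat \<Rightarrow> nat \<Rightarrow> bool" where
  "stationary e m \<longleftrightarrow> (\<forall>u<e_vmax e. \<forall>v<e_vmax e. in_box e (e_last e) v \<longrightarrow>
     mem v (e_star e m (e_top e) (e_class e u) (Suc (e_N e))) \<longrightarrow>
     mem v (e_star e m (e_top e) (e_class e u) (e_N e)))"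

definition e_check :: "nat \<Rightarrow> bool" where
  "e_check e \<longleftrightarrow> stationary e 0 \<and> stationary e (Suc (e_tau e))"

definition e_literal :: "nat \<Rightarrow> nat \<Rightarrow> nat \<Rightarrow> nat" where
  "e_literal e v cl = (if e_clause e cl
     then (if sat e v cl then prod_encode (1, cl) else prod_encode (2, prod_encode (1, cl)))
     else prod_encode (0, 0))"

definition e_char :: "nat \<Rightarrow> nat \<Rightarrow> nat" where
  "e_char e v = rec_nat (prod_encode (0, 0)) (\<lambda>i r. prod_encode (3, prod_encode (e_literal e v i, r))) (e_clause_bound e)"

definition e_output :: "nat \<Rightarrow> nat" where
  "e_output e = rec_nat (prod_encode (2, prod_encode (0, 0)))
     (\<lambda>v r. prod_encode (4, prod_encode (if in_box e (e_last e) v \<and> mem v (e_bisimilar e)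
        then e_char e v else prod_encode (2, prod_encode (0, 0)), r))) (e_vmax e)"

subsection \<open>Computability\<close>

lemma computable_lhd [comp_intros]: "computable f \<Longrightarrow> computable (\<lambda>n. lhd (f n))"
  unfolding lhd_def by (intro comp_intros)

lemma computable_ltl [comp_intros]: "computable f \<Longrightarrow> computable (\<lambda>n. ltl (f n))"
  unfolding ltl_def by (intro comp_intros)

lemma computable_ldrop [comp_intros]: "computable f \<Longrightarrow> computable g \<Longrightarrow> computable (\<lambda>n. ldrop (f n) (g n))"
  unfolding ldrop_def by (intro comp_intros)

lemma computable_in_field [comp_intros]: "computable f \<Longrightarrow> computable (\<lambda>n. in_field i (f n))"
  unfolding in_field_def by (intro comp_intros)

lemma computable_parameters [comp_intros]:
  assumes "computable f"
  shows "computable (\<lambda>n. e_rounds (f n))" "computable (\<lambda>n. e_top (f n))" "computable (\<lambda>n. e_last (f n))"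
    "computable (\<lambda>n. e_spread (f n))" "computable (\<lambda>n. e_base (f n))" "computable (\<lambda>n. e_vmax (f n))"
    "computable (\<lambda>n. e_pairs (f n))" "computable (\<lambda>n. e_clause_bound (f n))"
  unfolding e_rounds_def e_top_def e_last_def e_spread_def e_base_def e_vmax_def e_radius_def e_level_def
    e_gap_def e_pairs_def e_clause_bound_def Let_def
  by (intro comp_intros assms)+

lemma computable_e_level [comp_intros]: "computable f \<Longrightarrow> computable g \<Longrightarrow> computable (\<lambda>n. e_level (f n) (g n))"
  unfolding e_level_def e_gap_def by (intro comp_intros)

lemma computable_e_radius [comp_intros]: "computable f \<Longrightarrow> computable g \<Longrightarrow> computable (\<lambda>n. e_radius (f n) (g n))"
  unfolding e_radius_def by (intro comp_intros)

lemma int_computable_vval [comp_intros]: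
  "computable e \<Longrightarrow> computable v \<Longrightarrow> computable x \<Longrightarrow> int_computable (\<lambda>n. vval (e n) (v n) (x n))"
  unfolding vval_def by (intro comp_intros)

lemma int_computable_tval [comp_intros]:
  "computable e \<Longrightarrow> computable v \<Longrightarrow> computable t \<Longrightarrow> int_computable (\<lambda>n. tval (e n) (v n) (t n))"
  unfolding tval_def by (intro comp_intros)

lemma int_computable_pair_tval [comp_intros]:
  "computable e \<Longrightarrow> computable v \<Longrightarrow> computable w \<Longrightarrow> computable t \<Longrightarrow>
    int_computable (\<lambda>n. pair_tval (e n) (v n) (w n) (t n))"
  unfolding pair_tval_def by (intro comp_intros)

lemma decidable_in_box [comp_intros]:
  "computable e \<Longrightarrow> computable \<rho> \<Longrightarrow> computable v \<Longrightarrow> decidable (\<lambda>n. in_box (e n) (\<rho> n) (v n))"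
  by (rule decidable3[where F = in_box]) (unfold in_box_def, intro comp_intros)

lemma decidable_pair_sat [comp_intros]:
  "computable e \<Longrightarrow> computable v \<Longrightarrow> computable w \<Longrightarrow> computable cl \<Longrightarrow>
    decidable (\<lambda>n. pair_sat (e n) (v n) (w n) (cl n))"
  unfolding pair_sat_def by (intro comp_intros)

lemma decidable_list_sat [comp_intros]:
  "computable e \<Longrightarrow> computable v \<Longrightarrow> computable w \<Longrightarrow> computable l \<Longrightarrow>
    decidable (\<lambda>n. list_sat (e n) (v n) (w n) (l n))"
  by (rule decidable4[where F = list_sat]) (unfold list_sat_def, intro comp_intros)

lemma decidable_e_step [comp_intros]:
  "computable e \<Longrightarrow> computable m \<Longrightarrow> computable v \<Longrightarrow> computable w \<Longrightarrow>
    decidable (\<lambda>n. e_step (e n) (m n) (v n) (w n))"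
  by (rule decidable4[where F = e_step]) (unfold e_step_def, intro comp_intros)

lemma computable_e_pre [comp_intros]:
  "computable e \<Longrightarrow> computable m \<Longrightarrow> computable \<rho> \<Longrightarrow> computable X \<Longrightarrow>
    computable (\<lambda>n. e_pre (e n) (m n) (\<rho> n) (X n))"
  by (rule computable4[where F = e_pre]) (unfold e_pre_def, intro comp_intros)

lemma computable_e_star [comp_intros]:
  "computable e \<Longrightarrow> computable m \<Longrightarrow> computable \<rho> \<Longrightarrow> computable X \<Longrightarrow> computable i \<Longrightarrow>
    computable (\<lambda>n. e_star (e n) (m n) (\<rho> n) (X n) (i n))"
  by (rule computable5[where F = e_star]) (unfold e_star_def, intro comp_intros)

lemma computable_e_wpre [comp_intros]:
  "computable e \<Longrightarrow> computable a \<Longrightarrow> computable \<rho> \<Longrightarrow> computable X \<Longrightarrow>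
    computable (\<lambda>n. e_wpre (e n) (a n) (\<rho> n) (X n))"
  unfolding e_wpre_def by (intro comp_intros)

lemma decidable_tau_closed [comp_intros]:
  "computable e \<Longrightarrow> computable Z \<Longrightarrow> decidable (\<lambda>n. tau_closed (e n) (Z n))"
  by (rule decidable2[where F = tau_closed]) (unfold tau_closed_def, intro comp_intros)

lemma decidable_tau_reach [comp_intros]:
  "computable e \<Longrightarrow> computable p \<Longrightarrow> computable q \<Longrightarrow> decidable (\<lambda>n. tau_reach (e n) (p n) (q n))"
  by (rule decidable3[where F = tau_reach]) (unfold tau_reach_def, intro comp_intros)

lemma decidable_t_weak [comp_intros]:
  "computable e \<Longrightarrow> computable a \<Longrightarrow> computable p \<Longrightarrow> computable q \<Longrightarrow>
    decidable (\<lambda>n. t_weak (e n) (a n) (p n) (q n))"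
  by (rule decidable4[where F = t_weak]) (unfold t_weak_def, intro comp_intros)

lemma computable_row [comp_intros]:
  "computable e \<Longrightarrow> computable F \<Longrightarrow> computable q \<Longrightarrow> computable (\<lambda>n. row (e n) (F n) (q n))"
  by (rule computable3[where F = row]) (unfold row_def, intro comp_intros)

lemma computable_unmatched_row [comp_intros]:
  "computable e \<Longrightarrow> computable F \<Longrightarrow> computable a \<Longrightarrow> computable q \<Longrightarrow>
    computable (\<lambda>n. unmatched_row (e n) (F n) (a n) (q n))"
  by (rule computable4[where F = unmatched_row]) (unfold unmatched_row_def, intro comp_intros)

lemma computable_uncovered [comp_intros]:
  "computable e \<Longrightarrow> computable F \<Longrightarrow> computable (\<lambda>n. uncovered (e n) (F n))"
  by (rule computable2[where F = uncovered]) (unfold uncovered_def, intro comp_intros)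

lemma decidable_refined [comp_intros]:
  "computable e \<Longrightarrow> computable \<rho> \<Longrightarrow> computable F \<Longrightarrow> computable z \<Longrightarrow>
    decidable (\<lambda>n. refined (e n) (\<rho> n) (F n) (z n))"
  by (rule decidable4[where F = refined]) (unfold refined_def, intro comp_intros)

lemma computable_e_approx [comp_intros]:
  "computable e \<Longrightarrow> computable i \<Longrightarrow> computable (\<lambda>n. e_approx (e n) (i n))"
  by (rule computable2[where F = e_approx]) (unfold e_approx_def, intro comp_intros)

lemma computable_e_bisimilar [comp_intros]: "computable f \<Longrightarrow> computable (\<lambda>n. e_bisimilar (f n))"
  by (rule computable_compose[where f = e_bisimilar]) (unfold e_bisimilar_def Let_def, intro comp_intros)

lemma decidable_e_clause [comp_intros]:
  "computable e \<Longrightarrow> computable cl \<Longrightarrow> decidable (\<lambda>n. e_clause (e n) (cl n))"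
  unfolding e_clause_def e_trm_def by (intro comp_intros)

lemma decidable_sat [comp_intros]:
  "computable e \<Longrightarrow> computable v \<Longrightarrow> computable cl \<Longrightarrow> decidable (\<lambda>n. sat (e n) (v n) (cl n))"
  unfolding sat_def by (intro comp_intros)

lemma decidable_e_eqv [comp_intros]:
  "computable e \<Longrightarrow> computable u \<Longrightarrow> computable v \<Longrightarrow> decidable (\<lambda>n. e_eqv (e n) (u n) (v n))"
  by (rule decidable3[where F = e_eqv]) (unfold e_eqv_def, intro comp_intros)

lemma computable_e_class [comp_intros]:
  "computable e \<Longrightarrow> computable u \<Longrightarrow> computable (\<lambda>n. e_class (e n) (u n))"
  by (rule computable2[where F = e_class]) (unfold e_class_def, intro comp_intros)

lemma decidable_stationary [comp_intros]:
  "computable e \<Longrightarrow> computable m \<Longrightarrow> decidable (\<lambda>n. stationary (e n) (m n))"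
  by (rule decidable2[where F = stationary]) (unfold stationary_def, intro comp_intros)

lemma decidable_e_check: "decidable e_check"
  unfolding e_check_def by (intro comp_intros)

lemma computable_e_literal [comp_intros]:
  "computable e \<Longrightarrow> computable v \<Longrightarrow> computable cl \<Longrightarrow> computable (\<lambda>n. e_literal (e n) (v n) (cl n))"
  unfolding e_literal_def by (intro comp_intros)

lemma computable_e_char [comp_intros]:
  "computable e \<Longrightarrow> computable v \<Longrightarrow> computable (\<lambda>n. e_char (e n) (v n))"
  by (rule computable2[where F = e_char]) (unfold e_char_def, intro comp_intros)

lemma computable_e_output: "computable e_output"
  unfolding e_output_def by (intro comp_intros)

subsection \<open>Encodings\<close>

lemma lhd_Suc [simp]: "lhd (Suc (prod_encode (x, l))) = x"
  by (simp add: lhd_def)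

lemma lhd_list_encode: "lhd (list_encode (x # xs)) = x"
  by simp

lemma ltl_list_encode: "ltl (list_encode xs) = list_encode (tl xs)"
proof (cases xs)
  case Nil
  have "prod_encode (0, 0) = 0" by (simp add: prod_encode_def)
  then have "p2 0 = 0" by (metis p2_encode)
  then show ?thesis using Nil by (simp add: ltl_def)
qed (simp add: ltl_def)

lemma ldrop_list_encode: "ldrop (list_encode xs) i = list_encode (drop i xs)"
  by (induction i) (simp_all add: ldrop_def ltl_list_encode drop_Suc tl_drop)

lemma length_le_list_encode: "length xs \<le> list_encode xs"
proof (induction xs)
  case (Cons x xs)
  then show ?case using le_prod_encode_2[of "list_encode xs" x] by simp
qed simp

lemma in_set_le_list_encode: "x \<in> set xs \<Longrightarrow> x \<le> list_encode xs"
proof (induction xs)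
  case (Cons y xs)
  then show ?case
    using le_prod_encode_1[of y "list_encode xs"] le_prod_encode_2[of "list_encode xs" y] by fastforce
qed simp

lemma all_ldrop_iff:
  "(\<forall>i<list_encode xs. ldrop (list_encode xs) i = 0 \<or> P (lhd (ldrop (list_encode xs) i))) \<longleftrightarrow> (\<forall>x\<in>set xs. P x)"
proof
  assume *: "\<forall>i<list_encode xs. ldrop (list_encode xs) i = 0 \<or> P (lhd (ldrop (list_encode xs) i))"
  show "\<forall>x\<in>set xs. P x"
  proof
    fix x assume "x \<in> set xs"
    then obtain i where i: "i < length xs" "x = xs ! i" by (metis in_set_conv_nth)
    then have "i < list_encode xs" using length_le_list_encode[of xs] by simp
    with * have "ldrop (list_encode xs) i = 0 \<or> P (lhd (ldrop (list_encode xs) i))" by blast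
    then show "P x" using i unfolding ldrop_list_encode Cons_nth_drop_Suc[OF i(1), symmetric] by simp
  qed
next
  assume *: "\<forall>x\<in>set xs. P x"
  show "\<forall>i<list_encode xs. ldrop (list_encode xs) i = 0 \<or> P (lhd (ldrop (list_encode xs) i))"
  proof (intro allI impI)
    fix i
    show "ldrop (list_encode xs) i = 0 \<or> P (lhd (ldrop (list_encode xs) i))"
    proof (cases "drop i xs")
      case (Cons y ys)
      then have "y \<in> set xs" by (metis in_set_dropD list.set_intros(1))
      then show ?thesis using * Cons by (simp add: ldrop_list_encode)
    qed (simp add: ldrop_list_encode)
  qed
qed

lemma abs_le_int_encode: "\<bar>d\<bar> \<le> int (int_encode d)"
  by (simp add: int_encode_def sum_encode_def)

lemma int_encode_le: "\<bar>d\<bar> \<le> int m \<Longrightarrow> int_encode d \<le> 2 * m"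
  by (auto simp: int_encode_def sum_encode_def)

lemma prod_encode_mono: "a \<le> a' \<Longrightarrow> b \<le> b' \<Longrightarrow> prod_encode (a, b) \<le> prod_encode (a', b')"
proof -
  have "triangle m \<le> triangle n" if "m \<le> n" for m n
    unfolding triangle_def using that by (intro div_le_mono mult_le_mono) auto
  then show "a \<le> a' \<Longrightarrow> b \<le> b' \<Longrightarrow> ?thesis" by (simp add: prod_encode_def add_mono)
qed

lemma set_encode_mono: "finite B \<Longrightarrow> A \<subseteq> B \<Longrightarrow> set_encode A \<le> set_encode B"
  unfolding set_encode_def by (rule sum_mono2) auto

lemma card_le_set_encode: "finite A \<Longrightarrow> card A \<le> set_encode A"
proof -
  assume "finite A"
  then have "A \<subseteq> {..<set_encode A}" using mem_less by auto
  then show ?thesis using card_mono[of "{..<set_encode A}" A] by simp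
qed

lemma ex_digits:
  fixes f :: "nat \<Rightarrow> nat"
  assumes "0 < b" "\<And>x. x < m \<Longrightarrow> f x < b"
  shows "\<exists>v<b ^ m. \<forall>x<m. v div b ^ x mod b = f x"
  using assms(2)
proof (induction m)
  case (Suc m)
  then obtain v where v: "v < b ^ m" "\<And>x. x < m \<Longrightarrow> v div b ^ x mod b = f x" by auto
  have "v + f m * b ^ m < b ^ Suc m"
  proof -
    have "f m + 1 \<le> b" using Suc.prems[of m] by simp
    then have "(f m + 1) * b ^ m \<le> b * b ^ m" by (rule mult_le_mono1)
    then show ?thesis using v(1) by simp
  qed
  moreover have "(v + f m * b ^ m) div b ^ x mod b = f x" if "x < Suc m" for x
  proof (cases "x = m")
    case True
    then show ?thesis using v(1) Suc.prems[of m] assms(1) by simp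
  next
    case False
    then have x: "x < m" using that by simp
    have "b ^ m = b ^ x * (b * b ^ (m - Suc x))"
      using x by (metis Suc_diff_Suc le_add_diff_inverse less_imp_le power_Suc power_add)
    then have eq: "v + f m * b ^ m = v + (b * (b ^ (m - Suc x) * f m)) * b ^ x" by (simp only: mult_ac)
    have "(v + f m * b ^ m) div b ^ x = v div b ^ x + b * (b ^ (m - Suc x) * f m)"
      unfolding eq using assms(1) by (subst div_mult_self1) auto
    then show ?thesis using v(2)[OF x] by simp
  qed
  ultimately show ?case by blast
qed simp

lemma encode_trm_simps: "encode_trm (V x) = 2 * x" "encode_trm (C d) = Suc (2 * int_encode d)"
  by (simp_all add: sum_encode_def)

lemma encode_pvar_simps: "encode_pvar (Unprimed x) = 2 * x" "encode_pvar (Primed x) = Suc (2 * x)"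
  by (simp_all add: sum_encode_def)

locale encoded_instance =
  fixes G :: "(nat, nat) gcs" and \<tau> :: nat and T :: "(nat, nat) lts" and s N :: nat
  assumes inst: "bisim_instance G \<tau> T s"
begin

definition code :: nat where
  "code = prod_encode (encode_instance G \<tau> T s, N)"

lemma inst':
  "wf_gcs G" "\<tau> \<in> acts G" "wf_lts T" "labels T = acts G" "finite (states T)" "s \<in> states T"
  using inst by (auto simp: bisim_instance_def)

lemma finite_inst: "finite (vars G)" "finite (consts_of G)" "finite (acts G)" "finite (constraints G)"
  using inst'(1) by (auto simp: wf_gcs_def)

lemma finite_steps: "finite (steps T)"
proof (rule finite_subset)
  show "steps T \<subseteq> states T \<times> acts G \<times> states T" using inst'(3,4) by (simp add: wf_lts_def)
qed (use inst'(5) finite_inst in simp)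

lemma field_code:
  "e_vars code = set_encode (vars G)"
  "e_consts code = set_encode (int_encode ` consts_of G)"
  "e_acts code = set_encode (acts G)"
  "e_constraints code = set_encode ((\<lambda>D. prod_encode (encode_constraint D, lab G D)) ` constraints G)"
  "e_tau code = \<tau>"
  "e_states code = set_encode (states T)"
  "e_steps code = set_encode ((\<lambda>(p, a, q). prod_encode (p, prod_encode (a, q))) ` steps T)"
  "e_state code = s"
  "e_N code = N"
  by (simp_all add: code_def encode_instance_def in_field_def ldrop_list_encode lhd_list_encode del: list_encode.simps)

lemma mem_field [simp]:
  "mem x (e_vars code) \<longleftrightarrow> x \<in> vars G"
  "mem x (e_consts code) \<longleftrightarrow> x \<in> int_encode ` consts_of G"
  "mem a (e_acts code) \<longleftrightarrow> a \<in> acts G"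
  "mem d (e_constraints code) \<longleftrightarrow> d \<in> (\<lambda>D. prod_encode (encode_constraint D, lab G D)) ` constraints G"
  "mem q (e_states code) \<longleftrightarrow> q \<in> states T"
  "mem (prod_encode (p, prod_encode (a, q))) (e_steps code) \<longleftrightarrow> (p, a, q) \<in> steps T"
  unfolding field_code using finite_inst finite_steps inst'(5)
  by (auto simp: image_iff prod_encode_eq intro!: bexI[of _ "(p, a, q)"])

lemma field_less:
  "x \<in> vars G \<Longrightarrow> x < e_vars code" "a \<in> acts G \<Longrightarrow> a < e_acts code" "q \<in> states T \<Longrightarrow> q < e_states code"
  using mem_less mem_field by blast+

lemma gap_less:
  assumes "D \<in> constraints G" "Gap t u k \<in> set D" shows "\<bar>k\<bar> \<le> int (e_gap code)"
proof -
  let ?cl = "encode_clause (map_gap_clause encode_pvar (Gap t u k))"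
  have "int_encode k \<le> ?cl"
    unfolding gap_clause.map encode_clause.simps
    by (rule order.trans[OF le_prod_encode_2 le_prod_encode_2])
  also have "?cl \<le> encode_constraint D"
    unfolding encode_constraint_def by (rule in_set_le_list_encode) (use assms(2) in force)
  also have "\<dots> \<le> prod_encode (encode_constraint D, lab G D)" by (rule le_prod_encode_1)
  also have "\<dots> < e_constraints code" by (rule mem_less) (use assms(1) in auto)
  finally show ?thesis using abs_le_int_encode[of k] by (simp add: e_gap_def)
qed

lemma const_less: assumes "d \<in> consts_of G" shows "\<bar>d\<bar> \<le> int (e_consts code)"
proof -
  have "int_encode d < e_consts code" by (rule mem_less) (use assms in auto)
  then show ?thesis using abs_le_int_encode[of d] by simp
qed

end

sublocale encoded_instance \<subseteq> bounded_bisim G "e_vars code" "e_gap code" "e_consts code" \<tau> T "e_rounds code" N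
proof
  show "card (vars G) \<le> e_vars code" using card_le_set_encode[OF finite_inst(1)] by (simp add: field_code)
  show "1 \<le> e_gap code" by (simp add: e_gap_def)
  show "card (states T \<times> states T) \<le> e_rounds code"
    unfolding e_rounds_def field_code card_cartesian_product
    by (intro mult_le_mono card_le_set_encode inst')
qed (use inst' gap_less const_less in auto)

context encoded_instance
begin

lemma top_eq: "e_top code = top_rank"
  by (simp add: e_top_def top_rank_def field_code)

lemma last_eq: "e_last code = top_rank + N + 1"
  by (simp add: e_last_def top_eq field_code)

lemma level_eq: "int (e_level code \<rho>) = level \<rho>"
  by (simp add: e_level_def level_def)

lemma spread_le: "\<rho> \<le> e_last code \<Longrightarrow> spread \<rho> \<le> int (e_spread code)"
proof -
  have "int (e_spread code) = spread (e_last code)"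
    by (simp add: e_spread_def spread_def flip: level_eq)
  then show "\<rho> \<le> e_last code \<Longrightarrow> ?thesis" using spread_mono by simp
qed

lemma radius_antimono: "\<rho> \<le> \<rho>' \<Longrightarrow> e_radius code \<rho>' \<le> e_radius code \<rho>"
  unfolding e_radius_def by (intro add_mono mult_le_mono diff_le_mono2) auto

lemma radius_Suc: "Suc \<rho> \<le> e_last code \<Longrightarrow> e_radius code \<rho> = e_radius code (Suc \<rho>) + e_spread code"
proof -
  assume "Suc \<rho> \<le> e_last code"
  then have "e_last code - \<rho> = Suc (e_last code - Suc \<rho>)" by simp
  then show ?thesis by (simp add: e_radius_def)
qed

definition val :: "nat \<Rightarrow> nat \<Rightarrow> int" where
  "val v = restrict (vval code v) (vars G)"

lemma val_Val [simp]: "val v \<in> Val (vars G)"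
  by (simp add: val_def Val_def)

lemma in_boxD: "in_box code \<rho> v \<Longrightarrow> x \<in> vars G \<Longrightarrow> \<bar>val v x\<bar> \<le> int (e_radius code \<rho>)"
  using field_less(1)[of x] by (auto simp: in_box_def val_def)

lemma in_box_mono: "in_box code \<rho>' v \<Longrightarrow> \<rho> \<le> \<rho>' \<Longrightarrow> in_box code \<rho> v"
  using radius_antimono[of \<rho> \<rho>'] unfolding in_box_def by force

lemma ex_code:
  assumes \<nu>: "\<nu> \<in> Val (vars G)" and bnd: "\<And>x. x \<in> vars G \<Longrightarrow> \<bar>\<nu> x\<bar> \<le> int (e_radius code \<rho>)"
  shows "\<exists>v<e_vmax code. val v = \<nu> \<and> in_box code \<rho> v"
proof -
  let ?r = "e_radius code 0"
  have bnd0: "\<bar>\<nu> x\<bar> \<le> int ?r" if "x \<in> vars G" for x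
    using bnd[OF that] radius_antimono[of 0 \<rho>] by simp
  define f where "f x = (if x \<in> vars G then nat (\<nu> x + int ?r) else ?r)" for x
  have "f x < e_base code" for x using bnd0[of x] by (auto simp: f_def e_base_def)
  moreover have "0 < e_base code" by (simp add: e_base_def)
  ultimately obtain v where v: "v < e_vmax code"
    "\<And>x. x < e_vars code \<Longrightarrow> v div e_base code ^ x mod e_base code = f x"
    using ex_digits[of "e_base code" "e_vars code" f] unfolding e_vmax_def by blast
  have vv: "vval code v x = (if x \<in> vars G then \<nu> x else 0)" if "x < e_vars code" for x
    using v(2)[OF that] bnd0[of x] by (auto simp: vval_def f_def)
  have "val v = \<nu>"
  proof
    fix x show "val v x = \<nu> x"
      using \<nu> vv[of x] field_less(1)[of x] by (cases "x \<in> vars G") (auto simp: val_def Val_def PiE_def extensional_def)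
  qed
  moreover have "in_box code \<rho> v" unfolding in_box_def using vv bnd by (fastforce simp: abs_le_iff)
  ultimately show ?thesis using v(1) by blast
qed

lemma ex_representative_code:
  assumes "\<nu> \<in> Val (vars G)" "\<rho> \<le> e_last code"
  shows "\<exists>v<e_vmax code. in_box code (e_last code) v \<and> val_eqv G (level \<rho>) \<nu> (val v)"
proof -
  obtain \<mu> where \<mu>: "\<mu> \<in> Val (vars G)" "val_eqv G (level \<rho>) \<nu> \<mu>"
    "\<forall>x\<in>vars G. \<bar>\<mu> x\<bar> \<le> int (e_consts code) + spread \<rho>"
    using ex_bounded_representative[OF assms(1)] by blast
  have "\<bar>\<mu> x\<bar> \<le> int (e_radius code (e_last code))" if "x \<in> vars G" for x
    using \<mu>(3) that spread_le[OF assms(2)] by (fastforce simp: e_radius_def)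
  from ex_code[OF \<mu>(1) this] \<mu>(2) show ?thesis by auto
qed

subsection \<open>Correctness of the tables\<close>

lemma pair_tval_encode:
  assumes "t \<in> trms_over (Unprimed ` vars G \<union> Primed ` vars G) (consts_of G)"
  shows "pair_tval code v w (encode_trm (map_trm encode_pvar t)) = trm_val (joint (val v) (val w)) t"
proof (cases t)
  case (V y)
  show ?thesis
  proof (cases y)
    case (Unprimed x)
    then have "x \<in> vars G" using assms V by (auto simp: trms_over_def)
    then show ?thesis
      using V Unprimed by (simp add: pair_tval_def encode_trm_simps encode_pvar_simps joint_def val_def del: encode_trm.simps encode_pvar.simps)
  next
    case (Primed x)
    then have "x \<in> vars G" using assms V by (auto simp: trms_over_def)
    moreover have "2 * Suc (2 * x) mod 4 = 2" "2 * Suc (2 * x) div 4 = x" by presburger+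
    ultimately show ?thesis
      using V Primed by (simp add: pair_tval_def encode_trm_simps encode_pvar_simps joint_def val_def del: encode_trm.simps encode_pvar.simps mult_Suc_right)
  qed
next
  case (C d)
  have "Suc (2 * m) mod 4 \<noteq> 0" "Suc (2 * m) mod 4 \<noteq> 2" for m :: nat by presburger+
  then show ?thesis using C by (simp add: pair_tval_def encode_trm_simps del: encode_trm.simps neq0_conv)
qed

lemma list_sat_encode:
  assumes "D \<in> constraints G"
  shows "list_sat code v w (encode_constraint D) \<longleftrightarrow> (\<forall>cl\<in>set D. clause_sat (joint (val v) (val w)) cl)"
proof -
  have "pair_sat code v w (encode_clause (map_gap_clause encode_pvar cl)) \<longleftrightarrow> clause_sat (joint (val v) (val w)) cl"
    if cl: "cl \<in> set D" for cl
  proof -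
    obtain t u k where Gap: "cl = Gap t u k" by (cases cl)
    have "clause_over (Unprimed ` vars G \<union> Primed ` vars G) (consts_of G) cl"
      using inst'(1) assms cl by (auto simp: wf_gcs_def)
    then show ?thesis
      unfolding Gap by (simp add: pair_sat_def pair_tval_encode del: encode_trm.simps)
  qed
  then show ?thesis unfolding list_sat_def encode_constraint_def all_ldrop_iff by simp
qed

definition mode :: "nat option \<Rightarrow> nat" where
  "mode m = (case m of None \<Rightarrow> 0 | Some a \<Rightarrow> Suc a)"

lemma mode_simps [simp]: "mode None = 0" "mode (Some a) = Suc a"
  by (simp_all add: mode_def)

lemma e_step_iff: "e_step code (mode m) v w \<longleftrightarrow> (val v, val w) \<in> gstep G m"
proof -
  have "e_step code (mode m) v w \<longleftrightarrow> (\<exists>D\<in>constraints G. (mode m = 0 \<or> mode m = Suc (lab G D)) \<and>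
      list_sat code v w (encode_constraint D))"
  proof
    assume "e_step code (mode m) v w"
    then show "\<exists>D\<in>constraints G. (mode m = 0 \<or> mode m = Suc (lab G D)) \<and> list_sat code v w (encode_constraint D)"
      unfolding e_step_def mem_field by auto
  next
    assume "\<exists>D\<in>constraints G. (mode m = 0 \<or> mode m = Suc (lab G D)) \<and> list_sat code v w (encode_constraint D)"
    then obtain D where D: "D \<in> constraints G" "mode m = 0 \<or> mode m = Suc (lab G D)"
      "list_sat code v w (encode_constraint D)" by blast
    let ?d = "prod_encode (encode_constraint D, lab G D)"
    have "mem ?d (e_constraints code)" using D(1) by auto
    then show "e_step code (mode m) v w"
      unfolding e_step_def using D mem_less by (intro exI[of _ ?d]) simp
  qed
  also have "\<dots> \<longleftrightarrow> (val v, val w) \<in> gstep G m"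
    using list_sat_encode by (auto simp: gstep_def split: option.splits) (auto simp: mode_def split: option.splits)
  finally show ?thesis .
qed

definition represents :: "nat \<Rightarrow> nat \<Rightarrow> (nat \<Rightarrow> int) set \<Rightarrow> bool" where
  "represents \<rho> X S \<longleftrightarrow> (\<forall>v<e_vmax code. in_box code \<rho> v \<longrightarrow> (mem v X \<longleftrightarrow> val v \<in> S))"

lemma representsD: "represents \<rho> X S \<Longrightarrow> v < e_vmax code \<Longrightarrow> in_box code \<rho> v \<Longrightarrow> mem v X \<longleftrightarrow> val v \<in> S"
  by (simp add: represents_def)

lemma represents_mono: "represents \<rho> X S \<Longrightarrow> \<rho> \<le> \<rho>' \<Longrightarrow> represents \<rho>' X S"
  unfolding represents_def using in_box_mono by blast

lemma represents_pre:
  assumes X: "represents \<rho> X S" and S: "invariant \<rho> S" and \<rho>: "Suc \<rho> \<le> e_last code"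
  shows "represents (Suc \<rho>) (e_pre code (mode m) \<rho> X) ((gstep G m)\<inverse> `` S)"
  unfolding represents_def
proof (intro allI impI iffI)
  fix v assume v: "v < e_vmax code" "in_box code (Suc \<rho>) v"
  {
    assume "mem v (e_pre code (mode m) \<rho> X)"
    then obtain w where "w < e_vmax code" "in_box code \<rho> w" "mem w X" "e_step code (mode m) v w"
      by (auto simp: e_pre_def)
    then show "val v \<in> (gstep G m)\<inverse> `` S" using representsD[OF X] e_step_iff by blast
  next
    assume "val v \<in> (gstep G m)\<inverse> `` S"
    then obtain \<nu>' where \<nu>': "(val v, \<nu>') \<in> gstep G m" "\<nu>' \<in> S" by blast
    have "val_eqv G (level (Suc \<rho>)) (val v) (val v)" by (simp add: val_eqv_def gap_eqv_refl)
    moreover have "int (e_consts code) \<le> int (e_radius code (Suc \<rho>))" by (simp add: e_radius_def)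
    ultimately obtain \<mu>' where \<mu>': "(val v, \<mu>') \<in> gstep G m" "val_eqv G (level \<rho>) \<nu>' \<mu>'"
      "\<forall>x\<in>vars G. \<bar>\<mu>' x\<bar> \<le> int (e_radius code (Suc \<rho>)) + spread \<rho>"
      using step_match[OF \<nu>'(1) _ val_Val in_boxD[OF v(2)]] by blast
    have V: "\<nu>' \<in> Val (vars G)" "\<mu>' \<in> Val (vars G)" using \<nu>'(1) \<mu>'(1) by (auto simp: gstep_def)
    have "\<bar>\<mu>' x\<bar> \<le> int (e_radius code \<rho>)" if "x \<in> vars G" for x
      using \<mu>'(3) that spread_le[of \<rho>] \<rho> radius_Suc[OF \<rho>] by fastforce
    from ex_code[OF V(2) this] obtain w where w: "w < e_vmax code" "val w = \<mu>'" "in_box code \<rho> w" by blast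
    have "mem w X" using representsD[OF X w(1,3)] w(2) invariantD[OF S V \<mu>'(2) \<nu>'(2)] by simp
    then show "mem v (e_pre code (mode m) \<rho> X)" using v(1) w \<mu>'(1) e_step_iff by (auto simp: e_pre_def)
  }
qed

lemma e_star_0 [simp]: "e_star code m \<rho> X 0 = X"
  and e_star_Suc [simp]: "e_star code m \<rho> X (Suc i) = tab (e_vmax code)
    (\<lambda>v. mem v (e_star code m \<rho> X i) \<or> mem v (e_pre code m (\<rho> + i) (e_star code m \<rho> X i)))"
  by (simp_all add: e_star_def)

lemma represents_star:
  assumes X: "represents \<rho> X S" and S: "invariant \<rho> S"
  shows "\<rho> + i \<le> e_last code \<Longrightarrow> represents (\<rho> + i) (e_star code (mode m) \<rho> X i) (star i (gstep G m) S)"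
proof (induction i)
  case (Suc i)
  then have IH: "represents (\<rho> + i) (e_star code (mode m) \<rho> X i) (star i (gstep G m) S)" by simp
  have pre: "represents (\<rho> + Suc i) (e_pre code (mode m) (\<rho> + i) (e_star code (mode m) \<rho> X i))
      ((gstep G m)\<inverse> `` star i (gstep G m) S)"
    using represents_pre[OF IH invariant_star[OF S]] Suc.prems by simp
  show ?case
    using representsD[OF represents_mono[OF IH, of "\<rho> + Suc i"]] representsD[OF pre]
    unfolding represents_def e_star_Suc star_Suc mem_tab Un_iff by simp
qed (simp add: X)

lemma represents_wpre:
  assumes X: "represents \<rho> X S" and S: "invariant \<rho> S" and \<rho>: "\<rho> + (2 * N + 1) \<le> e_last code"
  shows "represents (\<rho> + (2 * N + 1)) (e_wpre code a \<rho> X) (wpre a S)"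
proof -
  let ?Y = "e_star code (mode (Some \<tau>)) \<rho> X N"
  have Y: "represents (\<rho> + N) ?Y (star N (gstep G (Some \<tau>)) S)"
    by (rule represents_star[OF X S]) (use \<rho> in simp)
  show ?thesis
  proof (cases "a = \<tau>")
    case True
    then show ?thesis using represents_mono[OF Y, of "\<rho> + (2 * N + 1)"] by (simp add: e_wpre_def wpre_def field_code)
  next
    case False
    have invY: "invariant (\<rho> + N) (star N (gstep G (Some \<tau>)) S)" by (rule invariant_star[OF S])
    have P: "represents (Suc (\<rho> + N)) (e_pre code (mode (Some a)) (\<rho> + N) ?Y) ((gstep G (Some a))\<inverse> `` star N (gstep G (Some \<tau>)) S)"
      by (rule represents_pre[OF Y invY]) (use \<rho> in simp)
    have "represents (Suc (\<rho> + N) + N) (e_star code (mode (Some \<tau>)) (Suc (\<rho> + N)) (e_pre code (mode (Some a)) (\<rho> + N) ?Y) N)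
        (star N (gstep G (Some \<tau>)) ((gstep G (Some a))\<inverse> `` star N (gstep G (Some \<tau>)) S))"
      by (rule represents_star[OF P invariant_pre[OF invY]]) (use \<rho> in simp)
    then show ?thesis using False by (simp add: e_wpre_def wpre_def field_code mult_2 add_ac)
  qed
qed

lemma tau_reach_iff:
  assumes p: "p \<in> states T"
  shows "tau_reach code p q \<longleftrightarrow> (p, q) \<in> (step_rel T \<tau>)\<^sup>*"
proof
  assume r: "tau_reach code p q"
  let ?A = "{q. (p, q) \<in> (step_rel T \<tau>)\<^sup>*}"
  have A: "?A \<subseteq> states T" using step_rel_rtrancl_states[OF _ inst'(3) p] by auto
  then have fin: "finite ?A" using inst'(5) by (rule finite_subset)
  have "set_encode ?A < Suc (e_states code)" unfolding field_code using set_encode_mono[OF inst'(5) A] by simp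
  moreover have "tau_closed code (set_encode ?A)"
    using fin by (auto simp: tau_closed_def field_code(5) step_rel_def intro: rtrancl_into_rtrancl)
  moreover have "mem p (set_encode ?A)" using fin by simp
  ultimately have "mem q (set_encode ?A)" using r unfolding tau_reach_def by blast
  then show "(p, q) \<in> (step_rel T \<tau>)\<^sup>*" using fin by simp
next
  assume pq: "(p, q) \<in> (step_rel T \<tau>)\<^sup>*"
  show "tau_reach code p q"
    unfolding tau_reach_def
  proof (intro allI impI, elim conjE)
    fix Z assume cl: "tau_closed code Z" and "mem p Z"
    with pq show "mem q Z"
    proof (induction rule: rtrancl_induct)
      case (step y z)
      then have "(y, \<tau>, z) \<in> steps T" by (simp add: step_rel_def)
      moreover from step_rel_states[OF inst'(3) step(2)] field_less(3) have "y < e_states code" "z < e_states code" by auto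
      moreover have "mem y Z" using step.IH step.prems by blast
      ultimately show ?case using cl unfolding tau_closed_def field_code(5) mem_field by blast
    qed
  qed
qed

lemma t_weak_iff:
  assumes p: "p \<in> states T"
  shows "t_weak code a p q \<longleftrightarrow> (p, q) \<in> weak_step \<tau> T a"
proof (cases "a = \<tau>")
  case True
  then show ?thesis by (simp add: t_weak_def weak_step_def field_code(5) tau_reach_iff[OF p])
next
  case False
  have st: "p' \<in> states T \<and> q' \<in> states T" if "(p', a, q') \<in> steps T" for p' q'
    using that inst'(3) by (auto simp: wf_lts_def)
  have "t_weak code a p q \<longleftrightarrow> (\<exists>p' q'. (p', a, q') \<in> steps T \<and> tau_reach code p p' \<and> tau_reach code q' q)"
    unfolding t_weak_def field_code(5) mem_field using False st field_less(3) by blast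
  also have "\<dots> \<longleftrightarrow> (\<exists>p' q'. (p', a, q') \<in> steps T \<and> (p, p') \<in> (step_rel T \<tau>)\<^sup>* \<and> (q', q) \<in> (step_rel T \<tau>)\<^sup>*)"
    using tau_reach_iff st p by blast
  also have "\<dots> \<longleftrightarrow> (p, q) \<in> weak_step \<tau> T a" using False by (auto simp: weak_step_def step_rel_def)
  finally show ?thesis .
qed

lemma e_approx_0: "e_approx code 0 = tab (e_pairs code) (\<lambda>_. True)"
  and e_approx_Suc: "e_approx code (Suc i) = tab (e_pairs code) (refined code ((2 * N + 1) * i) (e_approx code i))"
  by (simp_all add: e_approx_def field_code(9))

lemma less_e_pairs: "q \<in> states T \<Longrightarrow> v < e_vmax code \<Longrightarrow> prod_encode (q, v) < e_pairs code"
  unfolding e_pairs_def using field_less(3) by (simp add: less_Suc_eq_le prod_encode_mono less_imp_le)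

lemma mem_row: "v < e_vmax code \<Longrightarrow> mem v (row code F q) \<longleftrightarrow> mem (prod_encode (q, v)) F"
  by (simp add: row_def)

lemma weak_step_T_states: "q \<in> states T \<Longrightarrow> (q, q') \<in> weak_step \<tau> T a \<Longrightarrow> q' \<in> states T"
  using weak_step_states[OF inst'(3)] .

lemma represents_approx:
  assumes exact: star_exact
  shows "i \<le> e_rounds code + 1 \<Longrightarrow> q \<in> states T \<Longrightarrow>
    represents ((2 * N + 1) * i) (row code (e_approx code i) q) (approx_set i q)"
proof (induction i arbitrary: q)
  case 0
  then show ?case by (simp add: represents_def mem_row e_approx_0 less_e_pairs approx_set_0)
next
  case (Suc i)
  let ?F = "e_approx code i" and ?\<rho> = "(2 * N + 1) * i"
  have IH: "represents ?\<rho> (row code ?F q) (approx_set i q)" if "q \<in> states T" for q using Suc that by simp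
  have inv: "invariant ?\<rho> (approx_set i q)" if "q \<in> states T" for q
    using invariant_approx_set[OF exact _ that] Suc.prems(1) by simp
  have le: "(2 * N + 1) * i \<le> (2 * N + 1) * e_rounds code"
    using Suc.prems(1) by (intro mult_le_mono) auto
  have \<rho>: "?\<rho> + (2 * N + 1) \<le> e_last code" "?\<rho> + N + 1 \<le> top_rank"
    using le unfolding last_eq by (simp_all add: top_rank_def algebra_simps)
  let ?X = "\<lambda>a. Val (vars G) - (\<Union>q'\<in>weak_step \<tau> T a `` {q}. approx_set i q')"
  have un: "represents ?\<rho> (unmatched_row code ?F a q) (?X a)" for a
    unfolding represents_def
  proof (intro allI impI)
    fix v assume v: "v < e_vmax code" "in_box code ?\<rho> v"
    have "mem v (unmatched_row code ?F a q) \<longleftrightarrow>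
        \<not> (\<exists>q'\<in>states T. (q, q') \<in> weak_step \<tau> T a \<and> mem (prod_encode (q', v)) ?F)"
      using v(1) field_less(3) by (auto simp: unmatched_row_def t_weak_iff[OF Suc.prems(2)])
    also have "\<dots> \<longleftrightarrow> \<not> (\<exists>q'\<in>states T. (q, q') \<in> weak_step \<tau> T a \<and> val v \<in> approx_set i q')"
      using representsD[OF IH v] mem_row[OF v(1)] by blast
    also have "\<dots> \<longleftrightarrow> val v \<in> ?X a" using weak_step_T_states[OF Suc.prems(2)] by auto
    finally show "mem v (unmatched_row code ?F a q) \<longleftrightarrow> val v \<in> ?X a" .
  qed
  have invX: "invariant ?\<rho> (?X a)" for a
    using weak_step_T_states[OF Suc.prems(2)] by (intro invariant_Diff invariant_Val invariant_Union inv) blast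
  have rk: "?\<rho> + (2 * N + 1) = (2 * N + 1) * Suc i" by simp
  have w1: "represents ((2 * N + 1) * Suc i) (e_wpre code a ?\<rho> (unmatched_row code ?F a q)) (wpre a (?X a))" for a
    using represents_wpre[OF un invX \<rho>(1)] unfolding rk .
  have w2: "represents ((2 * N + 1) * Suc i) (e_wpre code a ?\<rho> (row code ?F q')) (wpre a (approx_set i q'))"
    if "q' \<in> states T" for a q'
    using represents_wpre[OF IH[OF that] inv[OF that] \<rho>(1)] unfolding rk .
  show ?case
    unfolding represents_def
  proof (intro allI impI)
    fix v assume v: "v < e_vmax code" "in_box code ((2 * N + 1) * Suc i) v"
    have "mem v (row code (e_approx code (Suc i)) q) \<longleftrightarrow> refined code ?\<rho> ?F (prod_encode (q, v))"
      using mem_row[OF v(1)] less_e_pairs[OF Suc.prems(2) v(1)] by (simp add: e_approx_Suc)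
    also have "\<dots> \<longleftrightarrow> (\<forall>a\<in>acts G.
        (\<forall>q'\<in>states T. (q, q') \<in> weak_step \<tau> T a \<longrightarrow> mem v (e_wpre code a ?\<rho> (row code ?F q'))) \<and>
        \<not> mem v (e_wpre code a ?\<rho> (unmatched_row code ?F a q)))"
      unfolding refined_def p1_encode p2_encode mem_field t_weak_iff[OF Suc.prems(2)]
      using field_less(2,3) by blast
    also have "\<dots> \<longleftrightarrow> (\<forall>a\<in>acts G.
        (\<forall>q'\<in>states T. (q, q') \<in> weak_step \<tau> T a \<longrightarrow> val v \<in> wpre a (approx_set i q')) \<and>
        val v \<notin> wpre a (?X a))"
      using representsD[OF w1 v] representsD[OF w2 v] by simp
    also have "\<dots> \<longleftrightarrow> val v \<in> approx_set (Suc i) q"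
      using weak_step_T_states[OF Suc.prems(2)] val_Val
      by (subst approx_set_Suc[OF exact Suc.prems(2) inv \<rho>(2)]) auto
    finally show "mem v (row code (e_approx code (Suc i)) q) \<longleftrightarrow> val v \<in> approx_set (Suc i) q" .
  qed
qed

lemma represents_bisimilar:
  assumes exact: star_exact
  shows "represents (e_last code) (e_bisimilar code) (bisimilar_valuations G \<tau> T s)"
proof -
  let ?k = "e_rounds code" and ?F = "e_approx code (Suc (e_rounds code))"
  let ?\<rho> = "(2 * N + 1) * Suc ?k" and ?Y = "Val (vars G) - (\<Union>q\<in>states T. approx_set (Suc ?k) q)"
  have r: "represents ?\<rho> (row code ?F q) (approx_set (Suc ?k) q)" if "q \<in> states T" for q
    using represents_approx[OF exact _ that, of "Suc ?k"] by simp
  have inv: "invariant ?\<rho> (approx_set (Suc ?k) q)" if "q \<in> states T" for q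
    using invariant_approx_set[OF exact _ that, of "Suc ?k"] by simp
  have le: "?\<rho> \<le> e_last code" "?\<rho> + N \<le> e_last code" unfolding last_eq by (simp_all add: top_rank_def)
  have "represents ?\<rho> (uncovered code ?F) ?Y"
    unfolding represents_def
  proof (intro allI impI)
    fix v assume v: "v < e_vmax code" "in_box code ?\<rho> v"
    have "mem v (uncovered code ?F) \<longleftrightarrow> \<not> (\<exists>q\<in>states T. mem (prod_encode (q, v)) ?F)"
      using v(1) field_less(3) by (auto simp: uncovered_def)
    also have "\<dots> \<longleftrightarrow> \<not> (\<exists>q\<in>states T. val v \<in> approx_set (Suc ?k) q)"
      using representsD[OF r v] mem_row[OF v(1)] by blast
    finally show "mem v (uncovered code ?F) \<longleftrightarrow> val v \<in> ?Y" by simp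
  qed
  moreover have "invariant ?\<rho> ?Y" by (intro invariant_Diff invariant_Val invariant_Union inv)
  ultimately have "represents (?\<rho> + N) (e_star code (mode None) ?\<rho> (uncovered code ?F) N) (star N (gstep G None) ?Y)"
    using le(2) by (rule represents_star)
  from represents_mono[OF this le(2)]
  have st: "represents (e_last code) (e_star code 0 ?\<rho> (uncovered code ?F) N) (star N (gstep G None) ?Y)" by simp
  show ?thesis
    unfolding represents_def
  proof (intro allI impI)
    fix v assume v: "v < e_vmax code" "in_box code (e_last code) v"
    have "mem v (e_bisimilar code) \<longleftrightarrow> mem v (row code ?F s) \<and> \<not> mem v (e_star code 0 ?\<rho> (uncovered code ?F) N)"
      using v(1) by (simp add: e_bisimilar_def Let_def mem_row field_code(8,9))
    also have "\<dots> \<longleftrightarrow> val v \<in> bisimilar_valuations G \<tau> T s"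
      using representsD[OF represents_mono[OF r[OF inst'(6)] le(1)] v] representsD[OF st v]
      unfolding bisimilar_valuations_eq(1)[OF exact inst'(6)] by simp
    finally show "mem v (e_bisimilar code) \<longleftrightarrow> val v \<in> bisimilar_valuations G \<tau> T s" .
  qed
qed

end

subsection \<open>Clause codes\<close>

context encoded_instance
begin

lemma e_trm_iff: "e_trm code t \<longleftrightarrow> t \<in> encode_trm ` trms_over (vars G) (consts_of G)"
proof
  assume t: "e_trm code t"
  show "t \<in> encode_trm ` trms_over (vars G) (consts_of G)"
  proof (cases "t mod 2 = 0")
    case True
    then have "t = encode_trm (V (t div 2))" "t div 2 \<in> vars G"
      using t by (auto simp: e_trm_def encode_trm_simps simp del: encode_trm.simps)
    then show ?thesis unfolding trms_over_def by (metis UnCI image_eqI)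
  next
    case False
    then obtain d where d: "d \<in> consts_of G" "t div 2 = int_encode d" using t by (auto simp: e_trm_def)
    have "t = encode_trm (C d)"
      unfolding encode_trm_simps d(2)[symmetric] using False by presburger
    then show ?thesis using d(1) unfolding trms_over_def by (metis UnCI image_eqI)
  qed
next
  assume "t \<in> encode_trm ` trms_over (vars G) (consts_of G)"
  then show "e_trm code t" by (auto simp: e_trm_def trms_over_def encode_trm_simps simp del: encode_trm.simps)
qed

lemma e_clause_iff: "e_clause code cl \<longleftrightarrow> cl \<in> encode_clause ` clauses top_rank"
proof
  assume cl: "e_clause code cl"
  then obtain t u where tu: "t \<in> trms_over (vars G) (consts_of G)" "p1 cl = encode_trm t"
    "u \<in> trms_over (vars G) (consts_of G)" "p1 (p2 cl) = encode_trm u"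
    unfolding e_clause_def e_trm_iff by blast
  let ?c = "Gap t u (int_decode (p2 (p2 cl)))"
  have "\<bar>int_decode (p2 (p2 cl))\<bar> \<le> level top_rank"
    using cl by (auto simp: e_clause_def top_eq level_eq)
  then have "?c \<in> clauses top_rank" using tu by (auto simp: clauses_def)
  moreover have "encode_clause ?c = cl" by (simp add: tu(2,4)[symmetric])
  ultimately show "cl \<in> encode_clause ` clauses top_rank" by (metis image_eqI)
next
  assume "cl \<in> encode_clause ` clauses top_rank"
  then show "e_clause code cl"
    by (auto simp: clauses_def e_clause_def e_trm_iff top_eq level_eq abs_le_iff simp del: encode_trm.simps)
qed

lemma tval_encode: "t \<in> trms_over (vars G) (consts_of G) \<Longrightarrow> tval code v (encode_trm t) = trm_val (val v) t"
  by (auto simp: trms_over_def tval_def encode_trm_simps val_def simp del: encode_trm.simps)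

lemma sat_encode: "cl \<in> clauses \<rho> \<Longrightarrow> sat code v (encode_clause cl) \<longleftrightarrow> clause_sat (val v) cl"
  by (auto simp: clauses_def sat_def tval_encode simp del: encode_trm.simps)

lemma encode_clause_less: "cl \<in> clauses top_rank \<Longrightarrow> encode_clause cl < e_clause_bound code"
proof -
  assume "cl \<in> clauses top_rank"
  then obtain t u k where cl: "cl = Gap t u k" "t \<in> trms_over (vars G) (consts_of G)"
    "u \<in> trms_over (vars G) (consts_of G)" "\<bar>k\<bar> \<le> level top_rank" by (auto simp: clauses_def)
  let ?b = "2 * (e_vars code + e_consts code) + 1"
  have trm: "encode_trm r \<le> ?b" if "r \<in> trms_over (vars G) (consts_of G)" for r
  proof (cases r)
    case (V x)
    then have "x \<in> vars G" using that by (auto simp: trms_over_def)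
    then show ?thesis using V field_less(1)[of x] by (simp add: encode_trm_simps del: encode_trm.simps)
  next
    case (C d)
    then have "d \<in> consts_of G" using that by (auto simp: trms_over_def)
    then have "mem (int_encode d) (e_consts code)" by simp
    then have "int_encode d < e_consts code" by (rule mem_less)
    then show ?thesis using C by (simp add: encode_trm_simps del: encode_trm.simps)
  qed
  have "int_encode k \<le> 2 * e_level code (e_top code)"
    by (rule int_encode_le) (use cl(4) in \<open>simp add: level_eq top_eq\<close>)
  then show ?thesis
    unfolding cl(1) encode_clause.simps e_clause_bound_def Let_def less_Suc_eq_le
    by (intro prod_encode_mono trm cl)
qed

lemma e_eqv_iff: "e_eqv code u v \<longleftrightarrow> val_eqv G (level top_rank) (val u) (val v)"
proof -
  have "e_eqv code u v \<longleftrightarrow> (\<forall>cl\<in>clauses top_rank. sat code u (encode_clause cl) \<longleftrightarrow> sat code v (encode_clause cl))"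
    unfolding e_eqv_def e_clause_iff using encode_clause_less by blast
  then show ?thesis unfolding val_eqv_iff_clauses using sat_encode by simp
qed

subsection \<open>The stopping criterion\<close>

definition eqv_class :: "(nat \<Rightarrow> int) \<Rightarrow> (nat \<Rightarrow> int) set" where
  "eqv_class \<mu> = {\<nu> \<in> Val (vars G). val_eqv G (level top_rank) \<nu> \<mu>}"

lemma invariant_eqv_class: "invariant top_rank (eqv_class \<mu>)"
proof (rule invariantI)
  show "\<nu>' \<in> eqv_class \<mu>" if "\<nu> \<in> eqv_class \<mu>" "\<nu>' \<in> Val (vars G)" "val_eqv G (level top_rank) \<nu> \<nu>'" for \<nu> \<nu>'
    using that gap_eqv_trans gap_eqv_sym unfolding eqv_class_def val_eqv_def by blast
qed (auto simp: eqv_class_def)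

lemma represents_class: "represents \<rho> (e_class code u) (eqv_class (val u))"
  by (simp add: represents_def e_class_def e_eqv_iff eqv_class_def)

lemma stationary_iff:
  "stationary code (mode m) \<longleftrightarrow>
     (\<forall>u<e_vmax code. star (Suc N) (gstep G m) (eqv_class (val u)) \<subseteq> star N (gstep G m) (eqv_class (val u)))"
proof -
  have "(\<forall>v<e_vmax code. in_box code (e_last code) v \<longrightarrow>
      mem v (e_star code (mode m) (e_top code) (e_class code u) (Suc (e_N code))) \<longrightarrow>
      mem v (e_star code (mode m) (e_top code) (e_class code u) (e_N code))) \<longleftrightarrow>
    star (Suc N) (gstep G m) (eqv_class (val u)) \<subseteq> star N (gstep G m) (eqv_class (val u))" (is "?l \<longleftrightarrow> ?A \<subseteq> ?B") for u
  proof -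
    have last: "top_rank + Suc N = e_last code" by (simp add: last_eq)
    have A: "represents (e_last code) (e_star code (mode m) (e_top code) (e_class code u) (Suc (e_N code))) ?A"
      using represents_star[OF represents_class invariant_eqv_class, of "Suc N"] last
      by (simp add: top_eq field_code(9) del: e_star_Suc star_Suc)
    have "represents (top_rank + N) (e_star code (mode m) (e_top code) (e_class code u) (e_N code)) ?B"
      using represents_star[OF represents_class invariant_eqv_class, of N] last
      by (simp add: top_eq field_code(9) del: e_star_Suc star_Suc)
    then have B: "represents (e_last code) (e_star code (mode m) (e_top code) (e_class code u) (e_N code)) ?B"
      by (rule represents_mono) (simp add: last_eq)
    have "invariant (e_last code) ?A"
      using invariant_star[OF invariant_eqv_class, of "Suc N"] unfolding last .
    moreover have "invariant (e_last code) ?B"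
      by (rule invariant_mono[OF invariant_star[OF invariant_eqv_class]]) (simp add: last_eq)
    ultimately have inv: "invariant (e_last code) (?A - ?B)" by (rule invariant_Diff)
    have "?l \<longleftrightarrow> (\<forall>v<e_vmax code. in_box code (e_last code) v \<longrightarrow> val v \<notin> ?A - ?B)"
      using representsD[OF A] representsD[OF B] by blast
    also have "\<dots> \<longleftrightarrow> ?A - ?B = {}"
    proof (intro iffI equals0I)
      fix \<nu> assume none: "\<forall>v<e_vmax code. in_box code (e_last code) v \<longrightarrow> val v \<notin> ?A - ?B" and \<nu>: "\<nu> \<in> ?A - ?B"
      have V: "\<nu> \<in> Val (vars G)" using \<nu> invariant_subset[OF inv] by blast
      from ex_representative_code[OF V order.refl] obtain v where
        v: "v < e_vmax code" "in_box code (e_last code) v" "val_eqv G (level (e_last code)) \<nu> (val v)" by blast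
      from invariantD[OF inv V val_Val v(3) \<nu>] none v(1,2) show False by blast
    qed blast
    finally show ?thesis by blast
  qed
  then show ?thesis unfolding stationary_def by simp
qed

lemma star_exact_if_check:
  assumes "e_check code" shows star_exact
  unfolding star_exact_def
proof (intro ballI allI impI star_closed)
  fix m X assume m: "m \<in> {None, Some \<tau>}" and X: "invariant top_rank X"
  have "stationary code (mode m)" using assms m by (auto simp: e_check_def field_code(5))
  then have stat: "star (Suc N) (gstep G m) (eqv_class (val u)) \<subseteq> star N (gstep G m) (eqv_class (val u))"
    if "u < e_vmax code" for u using that unfolding stationary_iff by blast
  define U where "U = {u. u < e_vmax code \<and> eqv_class (val u) \<subseteq> X}"
  have eq: "X = (\<Union>u\<in>U. eqv_class (val u))"
  proof (intro equalityI subsetI)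
    fix \<nu> assume \<nu>: "\<nu> \<in> X"
    then have V: "\<nu> \<in> Val (vars G)" using invariant_subset[OF X] by blast
    from ex_representative_code[OF V, of top_rank] obtain u where
      u: "u < e_vmax code" "val_eqv G (level top_rank) \<nu> (val u)" by (auto simp: last_eq)
    have uX: "val u \<in> X" using invariantD[OF X V val_Val u(2) \<nu>] .
    have "eqv_class (val u) \<subseteq> X"
      using invariantD[OF X val_Val _ val_eqv_sym uX] unfolding eqv_class_def by blast
    then show "\<nu> \<in> (\<Union>u\<in>U. eqv_class (val u))" using u V unfolding U_def eqv_class_def by blast
  qed (auto simp: U_def)
  have star_X: "star i (gstep G m) X = (\<Union>u\<in>U. star i (gstep G m) (eqv_class (val u)))" for i
    by (subst eq) (rule star_Union)
  show "star (Suc N) (gstep G m) X \<subseteq> star N (gstep G m) X"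
    unfolding star_X by (rule UN_mono[OF order.refl], rule stat) (simp add: U_def)
qed

lemma check_if_bound:
  assumes "\<And>m. m \<in> {None, Some \<tau>} \<Longrightarrow> (gstep G m)\<^sup>* \<subseteq> (\<Union>i\<le>N. gstep G m ^^ i)"
  shows "e_check code"
proof -
  have "stationary code (mode m)" if m: "m \<in> {None, Some \<tau>}" for m
  proof -
    have "star (Suc N) (gstep G m) Y \<subseteq> star N (gstep G m) Y" for Y
    proof (rule order.trans[OF star_subset_rtrancl])
      show "((gstep G m)\<^sup>*)\<inverse> `` Y \<subseteq> star N (gstep G m) Y" unfolding star_eq using assms[OF m] by blast
    qed
    then show ?thesis unfolding stationary_iff by blast
  qed
  from this[of None] this[of "Some \<tau>"] show ?thesis by (simp add: e_check_def field_code(5))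
qed

subsection \<open>The output\<close>

definition clause_of :: "nat \<Rightarrow> nat gap_clause" where
  "clause_of = inv_into (clauses top_rank) encode_clause"

lemma clause_of: "cl \<in> clauses top_rank \<Longrightarrow> clause_of (encode_clause cl) = cl"
  unfolding clause_of_def by (intro inv_into_f_f) (auto intro: inj_onI inj_encode_clause)

definition char_formula :: "nat \<Rightarrow> nat gap_formula" where
  "char_formula v = big_and (\<lambda>i. if e_clause code i then literal (val v) (clause_of i) else FTrue) (e_clause_bound code)"

definition output_formula :: "nat gap_formula" where
  "output_formula = big_or (\<lambda>v. if in_box code (e_last code) v \<and> mem v (e_bisimilar code)
     then char_formula v else FNot FTrue) (e_vmax code)"

lemma encode_big_and:
  "encode_formula (big_and f m) = rec_nat (prod_encode (0, 0)) (\<lambda>i r. prod_encode (3, prod_encode (encode_formula (f i), r))) m"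
  by (induction m) simp_all

lemma encode_big_or:
  "encode_formula (big_or f m) =
     rec_nat (prod_encode (2, prod_encode (0, 0))) (\<lambda>i r. prod_encode (4, prod_encode (encode_formula (f i), r))) m"
  by (induction m) simp_all

lemma e_literal_eq: "e_literal code v i = encode_formula (if e_clause code i then literal (val v) (clause_of i) else FTrue)"
proof (cases "e_clause code i")
  case True
  then obtain cl where cl: "cl \<in> clauses top_rank" "i = encode_clause cl" unfolding e_clause_iff by blast
  have "sat code v i \<longleftrightarrow> clause_sat (val v) cl" unfolding cl(2) by (rule sat_encode[OF cl(1)])
  then show ?thesis using True cl(2) clause_of[OF cl(1)] by (simp add: e_literal_def literal_def)
qed (simp add: e_literal_def)

lemma e_output_eq: "e_output code = encode_formula output_formula"
  unfolding e_output_def output_formula_def encode_big_or e_char_def char_formula_def e_literal_eq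
    encode_big_and[symmetric] by (simp add: if_distrib[of encode_formula] cong: if_cong)

lemma formula_over_output: "formula_over (vars G) (consts_of G) output_formula"
proof -
  have "clause_over (vars G) (consts_of G) (clause_of i)" if "e_clause code i" for i
    using that clause_of clause_over_clauses unfolding e_clause_iff by fastforce
  then show ?thesis
    unfolding output_formula_def char_formula_def by (auto intro!: formula_over_big_or formula_over_big_and)
qed

lemma formula_sat_char: "formula_sat \<mu> (char_formula v) \<longleftrightarrow> val_eqv G (level top_rank) (val v) \<mu>"
proof -
  have "formula_sat \<mu> (char_formula v) \<longleftrightarrow>
      (\<forall>i<e_clause_bound code. e_clause code i \<longrightarrow> (clause_sat (val v) (clause_of i) \<longleftrightarrow> clause_sat \<mu> (clause_of i)))"
    by (auto simp: char_formula_def)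
  also have "\<dots> \<longleftrightarrow> (\<forall>cl\<in>clauses top_rank. clause_sat (val v) (clause_of (encode_clause cl)) \<longleftrightarrow>
      clause_sat \<mu> (clause_of (encode_clause cl)))"
    unfolding e_clause_iff using encode_clause_less by blast
  finally show ?thesis by (simp add: val_eqv_iff_clauses clause_of)
qed

lemma defines_output:
  assumes "e_check code"
  shows "defines_set (vars G) (consts_of G) output_formula (bisimilar_valuations G \<tau> T s)"
proof -
  have exact: star_exact using assms by (rule star_exact_if_check)
  let ?X = "bisimilar_valuations G \<tau> T s"
  have inv: "invariant top_rank ?X" by (rule bisimilar_valuations_eq(2)[OF exact inst'(6)])
  have "\<mu> \<in> ?X \<longleftrightarrow> formula_sat \<mu> output_formula" if \<mu>: "\<mu> \<in> Val (vars G)" for \<mu>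
  proof -
    have "formula_sat \<mu> output_formula \<longleftrightarrow> (\<exists>v<e_vmax code. in_box code (e_last code) v \<and> val v \<in> ?X \<and>
        val_eqv G (level top_rank) (val v) \<mu>)"
      unfolding output_formula_def formula_sat_big_or using formula_sat_char representsD[OF represents_bisimilar[OF exact]]
      by (auto split: if_splits)
    also have "\<dots> \<longleftrightarrow> \<mu> \<in> ?X"
    proof
      assume "\<exists>v<e_vmax code. in_box code (e_last code) v \<and> val v \<in> ?X \<and> val_eqv G (level top_rank) (val v) \<mu>"
      then show "\<mu> \<in> ?X" using invariantD[OF inv val_Val \<mu>] by blast
    next
      assume "\<mu> \<in> ?X"
      obtain v where v: "v < e_vmax code" "in_box code (e_last code) v" "val_eqv G (level top_rank) \<mu> (val v)"
        using ex_representative_code[OF \<mu>, of top_rank] by (auto simp: last_eq)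
      with invariantD[OF inv \<mu> val_Val v(3) \<open>\<mu> \<in> ?X\<close>] val_eqv_sym
      show "\<exists>v<e_vmax code. in_box code (e_last code) v \<and> val v \<in> ?X \<and> val_eqv G (level top_rank) (val v) \<mu>" by blast
    qed
    finally show ?thesis by blast
  qed
  then show ?thesis
    using formula_over_output invariant_subset[OF inv] unfolding defines_set_def by blast
qed

end

theorem theorem4:
  "(\<forall>(G :: ('x, 'a) gcs) \<tau> (T :: ('s, 'a) lts) s. bisim_instance G \<tau> T s \<longrightarrow>
      gap_definable (vars G) (consts_of G) (bisimilar_valuations G \<tau> T s)) \<and>
   (\<exists>f. partial_recursive f \<and>
      (\<forall>(G :: (nat, nat) gcs) \<tau> (T :: (nat, nat) lts) s. bisim_instance G \<tau> T s \<longrightarrow>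
         (\<exists>\<phi>. f (encode_instance G \<tau> T s) = Some (encode_formula \<phi>) \<and>
              defines_set (vars G) (consts_of G) \<phi> (bisimilar_valuations G \<tau> T s))))"
proof (intro conjI)
  show "\<forall>(G :: ('x, 'a) gcs) \<tau> (T :: ('s, 'a) lts) s. bisim_instance G \<tau> T s \<longrightarrow>
      gap_definable (vars G) (consts_of G) (bisimilar_valuations G \<tau> T s)"
    using gap_definable_bisimilar_valuations by blast
next
  let ?P = "\<lambda>n N. e_check (prod_encode (n, N))" and ?F = "\<lambda>n N. e_output (prod_encode (n, N))"
  let ?f = "\<lambda>n. if \<exists>N. ?P n N then Some (?F n (LEAST N. ?P n N)) else None"
  have "partial_recursive ?f"
    by (rule partial_recursive_search) (use decidable_e_check computable_e_output in simp_all)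
  moreover have "\<exists>\<phi>. ?f (encode_instance G \<tau> T s) = Some (encode_formula \<phi>) \<and>
      defines_set (vars G) (consts_of G) \<phi> (bisimilar_valuations G \<tau> T s)"
    if inst: "bisim_instance G \<tau> T s" for G :: "(nat, nat) gcs" and \<tau> and T :: "(nat, nat) lts" and s
  proof -
    have inst': "encoded_instance G \<tau> T s" using inst by unfold_locales
    let ?n = "encode_instance G \<tau> T s"
    have code: "encoded_instance.code G \<tau> T s N = prod_encode (?n, N)" for N
      using encoded_instance.code_def[OF inst'] .
    have "wf_gcs G" using inst by (simp add: bisim_instance_def)
    from ex_gstep_bound[OF this, of \<tau>] obtain N where
      N: "\<forall>m\<in>{None, Some \<tau>}. (gstep G m)\<^sup>* \<subseteq> (\<Union>i\<le>N. gstep G m ^^ i)" ..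
    have "?P ?n N"
      using encoded_instance.check_if_bound[OF inst', OF bspec[OF N]] unfolding code .
    then have ex: "\<exists>N. ?P ?n N" and check: "?P ?n (LEAST N. ?P ?n N)" by (auto intro: LeastI)
    let ?N = "LEAST N. ?P ?n N"
    have "?F ?n ?N = encode_formula (encoded_instance.output_formula G \<tau> T s ?N)"
      using encoded_instance.e_output_eq[OF inst', of ?N] unfolding code .
    moreover have "defines_set (vars G) (consts_of G) (encoded_instance.output_formula G \<tau> T s ?N)
        (bisimilar_valuations G \<tau> T s)"
      using encoded_instance.defines_output[OF inst', of ?N] check unfolding code by blast
    ultimately show ?thesis using ex by auto
  qed
  ultimately show "\<exists>f. partial_recursive f \<and>
      (\<forall>(G :: (nat, nat) gcs) \<tau> (T :: (nat, nat) lts) s. bisim_instance G \<tau> T s \<longrightarrow>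
         (\<exists>\<phi>. f (encode_instance G \<tau> T s) = Some (encode_formula \<phi>) \<and>
              defines_set (vars G) (consts_of G) \<phi> (bisimilar_valuations G \<tau> T s)))"
    by blast
qed

end
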